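(* There exists an absolute constant $c_1>0$ such that the following holds. Let $\tau>0$ and let $F=\mathcal{L}(\xi)\in\mathcal{A}_1(\tau)$ be the distribution of a real random variable $\xi$ with $\mathbf{E}\,\xi=0$. Let $\Phi=\Phi_F$ be the normal distribution with mean zero and the same variance as $F$. Then $$\inf_{\pi}\int \exp\{|x-y|/(c_1\tau)\}\,d\pi(x,y)\le c_1,$$ where the infimum is taken over all probability distributions $\pi$ on $\mathbf{R}^2$ with marginal distributions $F$ and $\Phi$.
   Context: For $\tau\ge 0$, $\mathcal{A}_1(\tau)$ denotes the class of probability distributions $F$ on $\mathbf{R}$ for which the function $$\varphi(z)=\varphi(F,z)=\log\int_{\mathbf{R}} e^{zx}\,F\{dx\}\qquad(\varphi(0)=0)$$ is defined and analytic for all $z\in\mathbf{C}$ with $|z|\tau<1$, and satisfies $$|\varphi'''(z)|\le \tau\,\sigma^2\qquad\text{for all } z\in\mathbf{C},\ |z|\tau<1,$$ where $\sigma^2$ is the variance of $F$. A normal distribution with variance zero is understood as the degenerate distribution at its mean. $\mathcal{L}(\xi)$ denotes the distribution of $\xi$. An absolute constant is one that does not depend on $\tau$, $F$ or any other parameter. *)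

theory Defs
  imports "HOL-Probability.Probability" "HOL-Complex_Analysis.Complex_Analysis"
begin

definition real_distribution :: "real measure \<Rightarrow> bool" where
  "real_distribution F \<longleftrightarrow> prob_space F \<and> sets F = sets borel"

text \<open>
  The branch of the logarithm of the Laplace transform of \<open>F\<close> on an open connected set \<open>D\<close>
  containing \<open>0\<close> is singled out by analyticity together with \<open>\<phi> 0 = 0\<close>. It need not be the
  principal branch. Integrability is required explicitly, since the Bochner integral is total.
\<close>

definition is_log_laplace :: "real measure \<Rightarrow> complex set \<Rightarrow> (complex \<Rightarrow> complex) \<Rightarrow> bool" where
  "is_log_laplace F D \<phi> \<longleftrightarrow>
     \<phi> analytic_on D \<and> \<phi> 0 = 0 \<and>
     (\<forall>z\<in>D. integrable F (\<lambda>x. exp (z * complex_of_real x)) \<and>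
             exp (\<phi> z) = (\<integral>x. exp (z * complex_of_real x) \<partial>F))"

definition class_A1 :: "real \<Rightarrow> real measure set" where
  "class_A1 \<tau> = {F. real_distribution F \<and>
     (\<exists>\<phi>. is_log_laplace F {z. cmod z * \<tau> < 1} \<phi> \<and>
          (\<forall>z. cmod z * \<tau> < 1 \<longrightarrow>
               cmod ((deriv ^^ 3) \<phi> z) \<le> \<tau> * prob_space.variance F (\<lambda>x. x)))}"

text \<open>The second parameter is the variance; \<open>normal_density\<close> takes the standard deviation.\<close>

definition normal_distribution :: "real \<Rightarrow> real \<Rightarrow> real measure" where
  "normal_distribution m v =
     (if v = 0 then return borel m
      else density lborel (\<lambda>x. ennreal (normal_density m (sqrt v) x)))"

definition couplings :: "real measure \<Rightarrow> real measure \<Rightarrow> (real \<times> real) measure set" where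
  "couplings F G = {P. prob_space P \<and> sets P = sets borel \<and>
                       distr P borel fst = F \<and> distr P borel snd = G}"

end

theory Submission
  imports Defs
begin

text \<open>
  After rescaling the variance is 1 and the class parameter is \<open>\<rho> = \<tau> / \<sigma>\<close>. If \<open>\<rho>\<close> is bounded below, both
  marginals have bounded exponential moments at scale \<open>\<tau>\<close> and independent coordinates suffice.
  Otherwise use the quantile coupling. For \<open>0 \<le> h\<close> of order at most \<open>1 / \<rho>\<close> the exponentially tilted
  distribution has a characteristic function close to a Gaussian one for frequencies up to
  \<open>1 / (4 \<rho>)\<close>, so Esseen's smoothing inequality gives a Berry-Esseen bound of order \<open>\<rho>\<close>. Undoing the tilt
  compares \<open>P (\<xi> > \<phi>' h)\<close> with the Gaussian tail at \<open>h\<close> up to a factor \<open>exp (O (\<rho> (1 + h) (1 + h\<^sup>2)))\<close>.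
  A shift of the argument by \<open>K \<rho> (1 + h\<^sup>2)\<close> changes the Gaussian tail by at least this factor, hence
  quantile-coupled \<open>x\<close>, \<open>y\<close> satisfy \<open>\<bar>x - y\<bar> = O (\<rho> (1 + y\<^sup>2))\<close> for \<open>\<bar>x\<bar>\<close> of order at most \<open>1 / \<rho>\<close>; larger
  \<open>\<bar>x\<bar>\<close> are handled by Chernoff's bound.
\<close>

text \<open>An error of order \<rho>(1 + y^2) is tolerable because |x - y|/(c \<rho>) is then at
  most a constant plus y^2/4, and exp(y^2/4) is integrable against the Gaussian law. The obstacle is
  that Berry-Esseen bounds are additive while tails decay like exp(-h^2/2). Tilting by h moves the
  tail event at \<phi>'(h) to the centre; what remains of the Gaussian tail is a half-line Laplace
  transform, of size at least a constant times 1/(1 + h), so an additive error of order \<rho>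
  becomes a relative error of order \<rho>(1 + h). The Taylor remainder of \<phi> costs a further
  \<rho> h^3 in the exponent. Both fit under \<rho>(1 + h)(1 + h^2). The logarithmic slope of the
  Gaussian tail at h is about 1 + h, so a shift of order \<rho>(1 + h^2) pays for them. In the far
  region x and y are not compared at all: with h = 1/(8 K \<rho>) the condition |x| >= 2h yields a
  factor exp(-h^2), which cancels the growth in E exp(h|x|) <= 2 exp(h^2).\<close>

text \<open>\<open>Defs\<close> hides the locale predicate of the same base name; this is the library version.\<close>

abbreviation "rdist \<equiv> Distribution_Functions.real_distribution"

subsection \<open>The Fejer kernel\<close>

text \<open>The integral equals pi. It only normalises, so finiteness and positivity suffice and its
  value stays unevaluated.\<close>

definition fejer_mass :: real where
  "fejer_mass = (\<integral>x. (1 - cos x) / x\<^sup>2 \<partial>lborel)"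

text \<open>At 0 the division convention gives the value 0 instead of the limit; this affects only a
  null set.\<close>

definition fejer_density :: "real \<Rightarrow> real" where
  "fejer_density x = (1 - cos x) / x\<^sup>2 / fejer_mass"

definition fejer_measure :: "real measure" where
  "fejer_measure = density lborel (\<lambda>x. ennreal (fejer_density x))"

text \<open>Adding 1 - cos x <= x^2/2, sharp near 0, to (1 - cos x) x^2 <= 2 x^2, sharp at infinity,
  yields one integrable majorant for the whole line.\<close>

lemma fejer_bound: "(1 - cos x) / x\<^sup>2 \<le> 3 * inverse (1 + x\<^sup>2)" for x :: real
proof (cases "x = 0")
  case False
  have "1 - cos x = 2 * (sin (x / 2))\<^sup>2"
    using cos_double_sin[of "x / 2"] by simp
  moreover have "(sin (x / 2))\<^sup>2 \<le> (x / 2)\<^sup>2"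
    using abs_sin_x_le_abs_x[of "x / 2"] abs_le_square_iff by blast
  ultimately have 1: "1 - cos x \<le> x\<^sup>2 / 2" by (simp add: power2_eq_square)
  have "(1 - cos x) * (1 + x\<^sup>2) = (1 - cos x) + (1 - cos x) * x\<^sup>2" by algebra
  also have "\<dots> \<le> x\<^sup>2 / 2 + 2 * x\<^sup>2"
    using 1 cos_ge_minus_one[of x] by (intro add_mono mult_right_mono) (auto simp del: cos_ge_minus_one)
  also have "\<dots> \<le> 3 * x\<^sup>2" by simp
  finally have "(1 - cos x) * (1 + x\<^sup>2) \<le> 3 * x\<^sup>2" .
  moreover have "1 + x\<^sup>2 > 0" by (simp add: add_pos_nonneg)
  ultimately show ?thesis
    using False by (simp add: field_simps)
qed simp

lemma integrable_fejer: "integrable lborel (\<lambda>x::real. (1 - cos x) / x\<^sup>2)"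
proof (rule Bochner_Integration.integrable_bound)
  have "integrable lborel (\<lambda>x::real. inverse (1 + x\<^sup>2))"
    using integrable_inverse_1_plus_square by (simp add: set_integrable_def)
  then show "integrable lborel (\<lambda>x::real. 3 * inverse (1 + x\<^sup>2))" by simp
  show "AE x::real in lborel. norm ((1 - cos x) / x\<^sup>2) \<le> norm (3 * inverse (1 + x\<^sup>2))"
    using fejer_bound by (auto intro!: AE_I2 order_trans[OF _ abs_ge_self])
qed simp

lemma fejer_mass_pos: "fejer_mass > 0"
proof -
  have "fejer_mass \<ge> 0" unfolding fejer_mass_def by (intro integral_nonneg_AE) auto
  moreover have "fejer_mass \<noteq> 0"
  proof
    assume "fejer_mass = 0"
    moreover have "AE x in lborel. 0 \<le> (1 - cos x) / (x::real)\<^sup>2" by simp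
    ultimately have "AE x::real in lborel. (1 - cos x) / x\<^sup>2 = 0"
      unfolding fejer_mass_def using integral_nonneg_eq_0_iff_AE[OF integrable_fejer] by blast
    \<comment> \<open>The interval [1, 2] lies inside (0, pi), where cos x < 1, and has positive
      measure.\<close>
    then have "AE x in lborel. \<not> (x \<in> {1..2::real})"
    proof eventually_elim
      case (elim x)
      show ?case
      proof
        assume x: "x \<in> {1..2}"
        with elim have "cos x = 1" by auto
        moreover have "cos x < cos 0"
          using x pi_gt3 by (intro cos_monotone_0_pi) auto
        ultimately show False by simp
      qed
    qed
    then have "emeasure lborel {1..2::real} = 0"
      by (subst (asm) AE_iff_measurable[of "{1..2}"]) auto
    then show False by simp
  qed
  ultimately show ?thesis by simp
qed

text \<open>Substituting a x contributes a^2 from the denominator and 1/|a| from the Jacobian. The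
  resulting |a| is what makes the Fejer transform piecewise linear.\<close>

lemma
  integrable_fejer_scaled: "integrable lborel (\<lambda>x::real. (1 - cos (a * x)) / x\<^sup>2)" and
  integral_fejer_scaled: "(\<integral>x. (1 - cos (a * x)) / x\<^sup>2 \<partial>lborel) = \<bar>a\<bar> * fejer_mass"
proof -
  have eq: "(1 - cos (a * x)) / x\<^sup>2 = a\<^sup>2 * ((1 - cos (0 + a * x)) / (0 + a * x)\<^sup>2)" for x
    by (cases "a = 0") (simp_all add: power_mult_distrib)
  show "integrable lborel (\<lambda>x::real. (1 - cos (a * x)) / x\<^sup>2)"
  proof (cases "a = 0")
    case False
    show ?thesis
      unfolding eq by (intro integrable_mult_right lborel_integrable_real_affine[OF integrable_fejer] False)
  qed simp
  show "(\<integral>x. (1 - cos (a * x)) / x\<^sup>2 \<partial>lborel) = \<bar>a\<bar> * fejer_mass"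
  proof (cases "a = 0")
    case False
    have "(\<integral>x. (1 - cos (a * x)) / x\<^sup>2 \<partial>lborel)
        = a\<^sup>2 * (\<integral>x. (1 - cos (0 + a * x)) / (0 + a * x)\<^sup>2 \<partial>lborel)"
      unfolding eq by (rule integral_mult_right_zero)
    also have "\<dots> = \<bar>a\<bar> * fejer_mass"
      unfolding fejer_mass_def
      using False by (subst (2) lborel_integral_real_affine[of a _ 0]) (auto simp: power2_eq_square)
    finally show ?thesis .
  qed simp
qed

lemma fejer_density_nonneg: "0 \<le> fejer_density x"
  using fejer_mass_pos by (simp add: fejer_density_def)

lemma borel_measurable_fejer_density[measurable]: "fejer_density \<in> borel_measurable borel"
  by (simp add: fejer_density_def[abs_def])

lemma integrable_fejer_density: "integrable lborel fejer_density"
  unfolding fejer_density_def[abs_def] by (intro Bochner_Integration.integrable_divide integrable_fejer)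

lemma real_distribution_fejer: "rdist fejer_measure"
proof -
  have "prob_space fejer_measure"
  proof
    have "emeasure fejer_measure (space fejer_measure)
        = (\<integral>\<^sup>+x. ennreal (fejer_density x) \<partial>lborel)"
      unfolding fejer_measure_def by (simp add: emeasure_density)
    also have "\<dots> = ennreal (\<integral>x. fejer_density x \<partial>lborel)"
      using integrable_fejer_density fejer_density_nonneg by (intro nn_integral_eq_integral) auto
    also have "(\<integral>x. fejer_density x \<partial>lborel) = fejer_mass / fejer_mass"
      unfolding fejer_density_def[abs_def] by (subst integral_divide_zero) (simp add: fejer_mass_def)
    also have "ennreal \<dots> = 1"
      using fejer_mass_pos by simp
    finally show "emeasure fejer_measure (space fejer_measure) = 1" .
  qed
  then show ?thesis
    by (auto simp: Distribution_Functions.real_distribution_def real_distribution_axioms_def fejer_measure_def)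
qed

text \<open>Since \<open>cos (t x) (1 - cos x)\<close> is a combination of terms \<open>1 - cos (a x)\<close>, the transform is
  the second difference of the absolute value, up to the same normalising constant.\<close>

lemma char_fejer_eq_0:
  assumes "\<bar>t\<bar> \<ge> 1"
  shows "char fejer_measure t = 0"
proof -
  let ?k = fejer_density
  let ?f = "\<lambda>x::real. ?k x *\<^sub>R iexp (t * x)"
  have int: "integrable lborel ?f"
    by (rule Bochner_Integration.integrable_bound[of _ ?k])
       (use integrable_fejer_density fejer_density_nonneg in \<open>auto simp: abs_mult\<close>)
  have char: "char fejer_measure t = (\<integral>x. ?f x \<partial>lborel)"
    unfolding char_def fejer_measure_def using fejer_density_nonneg
    by (subst integral_density) auto
  \<comment> \<open>The integrand is odd, so reflection shows that the imaginary part equals its own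
    negative.\<close>
  have "Im (char fejer_measure t) = (\<integral>x. ?k x * sin (t * x) \<partial>lborel)"
    unfolding char using int by (subst integral_Im[symmetric]) (auto simp: Im_exp)
  also have "\<dots> = \<bar>-1\<bar> *\<^sub>R (\<integral>x. ?k (0 + - 1 * x) * sin (t * (0 + -1 * x)) \<partial>lborel)"
    by (rule lborel_integral_real_affine) simp
  also have "\<dots> = - (\<integral>x. ?k x * sin (t * x) \<partial>lborel)" by (simp add: fejer_density_def)
  finally have Im: "Im (char fejer_measure t) = 0"
    using \<open>Im (char fejer_measure t) = (\<integral>x. ?k x * sin (t * x) \<partial>lborel)\<close> by simp
  let ?g = "\<lambda>a x::real. (1 - cos (a * x)) / x\<^sup>2"
  have *: "cos (t * x) * (1 - cos x) = 
      (1 - cos ((t + 1) * x)) / 2 + (1 - cos ((t - 1) * x)) / 2 - (1 - cos (t * x))" for x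
    by (simp add: cos_add cos_diff algebra_simps add_divide_distrib diff_divide_distrib)
  have eq: "?k x * cos (t * x) = (?g (t + 1) x / 2 + ?g (t - 1) x / 2 - ?g t x) / fejer_mass" for x
  proof -
    have "?k x * cos (t * x) = cos (t * x) * (1 - cos x) / x\<^sup>2 / fejer_mass" by (simp add: fejer_density_def)
    also have "\<dots> = (?g (t + 1) x / 2 + ?g (t - 1) x / 2 - ?g t x) / fejer_mass"
      unfolding * by (simp add: add_divide_distrib diff_divide_distrib)
    finally show ?thesis .
  qed
  have "Re (char fejer_measure t) = (\<integral>x. ?k x * cos (t * x) \<partial>lborel)"
    unfolding char using int by (subst integral_Re[symmetric]) (auto simp: Re_exp)
  also have "\<dots> = (\<bar>t + 1\<bar> * fejer_mass / 2 + \<bar>t - 1\<bar> * fejer_mass / 2 - \<bar>t\<bar> * fejer_mass) / fejer_mass"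
    unfolding eq using integrable_fejer_scaled[of "t + 1"] integrable_fejer_scaled[of "t - 1"]
      integrable_fejer_scaled[of t]
    by (simp add: integral_fejer_scaled del: divide_divide_eq_left)
  also have "\<dots> = \<bar>t + 1\<bar> / 2 + \<bar>t - 1\<bar> / 2 - \<bar>t\<bar>"
    using fejer_mass_pos by (simp add: field_simps)
  \<comment> \<open>For |t| >= 1 the absolute value is affine on [t - 1, t + 1], so its second
    difference vanishes.\<close>
  also have "\<dots> = 0" using assms by (cases "t \<ge> 1") (auto simp: field_simps)
  finally show ?thesis using Im by (simp add: complex_eq_iff)
qed

subsection \<open>Smoothing inequality\<close>

text \<open>Levy inversion is applied to both laws. The inversion kernel has modulus at most 2/|t|,
  which cancels the factor |t| in the hypothesis on the transforms; hence the bound depends neither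
  on the cut-off S nor on the interval. The cruder kernel bound b - a serves only for integrability
  on [-S, S].\<close>

lemma Levy_bound_Ioc:
  assumes M: "rdist M" and N: "rdist N"
    and M0: "\<And>a. measure M {a} = 0" and N0: "\<And>a. measure N {a} = 0"
    and g: "integrable lborel g" and g0: "\<And>t. 0 \<le> g t"
    and le: "\<And>t. cmod (char M t - char N t) \<le> \<bar>t\<bar> * g t"
    and ab: "a \<le> b"
  shows "\<bar>measure M {a<..b} - measure N {a<..b}\<bar> \<le> (\<integral>t. g t \<partial>lborel)"
proof -
  interpret M: Distribution_Functions.real_distribution M by fact
  interpret N: Distribution_Functions.real_distribution N by fact
  let ?F = "\<lambda>t::real. (iexp (-(t * a)) - iexp (-(t * b))) / (\<i> * t)"
  have F1: "cmod (?F t) \<le> b - a" for t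
    using Levy_Inversion_aux2[of "-b" "-a" t] ab by (cases "t = 0") auto
  have F2: "cmod (?F t) * \<bar>t\<bar> \<le> 2" for t
  proof (cases "t = 0")
    case False
    have "cmod (iexp (-(t * a)) - iexp (-(t * b))) \<le> cmod (iexp (-(t * a))) + cmod (iexp (-(t * b)))"
      by (rule norm_triangle_ineq4)
    also have "\<dots> = 2" by (simp del: of_real_minus of_real_mult)
    finally show ?thesis using False by (simp add: norm_divide norm_mult)
  qed simp
  have int: "interval_lebesgue_integrable lborel (ereal (-S)) (ereal S) (\<lambda>t. ?F t * char K t)"
    if K: "rdist K" and S: "S \<ge> 0" for K and S :: real
  proof -
    interpret K: Distribution_Functions.real_distribution K by fact
    have "cmod (?F t * char K t) \<le> b - a" for t
      unfolding norm_mult using mult_mono[OF F1[of t] K.cmod_char_le_1[of t]] ab by simp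
    then show ?thesis
      using S unfolding interval_lebesgue_integrable_def set_integrable_def
      by (auto intro!: integrableI_bounded_set_indicator[where B="b - a"])
  qed
  have bound: "cmod (1 / (2 * pi) * (CLBINT t=-S..S. ?F t * char M t) - 
      1 / (2 * pi) * (CLBINT t=-S..S. ?F t * char N t)) \<le> (\<integral>t. g t \<partial>lborel)" (is "?l S \<le> ?r")
    if S: "S \<ge> 0" for S :: real
  proof -
    have le': "cmod (?F t * (char M t - char N t)) \<le> 2 * g t" for t
    proof -
      have "cmod (?F t * (char M t - char N t)) \<le> cmod (?F t) * (\<bar>t\<bar> * g t)"
        unfolding norm_mult by (intro mult_left_mono le) auto
      also have "\<dots> = (cmod (?F t) * \<bar>t\<bar>) * g t" by simp
      also have "\<dots> \<le> 2 * g t" by (intro mult_right_mono F2 g0)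
      finally show ?thesis .
    qed
    have I: "(CLBINT t=-S..S. ?F t * char M t) - (CLBINT t=-S..S. ?F t * char N t)
        = (CLBINT t=-S..S. ?F t * (char M t - char N t))"
      using interval_lebesgue_integral_diff(2)[OF int[OF M S] int[OF N S]]
      by (simp only: right_diff_distrib)
    have II: "interval_lebesgue_integrable lborel (ereal (-S)) (ereal S) (\<lambda>t. ?F t * (char M t - char N t))"
      using interval_lebesgue_integral_diff(1)[OF int[OF M S] int[OF N S]]
      by (simp only: right_diff_distrib)
    have "cmod (CLBINT t=-S..S. ?F t * (char M t - char N t)) \<le> (\<integral>t. 2 * g t \<partial>lborel)"
    proof -
      have "cmod (CLINT t|lborel. indicator {-S<..<S} t *\<^sub>R (?F t * (char M t - char N t))) \<le> (\<integral>t. 2 * g t \<partial>lborel)"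
      proof (rule order_trans[OF integral_norm_bound integral_mono])
        show "integrable lborel (\<lambda>t. cmod (indicator {-S<..<S} t *\<^sub>R (?F t * (char M t - char N t))))"
          using II S by (intro integrable_norm) (simp add: interval_lebesgue_integrable_def set_integrable_def)
        show "cmod (indicator {-S<..<S} t *\<^sub>R (?F t * (char M t - char N t))) \<le> 2 * g t" for t
          using le'[of t] g0[of t] by (cases "t \<in> {-S<..<S}") auto
      qed (use g in simp)
      then show ?thesis using S
        by (simp add: interval_lebesgue_integral_def set_lebesgue_integral_def)
    qed
    also have "\<dots> = 2 * ?r" by simp
    finally have "cmod (CLBINT t=-S..S. ?F t * (char M t - char N t)) \<le> 2 * ?r" .
    moreover have "?l S = 1 / (2 * pi) * cmod (CLBINT t=-S..S. ?F t * (char M t - char N t))"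
      unfolding right_diff_distrib[symmetric] I by (simp add: norm_mult norm_divide)
    ultimately have "?l S \<le> 1 / (2 * pi) * (2 * ?r)"
      by (simp only: mult_left_mono divide_nonneg_pos zero_le_one pi_gt_zero mult_pos_pos zero_less_numeral)
    also have "\<dots> = ?r * (1 / pi)" by simp
    also have "\<dots> \<le> ?r * 1"
      using g0 pi_gt3 by (intro mult_left_mono integral_nonneg_AE) auto
    finally show ?thesis by simp
  qed
  have lim: "(\<lambda>S::nat. cmod (1 / (2 * pi) * (CLBINT t=-S..S. ?F t * char M t) - 
      1 / (2 * pi) * (CLBINT t=-S..S. ?F t * char N t))) \<longlonglongrightarrow> cmod (complex_of_real (measure M {a<..b}) - complex_of_real (measure N {a<..b}))"
    using M.Levy_Inversion[OF ab] N.Levy_Inversion[OF ab] M0 N0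
    by (intro tendsto_norm tendsto_diff) auto
  have "cmod (complex_of_real (measure M {a<..b}) - complex_of_real (measure N {a<..b})) \<le> ?r"
    by (rule Lim_bounded[OF lim, of 0]) (use bound in auto)
  then show ?thesis by (simp flip: of_real_diff)
qed

text \<open>The interval bound is uniform in the left endpoint, which can therefore be sent to minus
  infinity.\<close>

lemma Levy_bound_cdf:
  assumes M: "rdist M" and N: "rdist N"
    and M0: "\<And>a. measure M {a} = 0" and N0: "\<And>a. measure N {a} = 0"
    and g: "integrable lborel g" and g0: "\<And>t. 0 \<le> g t"
    and le: "\<And>t. cmod (char M t - char N t) \<le> \<bar>t\<bar> * g t"
  shows "\<bar>cdf M b - cdf N b\<bar> \<le> (\<integral>t. g t \<partial>lborel)"
proof -
  interpret M: Distribution_Functions.real_distribution M by fact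
  interpret N: Distribution_Functions.real_distribution N by fact
  have "(\<lambda>n. \<bar>(cdf M b - cdf M (- real n)) - (cdf N b - cdf N (- real n))\<bar>) \<longlonglongrightarrow> \<bar>(cdf M b - 0) - (cdf N b - 0)\<bar>"
    by (intro tendsto_intros M.cdf_lim_neg_infty N.cdf_lim_neg_infty)
  moreover have "eventually (\<lambda>n. - real n < b) sequentially"
    using filterlim_real_sequentially unfolding filterlim_at_top_dense
    by (auto elim!: allE[of _ "-b"] eventually_mono)
  then have "eventually (\<lambda>n. \<bar>(cdf M b - cdf M (- real n)) - (cdf N b - cdf N (- real n))\<bar> \<le> (\<integral>t. g t \<partial>lborel)) sequentially"
    by eventually_elim (simp add: M.cdf_diff_eq N.cdf_diff_eq Levy_bound_Ioc[OF M N M0 N0 g g0 le])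
  ultimately show ?thesis
    by (auto dest: tendsto_upperbound)
qed

text \<open>Convolution with Fejer noise of scale 1/T. The transform of the noise vanishes for |t|
  >= T, so only the frequencies of \<open>M\<close> below T survive.\<close>

definition smoothed :: "real measure \<Rightarrow> real \<Rightarrow> real measure" where
  "smoothed M T = distr (M \<Otimes>\<^sub>M fejer_measure) borel (\<lambda>(x, z). x + z / T)"

context
  fixes M :: "real measure" and T :: real
  assumes M: "rdist M" and T: "T > 0"
begin

interpretation M: Distribution_Functions.real_distribution M by (rule M)
interpretation K: Distribution_Functions.real_distribution fejer_measure by (rule real_distribution_fejer)
interpretation P: pair_prob_space M fejer_measure ..

lemma sets_pair_fejer[measurable_cong]: "sets (M \<Otimes>\<^sub>M fejer_measure) = sets (borel \<Otimes>\<^sub>M borel)"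
  by (intro sets_pair_measure_cong) auto

lemma real_distribution_smoothed: "rdist (smoothed M T)"
  unfolding smoothed_def by (rule P.real_distribution_distr) (auto simp: split_beta')

lemma char_smoothed: "char (smoothed M T) t = char M t * char fejer_measure (t / T)"
proof -
  have eq: "iexp (t * (x + z / T)) = iexp (t * x) * iexp (t / T * z)" for x z
    by (simp add: algebra_simps flip: exp_add)
  have "char (smoothed M T) t = (\<integral>p. iexp (t * fst p) * iexp (t / T * snd p) \<partial>(M \<Otimes>\<^sub>M fejer_measure))"
    unfolding char_def smoothed_def by (subst integral_distr) (auto simp: split_beta' eq simp del: of_real_mult of_real_divide of_real_add)
  also have "\<dots> = (\<integral>x. \<integral>z. iexp (t * x) * iexp (t / T * z) \<partial>fejer_measure \<partial>M)"
  proof (subst P.integral_fst'[symmetric])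
    show "integrable (M \<Otimes>\<^sub>M fejer_measure) (\<lambda>p. iexp (t * fst p) * iexp (t / T * snd p))"
      by (rule P.integrable_const_bound[of _ 1]) (auto simp: norm_mult simp del: of_real_mult of_real_divide)
  qed simp
  also have "\<dots> = char M t * char fejer_measure (t / T)"
    by (simp add: char_def)
  finally show ?thesis .
qed

text \<open>The noise has a density, hence no atoms, and convolution inherits this. Levy inversion
  thus becomes available although \<open>M\<close> itself may have atoms.\<close>

lemma measure_smoothed_singleton: "measure (smoothed M T) {a} = 0"
proof -
  have null: "emeasure fejer_measure {c} = 0" for c
    unfolding fejer_measure_def by (subst emeasure_density) (auto intro!: nn_integral_null_set)
  have "emeasure (smoothed M T) {a} = (\<integral>\<^sup>+x. emeasure fejer_measure (Pair x -` {p. fst p + snd p / T = a}) \<partial>M)"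
    unfolding smoothed_def
  proof (subst emeasure_distr)
    have "Measurable.pred (M \<Otimes>\<^sub>M fejer_measure) (\<lambda>p. fst p + snd p / T = a)" by measurable
    then have "{p. fst p + snd p / T = a} \<in> sets (M \<Otimes>\<^sub>M fejer_measure)"
      by (simp add: pred_def space_pair_measure)
    from K.emeasure_pair_measure_alt[OF this]
    show "emeasure (M \<Otimes>\<^sub>M fejer_measure) ((\<lambda>(y, z). y + z / T) -` {a} \<inter> space (M \<Otimes>\<^sub>M fejer_measure)) =
      (\<integral>\<^sup>+x. emeasure fejer_measure (Pair x -` {p. fst p + snd p / T = a}) \<partial>M)"
      by (simp add: vimage_def split_beta' space_pair_measure)
  qed auto
  also have "\<dots> = (\<integral>\<^sup>+x. 0 \<partial>M)"
  proof (rule nn_integral_cong)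
    fix x
    have "Pair x -` {p. fst p + snd p / T = a} = {T * (a - x)}"
      using T by (auto simp: field_simps)
    then show "emeasure fejer_measure (Pair x -` {p. fst p + snd p / T = a}) = 0"
      using null by simp
  qed
  finally show ?thesis by (simp add: measure_def)
qed

lemma borel_measurable_cdf[measurable]: "cdf M \<in> borel_measurable borel"
  by (intro borel_measurable_mono monoI M.cdf_nondecreasing)

lemma integrable_cdf_shift: "integrable fejer_measure (\<lambda>z. cdf M (x - z / T))"
  using M.cdf_bounded_prob M.cdf_nonneg
  by (intro K.integrable_const_bound[of _ 1]) auto

lemma cdf_smoothed: "cdf (smoothed M T) x = (\<integral>z. cdf M (x - z / T) \<partial>fejer_measure)"
proof -
  have "emeasure (smoothed M T) {..x} = (\<integral>\<^sup>+z. emeasure M ((\<lambda>y. (y, z)) -` {p. fst p + snd p / T \<le> x}) \<partial>fejer_measure)"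
    unfolding smoothed_def
  proof (subst emeasure_distr)
    have "Measurable.pred (M \<Otimes>\<^sub>M fejer_measure) (\<lambda>p. fst p + snd p / T \<le> x)" by measurable
    then have "{p. fst p + snd p / T \<le> x} \<in> sets (M \<Otimes>\<^sub>M fejer_measure)"
      by (simp add: pred_def space_pair_measure)
    from P.emeasure_pair_measure_alt2[OF this]
    show "emeasure (M \<Otimes>\<^sub>M fejer_measure) ((\<lambda>(y, z). y + z / T) -` {..x} \<inter> space (M \<Otimes>\<^sub>M fejer_measure)) =
      (\<integral>\<^sup>+z. emeasure M ((\<lambda>y. (y, z)) -` {p. fst p + snd p / T \<le> x}) \<partial>fejer_measure)"
      by (simp add: vimage_def split_beta' space_pair_measure)
  qed auto
  also have "\<dots> = (\<integral>\<^sup>+z. ennreal (cdf M (x - z / T)) \<partial>fejer_measure)"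
  proof (rule nn_integral_cong)
    fix z
    have "(\<lambda>y. (y, z)) -` {p. fst p + snd p / T \<le> x} = {..x - z / T}" by auto
    then show "emeasure M ((\<lambda>y. (y, z)) -` {p. fst p + snd p / T \<le> x}) = ennreal (cdf M (x - z / T))"
      by (simp add: M.emeasure_eq_measure cdf_def)
  qed
  also have "\<dots> = ennreal (\<integral>z. cdf M (x - z / T) \<partial>fejer_measure)"
    using M.cdf_nonneg by (intro nn_integral_eq_integral integrable_cdf_shift) auto
  finally show ?thesis
    unfolding cdf_def[of "smoothed M T"] measure_def using M.cdf_nonneg
    by (simp add: integral_nonneg_AE)
qed

end

text \<open>The Fejer law has no first moment, so concentration replaces Chebyshev's inequality. The
  bound 1/4 is chosen so that the smoothing argument returns half of the supremum, which can be
  absorbed.\<close>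

lemma fejer_concentration: "\<exists>L>0. measure fejer_measure {z. \<bar>z\<bar> > L} \<le> 1/4"
proof -
  interpret K: Distribution_Functions.real_distribution fejer_measure by (rule real_distribution_fejer)
  have "((\<lambda>n. cdf fejer_measure (real n) - cdf fejer_measure (- real n)) \<longlonglongrightarrow> 1 - 0)"
    by (intro tendsto_diff K.cdf_lim_infty_prob K.cdf_lim_neg_infty)
  then have "eventually (\<lambda>n. cdf fejer_measure (real n) - cdf fejer_measure (- real n) > 3/4) sequentially"
    by (rule order_tendstoD) simp
  then obtain n where n: "cdf fejer_measure (real n) - cdf fejer_measure (- real n) > 3/4"
    by (auto simp: eventually_sequentially)
  then have n0: "n > 0" by (cases n) auto
  have "measure fejer_measure {z. \<bar>z\<bar> > real n} \<le> measure fejer_measure (space fejer_measure - {-real n <.. real n})"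
    by (rule K.finite_measure_mono) auto
  also have "\<dots> = 1 - measure fejer_measure {-real n <.. real n}"
    by (rule K.prob_compl) auto
  also have "\<dots> \<le> 1/4" using n n0 by (subst K.cdf_diff_eq[symmetric]) auto
  finally show ?thesis using n0 by (intro exI[of _ "real n"]) auto
qed

text \<open>The difference D of the distribution functions cannot drop quickly, because one is
  nondecreasing and the other Lipschitz. So a large |D y| persists on one side of y over a length
  2L/T and shows up in the average against Fejer noise shifted by L/T, which Levy inversion
  controls. The constant depends only on the concentration radius L.\<close>

lemma esseen_smoothing:
  "\<exists>C>0. \<forall>M N T A g x. rdist M \<longrightarrow> rdist N \<longrightarrow> T > 0 \<longrightarrow> A \<ge> 0 \<longrightarrow>
     (\<forall>x y. x \<le> y \<longrightarrow> cdf N y - cdf N x \<le> A * (y - x)) \<longrightarrow>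
     integrable lborel g \<longrightarrow> (\<forall>t. \<bar>t\<bar> \<le> T \<longrightarrow> cmod (char M t - char N t) \<le> \<bar>t\<bar> * g t) \<longrightarrow> (\<forall>t. 0 \<le> g t) \<longrightarrow>
     \<bar>cdf M x - cdf N x\<bar> \<le> C * ((\<integral>t. g t \<partial>lborel) + A / T)"
proof -
  interpret K: Distribution_Functions.real_distribution fejer_measure by (rule real_distribution_fejer)
  obtain L where L: "L > 0" "measure fejer_measure {z. \<bar>z\<bar> > L} \<le> 1/4"
    using fejer_concentration by auto
  show ?thesis
  proof (intro exI[of _ "max 2 (4 * L)"] conjI allI impI)
    fix M N :: "real measure" and T A :: real and g :: "real \<Rightarrow> real" and x
    assume M: "rdist M" and N: "rdist N" and T: "T > 0" and A: "A \<ge> 0"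
      and lip: "\<forall>x y. x \<le> y \<longrightarrow> cdf N y - cdf N x \<le> A * (y - x)"
      and g: "integrable lborel g" and g0: "\<forall>t. 0 \<le> g t"
      and le: "\<forall>t. \<bar>t\<bar> \<le> T \<longrightarrow> cmod (char M t - char N t) \<le> \<bar>t\<bar> * g t"
    interpret M: Distribution_Functions.real_distribution M by fact
    interpret N: Distribution_Functions.real_distribution N by fact
    define B where "B = (\<integral>t. g t \<partial>lborel)"
    have "B \<ge> 0" unfolding B_def using g0 by (intro integral_nonneg_AE) auto
    have le': "cmod (char (smoothed M T) t - char (smoothed N T) t) \<le> \<bar>t\<bar> * g t" for t
    proof (cases "\<bar>t\<bar> \<le> T")
      case True
      have "cmod (char (smoothed M T) t - char (smoothed N T) t) = 
          cmod (char M t - char N t) * cmod (char fejer_measure (t / T))"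
        by (simp add: char_smoothed M N T left_diff_distrib[symmetric] norm_mult)
      also have "\<dots> \<le> (\<bar>t\<bar> * g t) * 1"
        using le True g0 by (intro mult_mono K.cmod_char_le_1) auto
      finally show ?thesis by simp
    next
      case False
      then have "\<bar>t / T\<bar> \<ge> 1" using T by (simp add: abs_divide)
      then show ?thesis using g0 by (simp add: char_smoothed M N T char_fejer_eq_0)
    qed
    define D where "D = (\<lambda>x. cdf M x - cdf N x)"
    have int: "integrable fejer_measure (\<lambda>z. D (x - z / T))" for x
      unfolding D_def by (intro Bochner_Integration.integrable_diff integrable_cdf_shift M N T)
    have conv: "\<bar>\<integral>z. D (x - z / T) \<partial>fejer_measure\<bar> \<le> B" for x
    proof -
      have "(\<integral>z. D (x - z / T) \<partial>fejer_measure) = cdf (smoothed M T) x - cdf (smoothed N T) x"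
        unfolding D_def by (simp add: cdf_smoothed M N T integrable_cdf_shift)
      also have "\<bar>\<dots>\<bar> \<le> B"
        unfolding B_def
        by (rule Levy_bound_cdf) (auto simp: real_distribution_smoothed measure_smoothed_singleton M N T g g0 le')
      finally show ?thesis .
    qed
    have D1: "\<bar>D x\<bar> \<le> 1" for x
      using M.cdf_bounded_prob[of x] N.cdf_bounded_prob[of x] M.cdf_nonneg[of x] N.cdf_nonneg[of x]
      unfolding D_def by linarith
    \<comment> \<open>The supremum is finite since |D| <= 1; this permits the later absorption of
      half of it, and it need not be attained.\<close>
    define \<Delta> where "\<Delta> = (SUP x. \<bar>D x\<bar>)"
    have D\<Delta>: "\<bar>D x\<bar> \<le> \<Delta>" for x
      unfolding \<Delta>_def using D1 by (intro cSUP_upper bdd_aboveI2) auto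
    define E where "E = A * (2 * L / T)"
    have inc: "D (y + u) \<ge> D y - E" if "0 \<le> u" "u \<le> 2 * L / T" for y u
    proof -
      have "cdf N (y + u) - cdf N y \<le> A * u" using lip[rule_format, of y "y + u"] that by simp
      also have "\<dots> \<le> E" unfolding E_def using that A by (intro mult_left_mono) auto
      finally show ?thesis
        using M.cdf_nondecreasing[of y "y + u"] that unfolding D_def by simp
    qed
    have tail_int: "integrable fejer_measure (\<lambda>z. c + d * indicator {z. \<bar>z\<bar> > L} z :: real)" for c d
      by (intro Bochner_Integration.integrable_add integrable_mult_right integrable_real_indicator)
         (auto simp: K.emeasure_eq_measure)
    have "\<Delta> \<ge> 0" using D\<Delta>[of 0] by simp
    have tail_integral: "(\<integral>z. c + d * indicator {z. \<bar>z\<bar> > L} z \<partial>fejer_measure)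
        = c + d * measure fejer_measure {z. \<bar>z\<bar> > L}" for c d
    proof -
      have "integrable fejer_measure (indicator {z. \<bar>z\<bar> > L} :: real \<Rightarrow> real)"
        by (intro integrable_real_indicator) (auto simp: K.emeasure_eq_measure)
      then show ?thesis using K.prob_space by simp
    qed
    have "\<bar>D y\<bar> \<le> B + E + \<Delta> / 2" for y
    proof (cases "D y \<ge> 0")
      case True
      \<comment> \<open>The shift by L/T places y + (L - z)/T in [y, y + 2L/T] for every |z| <= L,
        where D has lost at most E. For the other z the loss is bounded by twice the
        supremum.\<close>
      have "(D y - E) - 2 * \<Delta> * (1/4) \<le> (\<integral>z. (D y - E) + (- 2 * \<Delta>) * indicator {z. \<bar>z\<bar> > L} z \<partial>fejer_measure)"
        using \<open>\<Delta> \<ge> 0\<close> mult_left_mono[OF L(2), of "2 * \<Delta>"]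
        unfolding tail_integral by simp
      also have "\<dots> \<le> (\<integral>z. D (y + L / T - z / T) \<partial>fejer_measure)"
      proof (intro integral_mono tail_int int)
        fix z
        show "(D y - E) + (- 2 * \<Delta>) * indicator {z. \<bar>z\<bar> > L} z \<le> D (y + L / T - z / T)"
        proof (cases "\<bar>z\<bar> > L")
          case True
          have "E \<ge> 0" unfolding E_def using A T L by simp
          then show ?thesis using True D\<Delta>[of y] D\<Delta>[of "y + L / T - z / T"] by simp
        next
          case False
          have eq: "y + L / T - z / T = y + (L - z) / T" by (simp add: diff_divide_distrib)
          show ?thesis using False inc[of "(L - z) / T" y] T unfolding eq
            by (auto simp: divide_right_mono)
        qed
      qed
      also have "\<dots> \<le> B" using conv[of "y + L / T"] by simp
      finally show ?thesis using True by simp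
    next
      case False
      have "- B \<le> (\<integral>z. D (y - L / T - z / T) \<partial>fejer_measure)"
        using conv[of "y - L / T"] by simp
      also have "\<dots> \<le> (\<integral>z. (D y + E) + (2 * \<Delta>) * indicator {z. \<bar>z\<bar> > L} z \<partial>fejer_measure)"
      proof (intro integral_mono tail_int int)
        fix z
        show "D (y - L / T - z / T) \<le> (D y + E) + (2 * \<Delta>) * indicator {z. \<bar>z\<bar> > L} z"
        proof (cases "\<bar>z\<bar> > L")
          case True
          have "E \<ge> 0" unfolding E_def using A T L by simp
          then show ?thesis using True D\<Delta>[of y] D\<Delta>[of "y - L / T - z / T"] by simp
        next
          case False
          have eq: "y - L / T - z / T + (L + z) / T = y" by (simp add: add_divide_distrib)
          show ?thesis using False inc[of "(L + z) / T" "y - L / T - z / T"] T unfolding eq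
            by (auto simp: divide_right_mono)
        qed
      qed
      also have "\<dots> \<le> (D y + E) + 2 * \<Delta> * (1/4)"
        using \<open>\<Delta> \<ge> 0\<close> mult_left_mono[OF L(2), of "2 * \<Delta>"]
        unfolding tail_integral by simp
      finally show ?thesis using False by simp
    qed
    then have "\<Delta> \<le> B + E + \<Delta> / 2"
      unfolding \<Delta>_def by (intro cSUP_least) auto
    \<comment> \<open>Absorbing half of the supremum doubles B + E, and 2E = 4 L A/T.\<close>
    then have "\<bar>D x\<bar> \<le> 2 * B + 4 * L * (A / T)"
      using D\<Delta>[of x] unfolding E_def by (simp add: field_simps)
    also have "\<dots> \<le> max 2 (4 * L) * B + max 2 (4 * L) * (A / T)"
      using \<open>B \<ge> 0\<close> A T by (intro add_mono mult_right_mono) auto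
    finally show "\<bar>cdf M x - cdf N x\<bar> \<le> max 2 (4 * L) * ((\<integral>t. g t \<partial>lborel) + A / T)"
      unfolding D_def B_def by (simp add: ring_distribs)
  qed simp
qed

subsection \<open>Gaussian tails\<close>

abbreviation gauss :: "real measure" where "gauss \<equiv> std_normal_distribution"

definition gtail :: "real \<Rightarrow> real" where "gtail x = measure gauss {x<..}"

text \<open>This is the Mills ratio of the standard normal law divided by sqrt(2 pi), written as a
  half-line Laplace transform because tails of tilted laws appear in that form.\<close>

definition mills :: "real \<Rightarrow> real" where
  "mills s = (\<integral>u. indicator {0<..} u * exp (- s * u) \<partial>gauss)"

interpretation gauss: Distribution_Functions.real_distribution gauss
  by (rule real_dist_normal_dist)

lemma gauss_integral:
  fixes f :: "real \<Rightarrow> real"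
  assumes "f \<in> borel_measurable borel"
  shows "(\<integral>x. f x \<partial>gauss) = (\<integral>x. std_normal_density x * f x \<partial>lborel)"
  using assms by (subst integral_density) auto

lemma gauss_integrable_iff:
  fixes f :: "real \<Rightarrow> real"
  assumes "f \<in> borel_measurable borel"
  shows "integrable gauss f \<longleftrightarrow> integrable lborel (\<lambda>x. std_normal_density x * f x)"
  using assms by (subst integrable_density) auto

lemma gtail_integral: "gtail x = (\<integral>t. std_normal_density t * indicator {x<..} t \<partial>lborel)"
  unfolding gtail_def by (subst gauss_integral[symmetric]) auto

lemma std_normal_density_shift:
  "std_normal_density (u + s) = exp (- s\<^sup>2 / 2) * (std_normal_density u * exp (- s * u))"
proof -
  have "- (u + s)\<^sup>2 / 2 = - s\<^sup>2 / 2 + (- u\<^sup>2 / 2 + - s * u)"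
    by (simp add: power2_eq_square field_simps)
  then show ?thesis by (simp only: std_normal_density_def exp_add) simp
qed

lemma gtail_mills: "gtail s = exp (- s\<^sup>2 / 2) * mills s"
proof -
  have "gtail s = (\<integral>u. std_normal_density (s + 1 * u) * indicator {s<..} (s + 1 * u) \<partial>lborel)"
    unfolding gtail_integral by (subst lborel_integral_real_affine[of 1 _ s]) auto
  also have "\<dots> = (\<integral>u. exp (- s\<^sup>2 / 2) * (std_normal_density u * (indicator {0<..} u * exp (- s * u))) \<partial>lborel)"
    using std_normal_density_shift[of _ s]
    by (intro Bochner_Integration.integral_cong) (auto simp: add.commute split: split_indicator)
  also have "\<dots> = exp (- s\<^sup>2 / 2) * mills s"
    unfolding mills_def by (subst gauss_integral) auto
  finally show ?thesis .
qed

lemma gauss_integrable_bounded: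
  fixes f :: "real \<Rightarrow> real"
  assumes "f \<in> borel_measurable borel" "\<And>x. \<bar>f x\<bar> \<le> 1"
  shows "integrable gauss f"
  using assms by (intro gauss.integrable_const_bound[of _ 1]) auto

lemma mills_integrable: "s \<ge> 0 \<Longrightarrow> integrable gauss (\<lambda>u. indicator {0<..} u * exp (- s * u))"
  by (rule gauss_integrable_bounded) (auto split: split_indicator)

lemma mills_antimono: "0 \<le> s \<Longrightarrow> s \<le> s' \<Longrightarrow> mills s' \<le> mills s"
  unfolding mills_def
  by (intro integral_mono mills_integrable) (auto split: split_indicator intro: mult_right_mono)

lemma mills_scaled:
  assumes "s > 0"
  shows "s * mills s = (\<integral>w. indicator {0<..} w * exp (- w) * std_normal_density (w / s) \<partial>lborel)"
proof -
  have "mills s = (\<integral>u. std_normal_density u * (indicator {0<..} u * exp (- s * u)) \<partial>lborel)"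
    unfolding mills_def by (rule gauss_integral) auto
  also have "\<dots> = (1 / s) * (\<integral>w. indicator {0<..} w * exp (- w) * std_normal_density (w / s) \<partial>lborel)"
    using assms
    by (subst lborel_integral_real_affine[of "1 / s" _ 0])
       (auto intro!: Bochner_Integration.integral_cong simp: zero_less_divide_iff split: split_indicator)
  finally show ?thesis using assms by simp
qed

text \<open>After the substitution u = w/s the parameter occurs only inside the density, which
  decreases in |w/s|. Together with the monotonicity of \<open>mills\<close> this confines the
  effect of a relative change of the argument.\<close>

lemma mills_times_mono:
  assumes "0 < s" "s \<le> s'"
  shows "s * mills s \<le> s' * mills s'"
proof -
  have int: "integrable lborel (\<lambda>w. indicator {0<..} w * exp (- w) * std_normal_density (w / r))" if "r > 0" for r
  proof (rule Bochner_Integration.integrable_bound)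
    show "integrable lborel (\<lambda>w. std_normal_density (0 + 1 / r * w))"
      using that by (intro lborel_integrable_real_affine) auto
    show "AE w in lborel. norm (indicator {0<..} w * exp (- w) * std_normal_density (w / r)) \<le> norm (std_normal_density (0 + 1 / r * w))"
      by (auto split: split_indicator intro!: mult_left_le_one_le)
  qed auto
  have "indicator {0<..} w * exp (- w) * std_normal_density (w / s)
      \<le> indicator {0<..} w * exp (- w) * std_normal_density (w / s')" for w
  proof (cases "w > 0")
    case True
    then have "w / s' \<le> w / s" using assms by (intro divide_left_mono) auto
    then have "(w / s')\<^sup>2 \<le> (w / s)\<^sup>2" using True assms by (intro power_mono) auto
    then have "std_normal_density (w / s) \<le> std_normal_density (w / s')"
      unfolding std_normal_density_def by (intro mult_left_mono) auto
    then show ?thesis by (intro mult_left_mono) auto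
  qed simp
  then show ?thesis
    using assms by (subst (1 2) mills_scaled) (auto intro!: integral_mono int)
qed

lemma std_normal_density_mono: "\<bar>x\<bar> \<le> y \<Longrightarrow> std_normal_density y \<le> std_normal_density x"
  unfolding std_normal_density_def using power_mono[of "\<bar>x\<bar>" y 2]
  by (intro mult_left_mono) auto

lemma std_normal_density_le_half: "std_normal_density x \<le> 1 / 2"
proof -
  have "2\<^sup>2 \<le> 2 * pi" using pi_gt3 by simp
  then have "2 \<le> sqrt (2 * pi)" by (rule real_le_rsqrt)
  then have "1 / sqrt (2 * pi) \<le> 1 / 2" by (intro divide_left_mono) auto
  moreover have "exp (- x\<^sup>2 / 2) \<le> 1" by simp
  ultimately have "1 / sqrt (2 * pi) * exp (- x\<^sup>2 / 2) \<le> 1 / 2 * 1"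
    by (intro mult_mono) auto
  then show ?thesis by (simp add: std_normal_density_def)
qed

lemma gauss_Ioc_ge:
  assumes "a \<le> b" "\<And>x. a \<le> x \<Longrightarrow> x \<le> b \<Longrightarrow> c \<le> std_normal_density x" 
  shows "c * (b - a) \<le> measure gauss {a<..b}"
proof -
  have "c * (b - a) = (\<integral>x. c * indicator {a<..b} x \<partial>lborel)" using assms by simp
  also have "\<dots> \<le> (\<integral>x. std_normal_density x * indicator {a<..b} x \<partial>lborel)"
    using assms by (intro integral_mono) (auto simp: integrable_real_mult_indicator split: split_indicator)
  also have "\<dots> = measure gauss {a<..b}" by (subst gauss_integral[symmetric]) auto
  finally show ?thesis .
qed

lemma gauss_Ioc_le:
  assumes "a \<le> b"
  shows "measure gauss {a<..b} \<le> b - a"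
proof -
  have "measure gauss {a<..b} = (\<integral>x. std_normal_density x * indicator {a<..b} x \<partial>lborel)"
    by (subst gauss_integral[symmetric]) auto
  also have "\<dots> \<le> (\<integral>x. indicator {a<..b} x \<partial>lborel)"
    using assms order_trans[OF std_normal_density_le_half, of 1]
    by (intro integral_mono) (auto simp: integrable_real_mult_indicator split: split_indicator)
  also have "\<dots> = b - a" using assms by simp
  finally show ?thesis .
qed

text \<open>On (0, 1/(1 + s)] the exponential is at least exp(-1) and the density at least its value
  at 1. Using 1 + s instead of s keeps the bound meaningful at s = 0. It later turns additive errors
  into relative ones.\<close>

lemma mills_lower: "s \<ge> 0 \<Longrightarrow> exp (- 1) * std_normal_density 1 \<le> (1 + s) * mills s"
proof -
  assume s: "s \<ge> 0"
  have "1 / (1 + s) \<le> 1" using s by simp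
  then have "std_normal_density 1 \<le> std_normal_density x" if "0 \<le> x" "x \<le> 1 / (1 + s)" for x
    using that by (intro std_normal_density_mono) auto
  then have "exp (-1) * (std_normal_density 1 * (1 / (1 + s) - 0)) \<le> exp (-1) * measure gauss {0<..1 / (1 + s)}"
    using s by (intro mult_left_mono gauss_Ioc_ge) auto
  also have "\<dots> = (\<integral>u. exp (-1) * indicator {0<..1 / (1 + s)} u \<partial>gauss)" by simp
  also have "\<dots> \<le> mills s"
    unfolding mills_def
  proof (intro integral_mono mills_integrable s)
    fix u
    show "exp (-1) * indicator {0<..1 / (1 + s)} u \<le> indicator {0<..} u * exp (- s * u)"
    proof (cases "u \<in> {0<..1 / (1 + s)}")
      case True
      then have "(1 + s) * u \<le> 1" using s by (simp add: field_simps)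
      then have "s * u \<le> 1" using True by (simp add: ring_distribs)
      then show ?thesis using True by simp
    qed (auto split: split_indicator)
  qed (auto intro!: gauss_integrable_bounded split: split_indicator)
  finally show ?thesis using s by (simp add: field_simps)
qed

lemma mills_pos: "s \<ge> 0 \<Longrightarrow> mills s > 0"
  using mills_lower[of s] normal_density_pos[of 1 0 1]
  by (smt (verit) exp_gt_zero mult_nonneg_nonpos mult_pos_pos)

lemma gtail_nonneg: "gtail x \<ge> 0" and gtail_le_1: "gtail x \<le> 1"
  by (auto simp: gtail_def)

lemma gtail_cdf: "gtail x = 1 - cdf gauss x"
proof -
  have "gtail x = measure gauss (space gauss - {..x})"
    unfolding gtail_def by (intro arg_cong[of _ _ "measure gauss"]) auto
  then show ?thesis by (subst (asm) gauss.prob_compl) (auto simp: cdf_def)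
qed

lemma gtail_antimono: "x \<le> y \<Longrightarrow> gtail y \<le> gtail x"
  unfolding gtail_cdf using gauss.cdf_nondecreasing by simp

lemma gtail_diff: "x \<le> y \<Longrightarrow> gtail x - gtail y = measure gauss {x<..y}"
  using gauss.cdf_diff_eq[of x y] by (cases "x = y") (auto simp: gtail_cdf)

lemma cdf_gauss_lessThan: "measure gauss {..<x} = cdf gauss x"
proof -
  have "emeasure gauss {x} = 0" by (subst emeasure_density) (auto intro!: nn_integral_null_set)
  then have "measure gauss {x} = 0" by (simp add: measure_def)
  moreover have "measure gauss {..x} = measure gauss {..<x} + measure gauss {x}"
    by (subst gauss.finite_measure_Union[symmetric]) (auto intro!: arg_cong[of _ _ "measure gauss"])
  ultimately show ?thesis by (simp add: cdf_def)
qed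

lemma gtail_uminus: "gtail (- x) = 1 - gtail x"
proof -
  have "gtail (-x) = (\<integral>t. std_normal_density t * indicator {-x<..} t \<partial>lborel)"
    by (rule gtail_integral)
  also have "\<dots> = (\<integral>t. std_normal_density (0 + -1 * t) * indicator {-x<..} (0 + -1 * t) \<partial>lborel)"
    by (subst lborel_integral_real_affine[of "-1" _ 0]) auto
  also have "\<dots> = (\<integral>t. std_normal_density t * indicator {..<x} t \<partial>lborel)"
    by (intro Bochner_Integration.integral_cong) (auto simp: std_normal_density_def split: split_indicator)
  also have "\<dots> = measure gauss {..<x}" by (subst gauss_integral[symmetric]) auto
  finally show ?thesis by (simp add: gtail_cdf cdf_gauss_lessThan)
qed

section \<open>Relative decay of the Gaussian tail under shifts\<close>

lemma gtail_shift_exp: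
  assumes "x \<ge> 0" "d \<ge> 0"
  shows "gtail (x + d) \<le> exp (- x * d) * gtail x"
proof -
  have "gtail (x + d) = exp (- (x + d)\<^sup>2 / 2) * mills (x + d)" by (rule gtail_mills)
  also have "\<dots> \<le> (exp (- x * d) * exp (- x\<^sup>2 / 2)) * mills x"
    using assms mills_pos[of "x + d"]
    by (intro mult_mono mills_antimono) (auto simp: power2_eq_square field_simps simp flip: exp_add)
  finally show ?thesis by (simp add: gtail_mills)
qed

text \<open>\<open>std_normal_density 2\<close> is the minimum of the density on [-2, 2], where
  short shifts take place; halving makes room for the factor 1 + x <= 2 when x < 1. The bound 1/4
  makes the same constant work for x >= 1.\<close>

definition shift_const :: real where "shift_const = std_normal_density 2 / 2"

lemma shift_const: "0 < shift_const" "shift_const \<le> 1 / 4"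
  using std_normal_density_le_half[of 2] by (auto simp: shift_const_def normal_density_pos)

text \<open>The tail loses at least the minimal density times d; since the tail is at most 1, this
  absolute loss is also a relative one.\<close>

lemma gtail_shift_small:
  assumes "- 2 \<le> x" "0 \<le> d" "x + d \<le> 2"
  shows "gtail (x + d) \<le> exp (- (2 * shift_const * d)) * gtail x"
proof -
  have "std_normal_density 2 \<le> std_normal_density u" if "x \<le> u" "u \<le> x + d" for u
    using that assms by (intro std_normal_density_mono) auto
  then have "2 * shift_const * d \<le> gtail x - gtail (x + d)"
    using gauss_Ioc_ge[of x "x + d" "std_normal_density 2"] assms
    by (simp add: gtail_diff shift_const_def)
  moreover have "2 * shift_const * d * gtail x \<le> 2 * shift_const * d * 1"
    using assms shift_const by (intro mult_left_mono gtail_le_1) auto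
  ultimately have "gtail (x + d) \<le> (1 + - (2 * shift_const * d)) * gtail x"
    by (simp add: ring_distribs)
  also have "\<dots> \<le> exp (- (2 * shift_const * d)) * gtail x"
    by (intro mult_right_mono exp_ge_add_one_self gtail_nonneg)
  finally show ?thesis .
qed

text \<open>The exponential estimate has rate x, which is comparable with 1 + x only away from 0.
  For x < 1 the short-shift estimate takes over, hence the restriction d <= 1 there.\<close>

lemma gtail_shift_up:
  assumes x: "x \<ge> 0" and d: "d \<ge> 0" and small: "x < 1 \<Longrightarrow> d \<le> 1"
  shows "gtail (x + d) \<le> exp (- (shift_const * d * (1 + x))) * gtail x"
proof (cases "x < 1")
  case True
  have "gtail (x + d) \<le> exp (- (2 * shift_const * d)) * gtail x"
    using True x d small by (intro gtail_shift_small) auto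
  also have "\<dots> \<le> exp (- (shift_const * d * (1 + x))) * gtail x"
    using True d shift_const mult_left_mono[of "1 + x" 2 "shift_const * d"]
    by (intro mult_right_mono gtail_nonneg) auto
  finally show ?thesis .
next
  case False
  have "shift_const * d * (1 + x) \<le> 1 / 4 * d * (1 + x)"
    using shift_const d x by (intro mult_right_mono) auto
  also have "\<dots> = d * ((1 + x) / 4)" by simp
  also have "\<dots> \<le> d * x" using False d by (intro mult_left_mono) auto
  finally have "shift_const * d * (1 + x) \<le> x * d" by (simp add: mult.commute)
  then have "exp (- x * d) * gtail x \<le> exp (- (shift_const * d * (1 + x))) * gtail x"
    by (intro mult_right_mono gtail_nonneg) auto
  then show ?thesis using gtail_shift_exp[OF x d] by linarith
qed

text \<open>The exponential estimate is started from x - d. The condition d <= x/2 keeps its rate at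
  least x/2, which still dominates (1 + x)/4 for x >= 1.\<close>

lemma gtail_shift_down:
  assumes x: "x \<ge> 0" and d: "d \<ge> 0" and small: "x < 1 \<Longrightarrow> d \<le> 1" and large: "x \<ge> 1 \<Longrightarrow> d \<le> x / 2"
  shows "gtail x \<le> exp (- (shift_const * d * (1 + x))) * gtail (x - d)"
proof (cases "x < 1")
  case True
  have "gtail ((x - d) + d) \<le> exp (- (2 * shift_const * d)) * gtail (x - d)"
    using True x d small by (intro gtail_shift_small) auto
  also have "\<dots> \<le> exp (- (shift_const * d * (1 + x))) * gtail (x - d)"
    using True d shift_const mult_left_mono[of "1 + x" 2 "shift_const * d"]
    by (intro mult_right_mono gtail_nonneg) auto
  finally show ?thesis by simp
next
  case False
  have "shift_const * d * (1 + x) \<le> 1 / 4 * d * (1 + x)"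
    using shift_const d x by (intro mult_right_mono) auto
  also have "\<dots> = d * ((1 + x) / 4)" by simp
  also have "\<dots> \<le> d * (x - d)" using False d large by (intro mult_left_mono) auto
  finally have "- (x - d) * d \<le> - (shift_const * d * (1 + x))" by (simp add: algebra_simps)
  then have "exp (- (x - d) * d) * gtail (x - d) \<le> exp (- (shift_const * d * (1 + x))) * gtail (x - d)"
    by (intro mult_right_mono gtail_nonneg) auto
  then show ?thesis using gtail_shift_exp[of "x - d" d] d large False by simp
qed

text \<open>Half of the Gaussian exponent is left over, so the product is a multiple of the density
  with variance 2.\<close>

lemma gauss_exp_square:
  shows "integrable gauss (\<lambda>x. exp (x\<^sup>2 / 4))" "(\<integral>x. exp (x\<^sup>2 / 4) \<partial>gauss) = sqrt 2"
proof -
  have eq: "std_normal_density x * exp (x\<^sup>2 / 4) = sqrt 2 * normal_density 0 (sqrt 2) x" for x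
    by (simp add: normal_density_def real_sqrt_mult exp_add[symmetric] field_simps)
  show "integrable gauss (\<lambda>x. exp (x\<^sup>2 / 4))"
    by (subst gauss_integrable_iff) (auto simp: eq)
  show "(\<integral>x. exp (x\<^sup>2 / 4) \<partial>gauss) = sqrt 2"
    by (subst gauss_integral) (auto simp: eq)
qed

lemma gtail_strict: "x < y \<Longrightarrow> gtail y < gtail x"
proof -
  assume xy: "x < y"
  define c where "c = std_normal_density (max \<bar>x\<bar> \<bar>y\<bar>)"
  have "c \<le> std_normal_density u" if "x \<le> u" "u \<le> y" for u
    unfolding c_def using that by (intro std_normal_density_mono) auto
  then have "c * (y - x) \<le> measure gauss {x<..y}" using xy by (intro gauss_Ioc_ge) auto
  moreover have "c * (y - x) > 0" using xy by (simp add: c_def normal_density_pos)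
  ultimately show ?thesis using gtail_diff[of x y] xy by linarith
qed

lemma gtail_le_iff: "gtail x \<le> gtail y \<longleftrightarrow> y \<le> x"
  using gtail_strict[of x y] gtail_antimono[of y x] by (auto simp: not_less[symmetric])

subsection \<open>Laplace transforms of nearby distributions\<close>

text \<open>For an exponential variable V of rate h, exp(-h u) is the probability of V >= u. Fubini
  on the set 0 < u <= v then replaces an integration by parts and works for laws without a
  density.\<close>

lemma laplace_eq_integral_Ioc:
  assumes M: "rdist M" and h: "h > 0"
  shows "(\<integral>u. indicator {0<..} u * exp (- h * u) \<partial>M)
    = (\<integral>v. measure M {0<..v} \<partial>density lborel (exponential_density h))"
proof -
  define E where "E = density lborel (exponential_density h)"
  interpret M: Distribution_Functions.real_distribution M by (rule M)
  interpret E: prob_space E unfolding E_def by (rule prob_space_exponential_density[OF h])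
  have sets_E[measurable_cong]: "sets E = sets borel" by (simp add: E_def)
  have space_E: "space E = UNIV" by (simp add: E_def)
  interpret P: pair_prob_space M E ..
  define A where "A = {p :: real \<times> real. 0 < fst p \<and> fst p \<le> snd p}"
  have "Measurable.pred (M \<Otimes>\<^sub>M E) (\<lambda>p. 0 < fst p \<and> fst p \<le> snd p)" by measurable
  then have A: "A \<in> sets (M \<Otimes>\<^sub>M E)"
    unfolding A_def by (simp add: pred_def space_pair_measure space_E)
  have tail: "emeasure E {u..} = ennreal (exp (- h * u))" if "u > 0" for u
  proof -
    have "distributed E lborel (\<lambda>x. x) (exponential_density h)"
      unfolding distributed_def E_def by (auto simp: distr_id2 intro!: exponential_density_nonneg h)
    from E.exponential_distributedD_gt[OF this less_imp_le[OF that] h]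
    have "measure E {u<..} = exp (- h * u)"
      by (simp add: space_E greaterThan_def mult.commute)
    moreover have "emeasure E {u} = 0"
      unfolding E_def by (subst emeasure_density) (auto intro!: nn_integral_null_set)
    then have "measure E {u} = 0" by (simp add: measure_def)
    moreover have "measure E {u..} = measure E {u} + measure E {u<..}"
      by (subst E.finite_measure_Union[symmetric]) (auto simp: sets_E intro!: arg_cong[of _ _ "measure E"])
    ultimately show ?thesis by (simp add: E.emeasure_eq_measure)
  qed
  have sec1: "emeasure E (Pair u -` A) = ennreal (indicator {0<..} u * exp (- h * u))" for u
  proof (cases "u > 0")
    case True
    then have "Pair u -` A = {u..}" by (auto simp: A_def)
    then show ?thesis using tail True by simp
  qed (simp add: A_def vimage_def)
  have sec2: "emeasure M ((\<lambda>u. (u, v)) -` A) = ennreal (measure M {0<..v})" for v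
  proof -
    have "(\<lambda>u. (u, v)) -` A = {0<..v}" by (auto simp: A_def)
    then show ?thesis by (simp add: M.emeasure_eq_measure)
  qed
  have meas: "(\<lambda>v. measure M {0<..v}) \<in> borel_measurable E"
    unfolding sets_E[THEN measurable_cong_sets[OF _ refl]]
    by (intro borel_measurable_mono monoI M.finite_measure_mono) auto
  have "(\<integral>u. indicator {0<..} u * exp (- h * u) \<partial>M)
      = enn2real (\<integral>\<^sup>+u. ennreal (indicator {0<..} u * exp (- h * u)) \<partial>M)"
    by (intro integral_eq_nn_integral) auto
  also have "(\<integral>\<^sup>+u. ennreal (indicator {0<..} u * exp (- h * u)) \<partial>M) = emeasure (M \<Otimes>\<^sub>M E) A"
    by (subst E.emeasure_pair_measure_alt[OF A]) (simp add: sec1)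
  also have "\<dots> = (\<integral>\<^sup>+v. ennreal (measure M {0<..v}) \<partial>E)"
    by (subst P.emeasure_pair_measure_alt2[OF A]) (simp add: sec2)
  also have "enn2real \<dots> = (\<integral>v. measure M {0<..v} \<partial>E)"
    by (intro integral_eq_nn_integral[symmetric] meas) auto
  finally show ?thesis unfolding E_def .
qed

text \<open>The Laplace transform is an average of masses of intervals (0, v], each a difference of
  two values of the distribution function; hence the factor 2. At h = 0 there is no exponential law,
  so this case is read off directly.\<close>

lemma laplace_cdf_bound:
  assumes M: "rdist M" and N: "rdist N" and h: "h \<ge> 0"
    and le: "\<And>x. \<bar>cdf M x - cdf N x\<bar> \<le> \<Delta>"
  shows "\<bar>(\<integral>u. indicator {0<..} u * exp (- h * u) \<partial>M) - (\<integral>u. indicator {0<..} u * exp (- h * u) \<partial>N)\<bar> \<le> 2 * \<Delta>"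
proof -
  interpret M: Distribution_Functions.real_distribution M by (rule M)
  interpret N: Distribution_Functions.real_distribution N by (rule N)
  have \<Delta>: "\<Delta> \<ge> 0" using le[of 0] by simp
  show ?thesis
  proof (cases "h = 0")
    case True
    have *: "(\<integral>u. indicator {0<..} u * exp (- 0 * u) \<partial>K) = 1 - cdf K 0" if "rdist K" for K
    proof -
      interpret K: Distribution_Functions.real_distribution K by (rule that)
      have "measure K (space K - {..0}) = 1 - cdf K 0" unfolding cdf_def by (rule K.prob_compl) auto
      moreover have "space K - {..0} = {0<..}" by auto
      ultimately show ?thesis by simp
    qed
    show ?thesis using le[of 0] \<Delta> unfolding True *[OF M] *[OF N] by linarith
  next
    case False
    with h have h: "h > 0" by simp
    define E where "E = density lborel (exponential_density h)"
    interpret E: prob_space E unfolding E_def by (rule prob_space_exponential_density[OF h])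
    have sets_E: "sets E = sets borel" by (simp add: E_def)
    have int: "integrable E (\<lambda>v. measure K {0<..v})" if "rdist K" for K
    proof -
      interpret K: Distribution_Functions.real_distribution K by (rule that)
      have "(\<lambda>v. measure K {0<..v}) \<in> borel_measurable borel"
        by (intro borel_measurable_mono monoI K.finite_measure_mono) auto
      then have "(\<lambda>v. measure K {0<..v}) \<in> borel_measurable E"
        by (simp add: measurable_cong_sets[OF sets_E refl])
      then show ?thesis by (intro E.integrable_const_bound[of _ 1]) auto
    qed
    have diff: "\<bar>measure M {0<..v} - measure N {0<..v}\<bar> \<le> 2 * \<Delta>" for v
    proof (cases "v > 0")
      case True
      then show ?thesis
        using M.cdf_diff_eq[OF True] N.cdf_diff_eq[OF True] le[of 0] le[of v] by linarith
    qed (use \<Delta> in simp)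
    have "\<bar>(\<integral>v. measure M {0<..v} \<partial>E) - (\<integral>v. measure N {0<..v} \<partial>E)\<bar>
        = \<bar>\<integral>v. measure M {0<..v} - measure N {0<..v} \<partial>E\<bar>"
      by (simp add: int M N)
    also have "\<dots> \<le> (\<integral>v. \<bar>measure M {0<..v} - measure N {0<..v}\<bar> \<partial>E)"
      by (rule integral_abs_bound)
    also have "\<dots> \<le> (\<integral>v. 2 * \<Delta> \<partial>E)"
      by (intro integral_mono integrable_abs Bochner_Integration.integrable_diff int M N diff) auto
    finally show ?thesis
      unfolding laplace_eq_integral_Ioc[OF M h] laplace_eq_integral_Ioc[OF N h] E_def[symmetric]
      by (simp add: E.prob_space)
  qed
qed

subsection \<open>Cumulant bounds\<close>

text \<open>The complex derivative can be computed along the real axis, where the imaginary part is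
  constant.\<close>

lemma Im_deriv_eq_0:
  assumes f: "f holomorphic_on ball 0 R" and real: "\<And>x. \<bar>x\<bar> < R \<Longrightarrow> Im (f (of_real x)) = 0"
    and x: "\<bar>x\<bar> < R"
  shows "Im (deriv f (of_real x)) = 0"
proof -
  have "(f has_field_derivative deriv f (of_real x)) (at (of_real x))"
    using f x by (intro holomorphic_derivI[of _ "ball 0 R"]) auto
  then have "((\<lambda>t. f (of_real t)) has_vector_derivative deriv f (of_real x)) (at x)"
    by (rule has_vector_derivative_real_field)
  then have "((\<lambda>t. Im (f (of_real t))) has_vector_derivative Im (deriv f (of_real x))) (at x)"
    by (rule bounded_linear.has_vector_derivative[OF bounded_linear_Im])
  moreover have "((\<lambda>t. Im (f (of_real t))) has_vector_derivative 0) (at x)"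
    by (rule has_vector_derivative_transform_within_open[of "\<lambda>_. 0" 0 _ "{-R<..<R}"])
       (use x real in auto)
  ultimately show ?thesis by (rule vector_derivative_unique_at)
qed

lemma power_le_exp:
  fixes y :: real
  assumes "y \<ge> 0" "k > 0"
  shows "y ^ k \<le> real k ^ k * exp y"
proof -
  have "y / real k \<le> exp (y / real k)"
    using exp_ge_add_one_self[of "y / real k"] by linarith
  then have "(y / real k) ^ k \<le> exp (y / real k) ^ k"
    using assms by (intro power_mono) auto
  also have "\<dots> = exp y" using assms by (simp flip: exp_of_nat_mult)
  finally show ?thesis using assms by (simp add: power_divide field_simps)
qed

text \<open>The variance and the branch of the logarithm are parameters so that reflected and
  rescaled laws are again instances with explicit data.\<close>

locale A1_distribution = Distribution_Functions.real_distribution F for F :: "real measure" +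
  fixes \<tau> v :: real and \<phi> :: "complex \<Rightarrow> complex"
  assumes \<tau>_pos: "\<tau> > 0"
    and holo: "\<phi> holomorphic_on ball 0 (1 / \<tau>)"
    and \<phi>_0: "\<phi> 0 = 0"
    and exp_integrable: "\<And>z. z \<in> ball 0 (1 / \<tau>) \<Longrightarrow> integrable F (\<lambda>x. exp (z * complex_of_real x))"
    and exp_\<phi>: "\<And>z. z \<in> ball 0 (1 / \<tau>) \<Longrightarrow> exp (\<phi> z) = (\<integral>x. exp (z * complex_of_real x) \<partial>F)"
    and third: "\<And>z. z \<in> ball 0 (1 / \<tau>) \<Longrightarrow> cmod ((deriv ^^ 3) \<phi> z) \<le> \<tau> * v"
    and mean: "expectation (\<lambda>x. x) = 0"
    and var: "variance (\<lambda>x. x) = v"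
begin

lemma v_nonneg: "v \<ge> 0"
  unfolding var[symmetric] by (intro integral_nonneg_AE) auto

lemma real_exp_integrable:
  assumes "\<bar>h\<bar> < 1 / \<tau>" shows "integrable F (\<lambda>x. exp (h * x))"
proof -
  have "integrable F (\<lambda>x. cmod (exp (of_real h * complex_of_real x)))"
    by (intro integrable_norm exp_integrable) (use assms in auto)
  then show ?thesis by (simp add: norm_exp_eq_Re)
qed

lemma abs_exp_integrable:
  assumes "0 \<le> h" "h < 1 / \<tau>" shows "integrable F (\<lambda>x. exp (h * \<bar>x\<bar>))"
proof (rule Bochner_Integration.integrable_bound)
  show "integrable F (\<lambda>x. exp (h * x) + exp (- h * x))"
    using assms by (intro Bochner_Integration.integrable_add real_exp_integrable) auto
  show "AE x in F. norm (exp (h * \<bar>x\<bar>)) \<le> norm (exp (h * x) + exp (- h * x))"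
  proof (rule AE_I2)
    fix x
    have "norm (exp (h * x) + exp (- h * x)) = exp (h * x) + exp (- h * x)"
      by (simp add: add_pos_pos less_imp_le)
    then show "norm (exp (h * \<bar>x\<bar>)) \<le> norm (exp (h * x) + exp (- h * x))"
      by (cases "x \<ge> 0") simp_all
  qed
qed simp

lemma abs_moment_integrable:
  assumes "k > 0" shows "integrable F (\<lambda>x. \<bar>x\<bar> ^ k)"
proof (rule Bochner_Integration.integrable_bound)
  let ?h = "1 / (2 * \<tau>)"
  show "integrable F (\<lambda>x. (real k ^ k / ?h ^ k) * exp (?h * \<bar>x\<bar>))"
    using \<tau>_pos by (intro integrable_mult_right abs_exp_integrable) (auto simp: field_simps)
  show "AE x in F. norm (\<bar>x\<bar> ^ k) \<le> norm ((real k ^ k / ?h ^ k) * exp (?h * \<bar>x\<bar>))"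
  proof (rule AE_I2)
    fix x
    have "(?h * \<bar>x\<bar>) ^ k \<le> real k ^ k * exp (?h * \<bar>x\<bar>)"
      using \<tau>_pos assms by (intro power_le_exp) auto
    then have "\<bar>x\<bar> ^ k \<le> (real k ^ k / ?h ^ k) * exp (?h * \<bar>x\<bar>)"
      using \<tau>_pos by (simp add: power_mult_distrib field_simps)
    moreover have "0 \<le> (real k ^ k / ?h ^ k) * exp (?h * \<bar>x\<bar>)" using \<tau>_pos by simp
    ultimately show "norm (\<bar>x\<bar> ^ k) \<le> norm ((real k ^ k / ?h ^ k) * exp (?h * \<bar>x\<bar>))"
      by (simp only: real_norm_def power_abs abs_abs abs_of_nonneg)
  qed
qed simp

lemma moment_integrable:
  assumes "k > 0" shows "integrable F (\<lambda>x. x ^ k)"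
  by (rule Bochner_Integration.integrable_bound[OF abs_moment_integrable[OF assms]]) (auto simp: power_abs)

section \<open>Taylor expansion of \<phi> and its coefficients at 0\<close>

lemma char_eq: "\<bar>t\<bar> < 1 / \<tau> \<Longrightarrow> char F t = exp (\<phi> (\<i> * of_real t))"
  unfolding char_def by (subst exp_\<phi>) (auto simp: norm_mult mult_ac)

text \<open>This moment expansion identifies \<phi>'(0) and \<phi>''(0) without differentiation
  under the integral sign.\<close>

lemma char_approx: "\<exists>C. \<forall>t. cmod (char F t - (1 - t\<^sup>2 * v / 2)) \<le> C * \<bar>t\<bar> ^ 3"
proof (intro exI allI)
  fix t
  have "cmod (char F t - (1 - t\<^sup>2 * v / 2)) \<le> (t\<^sup>2 / 6) * expectation (\<lambda>x. min (6 * x\<^sup>2) (\<bar>t\<bar> * \<bar>x\<bar> ^ 3))"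
    using moment_integrable[of 1] moment_integrable[of 2] mean var by (intro char_approx3) auto
  also have "\<dots> \<le> (t\<^sup>2 / 6) * expectation (\<lambda>x. \<bar>t\<bar> * \<bar>x\<bar> ^ 3)"
    by (intro mult_left_mono integral_mono' integrable_mult_right abs_moment_integrable) auto
  also have "\<dots> = (expectation (\<lambda>x. \<bar>x\<bar> ^ 3) / 6) * \<bar>t\<bar> ^ 3"
    by (simp add: power3_eq_cube power2_eq_square abs_mult[symmetric])
  finally show "cmod (char F t - (1 - t\<^sup>2 * v / 2)) \<le> (expectation (\<lambda>x. \<bar>x\<bar> ^ 3) / 6) * \<bar>t\<bar> ^ 3" .
qed

lemma higher_deriv_has_deriv:
  "z \<in> ball 0 (1 / \<tau>) \<Longrightarrow> ((deriv ^^ i) \<phi> has_field_derivative (deriv ^^ Suc i) \<phi> z) (at z within ball 0 (1 / \<tau>))"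
  using holomorphic_derivI[OF holomorphic_higher_deriv[OF holo open_ball, of i] open_ball]
  by (simp add: has_field_derivative_at_within)

lemma third':
  "z \<in> ball 0 (1 / \<tau>) \<Longrightarrow> cmod ((deriv ^^ Suc (Suc (Suc 0))) \<phi> z) \<le> \<tau> * v"
  using third[of z] by (simp add: eval_nat_numeral)

text \<open>The complex Taylor theorem bounds the remainder of degree n by B |z - w|^(n+1) / n!,
  which explains the denominator 2 for a third-order remainder.\<close>

lemma taylor2:
  assumes "z \<in> ball 0 (1 / \<tau>)" "w \<in> ball 0 (1 / \<tau>)"
  shows "cmod (\<phi> z - (\<phi> w + deriv \<phi> w * (z - w) + deriv (deriv \<phi>) w * (z - w)\<^sup>2 / 2))
     \<le> \<tau> * v * cmod (z - w) ^ 3 / 2"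
  using complex_Taylor[of "ball 0 (1 / \<tau>)" 2 "\<lambda>i. (deriv ^^ i) \<phi>" "\<tau> * v" w z]
    higher_deriv_has_deriv third' assms
  by (simp add: eval_nat_numeral add_ac)

lemma taylor1:
  assumes "z \<in> ball 0 (1 / \<tau>)" "w \<in> ball 0 (1 / \<tau>)"
  shows "cmod (deriv \<phi> z - (deriv \<phi> w + deriv (deriv \<phi>) w * (z - w))) \<le> \<tau> * v * cmod (z - w) ^ 2"
  using complex_Taylor[of "ball 0 (1 / \<tau>)" 1 "\<lambda>i. (deriv ^^ Suc i) \<phi>" "\<tau> * v" w z]
    higher_deriv_has_deriv[of _ "Suc _"] third' assms
  by (simp add: eval_nat_numeral add_ac)

lemma taylor0:
  assumes "z \<in> ball 0 (1 / \<tau>)" "w \<in> ball 0 (1 / \<tau>)"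
  shows "cmod (deriv (deriv \<phi>) z - deriv (deriv \<phi>) w) \<le> \<tau> * v * cmod (z - w)"
  using complex_Taylor[of "ball 0 (1 / \<tau>)" 0 "\<lambda>i. (deriv ^^ Suc (Suc i)) \<phi>" "\<tau> * v" w z]
    higher_deriv_has_deriv[of _ "Suc (Suc 0)"] third' assms
  by (simp add: eval_nat_numeral add_ac)

lemma zero_in_ball: "0 \<in> ball 0 (1 / \<tau>)" using \<tau>_pos by simp

text \<open>Along the imaginary axis exp \<phi> is the characteristic function, whose expansion has
  no linear term because the mean is 0.\<close>

lemma deriv_\<phi>_0: "deriv \<phi> 0 = 0"
proof -
  obtain C where C: "\<And>t. cmod (char F t - (1 - t\<^sup>2 * v / 2)) \<le> C * \<bar>t\<bar> ^ 3"
    using char_approx by auto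
  have "(\<phi> has_field_derivative deriv \<phi> 0) (at 0)"
    using holo zero_in_ball by (intro holomorphic_derivI[of _ "ball 0 (1 / \<tau>)"]) auto
  then have "((\<lambda>z. exp (\<phi> z)) has_field_derivative deriv \<phi> 0) (at 0)"
    by (auto intro!: derivative_eq_intros simp: \<phi>_0)
  then have "((\<lambda>z. (exp (\<phi> z) - 1) / z) \<longlongrightarrow> deriv \<phi> 0) (at 0)"
    by (simp add: has_field_derivative_iff \<phi>_0)
  moreover have "filterlim (\<lambda>t. \<i> * complex_of_real t) (at 0) (at 0)"
    by (rule filterlim_atI) (auto intro!: tendsto_eq_intros simp: eventually_at_filter)
  ultimately have lim: "((\<lambda>t. (exp (\<phi> (\<i> * of_real t)) - 1) / (\<i> * of_real t)) \<longlongrightarrow> deriv \<phi> 0) (at (0::real))"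
    by (rule filterlim_compose)
  have "((\<lambda>t. (exp (\<phi> (\<i> * of_real t)) - 1) / (\<i> * of_real t)) \<longlongrightarrow> 0) (at (0::real))"
  proof (rule Lim_null_comparison)
    have "eventually (\<lambda>t. t \<in> {-1/\<tau><..<1/\<tau>}) (at (0::real))"
      using \<tau>_pos by (intro eventually_at_in_open') auto
    then show "eventually (\<lambda>t. cmod ((exp (\<phi> (\<i> * of_real t)) - 1) / (\<i> * of_real t)) \<le> C * \<bar>t\<bar>\<^sup>2 + \<bar>t\<bar> * v / 2) (at (0::real))"
      unfolding eventually_at_filter
    proof eventually_elim
      case (elim t)
      show ?case
      proof (intro impI)
        assume t: "t \<noteq> 0"
        have "cmod (char F t - 1) \<le> cmod (char F t - (1 - t\<^sup>2 * v / 2)) + cmod (t\<^sup>2 * v / 2)"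
          using norm_triangle_ineq4[of "char F t - (1 - t\<^sup>2 * v / 2)" "complex_of_real (t\<^sup>2 * v / 2)"]
          by simp
        also have "\<dots> \<le> C * \<bar>t\<bar> ^ 3 + t\<^sup>2 * v / 2"
          using C[of t] v_nonneg by (simp add: norm_mult norm_divide norm_power)
        also have "\<dots> = (C * \<bar>t\<bar>\<^sup>2 + \<bar>t\<bar> * v / 2) * \<bar>t\<bar>"
          by (simp add: power2_eq_square power3_eq_cube algebra_simps)
        finally show "cmod ((exp (\<phi> (\<i> * of_real t)) - 1) / (\<i> * of_real t)) \<le> C * \<bar>t\<bar>\<^sup>2 + \<bar>t\<bar> * v / 2"
          using t elim by (simp add: norm_divide norm_mult char_eq abs_less_iff divide_le_eq)
      qed
    qed
    show "((\<lambda>t. C * \<bar>t\<bar>\<^sup>2 + \<bar>t\<bar> * v / 2) \<longlongrightarrow> 0) (at (0::real))"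
      by (auto intro!: tendsto_eq_intros)
  qed
  with lim show ?thesis by (intro tendsto_unique[OF _ lim]) auto
qed

text \<open>With w = \<phi>(i t) there are two expansions of exp w up to O(t^3): one from w = -b
  t^2/2 + O(t^3), the other from the moments. Comparing them gives |b - v| = O(t), and t tends to
  0.\<close>

lemma deriv2_\<phi>_0: "deriv (deriv \<phi>) 0 = of_real v"
proof -
  obtain C where C: "\<And>t. cmod (char F t - (1 - t\<^sup>2 * v / 2)) \<le> C * \<bar>t\<bar> ^ 3"
    using char_approx by auto
  define b where "b = deriv (deriv \<phi>) 0"
  define B where "B = cmod b / 2 + v / 2"
  have B: "B \<ge> 0" using v_nonneg by (simp add: B_def)
  define K where "K = 2 * (C + \<tau> * v / 2 + B\<^sup>2 * exp B)"
  have main: "cmod (b - of_real v) \<le> K * t" if t: "0 < t" "t < 1 / \<tau>" "t \<le> 1" for t :: real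
  proof -
    define w where "w = \<phi> (\<i> * of_real t)"
    have "cmod (w - (b * (\<i> * of_real t)\<^sup>2 / 2)) \<le> \<tau> * v * t ^ 3 / 2"
      using taylor2[of "\<i> * of_real t" 0] t zero_in_ball
      by (simp add: w_def b_def \<phi>_0 deriv_\<phi>_0 norm_mult)
    then have w1: "cmod (w + b * t\<^sup>2 / 2) \<le> \<tau> * v * t ^ 3 / 2"
      by (simp add: power_mult_distrib)
    have "\<tau> * v * t ^ 3 / 2 = (\<tau> * t) * (v * t\<^sup>2 / 2)" by (simp add: power2_eq_square power3_eq_cube)
    also have "\<dots> \<le> 1 * (v * t\<^sup>2 / 2)"
      using t \<tau>_pos v_nonneg by (intro mult_right_mono) (auto simp: field_simps)
    finally have "cmod (w + b * t\<^sup>2 / 2) \<le> v * t\<^sup>2 / 2" using w1 by simp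
    then have w2: "cmod w \<le> B * t\<^sup>2"
      using norm_triangle_ineq4[of "w + b * t\<^sup>2 / 2" "b * t\<^sup>2 / 2"]
      by (simp add: norm_mult norm_divide norm_power B_def algebra_simps)
    also have "\<dots> \<le> B * 1" using t B by (intro mult_left_mono power_le_one) auto
    finally have w3: "cmod w \<le> B" by simp
    have "cmod (exp w - (1 + w)) \<le> exp \<bar>Re w\<bar> * cmod w ^ 2"
      using Taylor_exp[of w 1] by (simp add: eval_nat_numeral)
    also have "\<dots> \<le> exp B * (B * t\<^sup>2)\<^sup>2"
      using w2 w3 abs_Re_le_cmod[of w] by (intro mult_mono power_mono) auto
    also have "\<dots> = exp B * B\<^sup>2 * t ^ 3 * t" by (simp add: power2_eq_square power3_eq_cube)
    also have "\<dots> \<le> exp B * B\<^sup>2 * t ^ 3 * 1" using t by (intro mult_left_mono) auto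
    finally have w4: "cmod (exp w - (1 + w)) \<le> exp B * B\<^sup>2 * t ^ 3" by simp
    have w5: "cmod (exp w - (1 - t\<^sup>2 * v / 2)) \<le> C * t ^ 3"
      using C[of t] t by (simp add: w_def char_eq)
    have eq: "(b - of_real v) * of_real (t\<^sup>2 / 2) =
      (w + b * t\<^sup>2 / 2) + (exp w - (1 + w)) - (exp w - (1 - t\<^sup>2 * v / 2))"
      by (simp add: field_simps)
    have "cmod ((b - of_real v) * of_real (t\<^sup>2 / 2)) \<le> \<tau> * v * t ^ 3 / 2 + exp B * B\<^sup>2 * t ^ 3 + C * t ^ 3"
      unfolding eq using norm_triangle_ineq4[of "(w + b * t\<^sup>2 / 2) + (exp w - (1 + w))" "exp w - (1 - t\<^sup>2 * v / 2)"]
        norm_triangle_ineq[of "w + b * t\<^sup>2 / 2" "exp w - (1 + w)"] w1 w4 w5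
      by linarith
    also have "\<dots> = (K * t) * (t\<^sup>2 / 2)"
      by (simp add: K_def power2_eq_square power3_eq_cube algebra_simps)
    finally have "cmod (b - of_real v) * (t\<^sup>2 / 2) \<le> (K * t) * (t\<^sup>2 / 2)"
      by (simp add: norm_mult norm_divide norm_power)
    then show ?thesis using t by simp
  qed
  have "((\<lambda>t. K * t) \<longlongrightarrow> K * 0) (at_right 0)"
    by (intro tendsto_intros)
  moreover have "eventually (\<lambda>t. cmod (b - of_real v) \<le> K * t) (at_right 0)"
    unfolding eventually_at_right[OF zero_less_one]
    using main \<tau>_pos by (intro exI[of _ "min 1 (1 / \<tau>)"]) auto
  ultimately have "cmod (b - of_real v) \<le> K * 0"
    by (intro tendsto_lowerbound) auto
  then show ?thesis by (simp add: b_def)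
qed

text \<open>The branch is fixed only by analyticity and \<phi>(0) = 0. On the real axis exp \<phi>
  is a nonnegative real, so Im \<phi> takes values in 2 pi Z; by continuity it is constant there,
  hence 0.\<close>

lemma Im_\<phi>: assumes "\<bar>h\<bar> < 1 / \<tau>" shows "Im (\<phi> (of_real h)) = 0"
proof -
  let ?S = "{-1/\<tau><..<1/\<tau>}"
  have ex: "\<exists>n::int. Im (\<phi> (of_real x)) = of_int (2 * n) * pi" if "x \<in> ?S" for x
  proof -
    from that have x: "complex_of_real x \<in> ball 0 (1 / \<tau>)" "\<bar>x\<bar> < 1 / \<tau>" by (auto simp: dist_norm abs_less_iff)
    have "exp (\<phi> (of_real x)) = (\<integral>y. complex_of_real (exp (x * y)) \<partial>F)"
      using exp_\<phi>[OF x(1)] by (simp flip: exp_of_real)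
    also have "\<dots> = of_real (\<integral>y. exp (x * y) \<partial>F)" by simp
    finally have eq: "exp (\<phi> (of_real x)) = of_real (\<integral>y. exp (x * y) \<partial>F)" .
    have "0 \<le> (\<integral>y. exp (x * y) \<partial>F)" by (intro integral_nonneg_AE) auto
    also have "\<dots> = Re (exp (\<phi> (of_real x)))" by (simp add: eq)
    also have "\<dots> = exp (Re (\<phi> (of_real x))) * cos (Im (\<phi> (of_real x)))" by (simp add: Re_exp)
    finally have "cos (Im (\<phi> (of_real x))) \<ge> 0" by (simp add: zero_le_mult_iff)
    have "Im (exp (\<phi> (of_real x))) = exp (Re (\<phi> (of_real x))) * sin (Im (\<phi> (of_real x)))"
      by (simp add: Im_exp)
    then have "sin (Im (\<phi> (of_real x))) = 0" unfolding eq by simp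
    with \<open>cos (Im (\<phi> (of_real x))) \<ge> 0\<close> have "cos (Im (\<phi> (of_real x))) = 1"
      using sin_cos_squared_add[of "Im (\<phi> (of_real x))"] by (auto simp: power2_eq_1_iff)
    then show ?thesis by (auto simp: cos_one_2pi_int)
  qed
  have "(\<lambda>x. Im (\<phi> (complex_of_real x))) constant_on ?S"
  proof (rule continuous_discrete_range_constant)
    show "connected ?S" by (rule connected_Ioo)
    show "continuous_on ?S (\<lambda>x. Im (\<phi> (complex_of_real x)))"
      by (intro continuous_intros continuous_on_compose2[OF holomorphic_on_imp_continuous_on[OF holo]]) auto
    show "\<exists>e>0. \<forall>y. y \<in> ?S \<and> Im (\<phi> (complex_of_real y)) \<noteq> Im (\<phi> (complex_of_real x)) \<longrightarrow>
      e \<le> norm (Im (\<phi> (complex_of_real y)) - Im (\<phi> (complex_of_real x)))" if x: "x \<in> ?S" for x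
    \<comment> \<open>Distinct multiples of 2 pi are at least 2 pi apart; the cruder gap pi is
      enough for discreteness.\<close>
    proof (intro exI[of _ pi] conjI allI impI)
      fix y assume y: "y \<in> ?S \<and> Im (\<phi> (complex_of_real y)) \<noteq> Im (\<phi> (complex_of_real x))"
      obtain n where n: "Im (\<phi> (of_real x)) = of_int (2 * n) * pi" using ex[OF x] by auto
      obtain k where k: "Im (\<phi> (of_real y)) = of_int (2 * k) * pi" using ex y by blast
      have "k \<noteq> n" using y n k by auto
      then have "1 \<le> \<bar>2 * (k - n)\<bar>" by presburger
      then have "1 \<le> \<bar>real_of_int (2 * (k - n))\<bar>"
        by (simp only: of_int_abs[symmetric] of_int_1_le_iff)
      then have "1 * pi \<le> \<bar>real_of_int (2 * (k - n))\<bar> * pi" by (intro mult_right_mono) auto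
      also have "\<dots> = \<bar>real_of_int (2 * (k - n)) * pi\<bar>" by (simp add: abs_mult)
      also have "real_of_int (2 * (k - n)) * pi = Im (\<phi> (of_real y)) - Im (\<phi> (of_real x))"
        by (simp add: n k algebra_simps)
      finally show "pi \<le> norm (Im (\<phi> (complex_of_real y)) - Im (\<phi> (complex_of_real x)))" by simp
    qed simp
  qed
  then obtain c where "\<And>x. x \<in> ?S \<Longrightarrow> Im (\<phi> (complex_of_real x)) = c"
    by (auto simp: constant_on_def)
  from this[of h] this[of 0] assms \<tau>_pos show ?thesis by (auto simp: \<phi>_0 abs_less_iff)
qed

lemma Im_deriv_\<phi>: "\<bar>h\<bar> < 1 / \<tau> \<Longrightarrow> Im (deriv \<phi> (of_real h)) = 0"
  by (rule Im_deriv_eq_0[OF holo]) (auto intro: Im_\<phi>)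

lemma Im_deriv2_\<phi>: "\<bar>h\<bar> < 1 / \<tau> \<Longrightarrow> Im (deriv (deriv \<phi>) (of_real h)) = 0"
  by (rule Im_deriv_eq_0[of _ "1 / \<tau>"]) (auto intro: Im_deriv_\<phi> holomorphic_deriv holo)

lemma exp_real:
  assumes "\<bar>h\<bar> < 1 / \<tau>"
  shows "(\<integral>x. exp (h * x) \<partial>F) = exp (Re (\<phi> (of_real h)))"
proof -
  have "complex_of_real (\<integral>x. exp (h * x) \<partial>F) = (\<integral>x. complex_of_real (exp (h * x)) \<partial>F)" by simp
  also have "\<dots> = exp (\<phi> (of_real h))"
    using assms by (subst exp_\<phi>) (auto simp flip: exp_of_real)
  also have "\<phi> (of_real h) = of_real (Re (\<phi> (of_real h)))"
    using Im_\<phi>[OF assms] by (simp add: complex_eq_iff)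
  finally show ?thesis by (simp only: exp_of_real of_real_eq_iff)
qed

lemma \<phi>_real_bound:
  assumes "\<bar>h\<bar> < 1 / \<tau>"
  shows "\<bar>Re (\<phi> (of_real h)) - v * h\<^sup>2 / 2\<bar> \<le> \<tau> * v * \<bar>h\<bar> ^ 3 / 2"
proof -
  have "cmod (\<phi> (of_real h) - of_real v * (of_real h)\<^sup>2 / 2) \<le> \<tau> * v * \<bar>h\<bar> ^ 3 / 2"
    using taylor2[of "of_real h" 0] assms zero_in_ball by (simp add: \<phi>_0 deriv_\<phi>_0 deriv2_\<phi>_0)
  moreover have "of_real v * (complex_of_real h)\<^sup>2 / 2 = of_real (v * h\<^sup>2 / 2)" by simp
  ultimately show ?thesis
    using abs_Re_le_cmod[of "\<phi> (of_real h) - of_real v * (of_real h)\<^sup>2 / 2"]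
    by (simp del: of_real_mult of_real_divide of_real_power)
qed

lemma deriv_\<phi>_real_bound:
  assumes "\<bar>h\<bar> < 1 / \<tau>"
  shows "\<bar>Re (deriv \<phi> (of_real h)) - v * h\<bar> \<le> \<tau> * v * h\<^sup>2"
proof -
  have "cmod (deriv \<phi> (of_real h) - of_real (v * h)) \<le> \<tau> * v * h\<^sup>2"
    using taylor1[of "of_real h" 0] assms zero_in_ball by (simp add: deriv_\<phi>_0 deriv2_\<phi>_0)
  then show ?thesis
    using abs_Re_le_cmod[of "deriv \<phi> (of_real h) - of_real (v * h)"]
    by (simp del: of_real_mult)
qed

lemma deriv2_\<phi>_real_bound:
  assumes "\<bar>h\<bar> < 1 / \<tau>"
  shows "\<bar>Re (deriv (deriv \<phi>) (of_real h)) - v\<bar> \<le> \<tau> * v * \<bar>h\<bar>"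
proof -
  have "cmod (deriv (deriv \<phi>) (of_real h) - of_real v) \<le> \<tau> * v * \<bar>h\<bar>"
    using taylor0[of "of_real h" 0] assms zero_in_ball by (simp add: deriv2_\<phi>_0)
  then show ?thesis
    using abs_Re_le_cmod[of "deriv (deriv \<phi>) (of_real h) - of_real v"] by simp
qed

text \<open>The third derivative acquires a^3, exactly the factor by which the product of class
  parameter and variance grows in absolute value. Negative a is included to obtain
  reflections.\<close>

lemma A1_scale:
  assumes a: "a \<noteq> 0"
  shows "A1_distribution (distr F borel (\<lambda>x. a * x)) (\<bar>a\<bar> * \<tau>) (a\<^sup>2 * v) (\<lambda>z. \<phi> (of_real a * z))"
proof -
  have ball: "of_real a * z \<in> ball 0 (1 / \<tau>)" if "z \<in> ball 0 (1 / (\<bar>a\<bar> * \<tau>))" for z :: complex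
    using that a \<tau>_pos by (simp add: norm_mult field_simps)
  interpret G: Distribution_Functions.real_distribution "distr F borel (\<lambda>x. a * x)" by simp
  show ?thesis
  proof
    show "0 < \<bar>a\<bar> * \<tau>" using a \<tau>_pos by simp
    show "(\<lambda>z. \<phi> (of_real a * z)) holomorphic_on ball 0 (1 / (\<bar>a\<bar> * \<tau>))"
      using ball by (intro holomorphic_on_compose_gen[OF _ holo, unfolded comp_def] holomorphic_intros) auto
    show "\<phi> (of_real a * 0) = 0" by (simp add: \<phi>_0)
    fix z :: complex assume z: "z \<in> ball 0 (1 / (\<bar>a\<bar> * \<tau>))"
    show "integrable (distr F borel (\<lambda>x. a * x)) (\<lambda>x. exp (z * complex_of_real x))"
      using exp_integrable[OF ball[OF z]] by (subst integrable_distr_eq) (auto simp: mult_ac)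
    show "exp (\<phi> (of_real a * z)) = (\<integral>x. exp (z * complex_of_real x) \<partial>distr F borel (\<lambda>x. a * x))"
      using exp_\<phi>[OF ball[OF z]] by (subst integral_distr) (auto simp: mult_ac)
    have "(deriv ^^ 3) (\<lambda>w. \<phi> (of_real a * w)) z = of_real a ^ 3 * (deriv ^^ 3) \<phi> (of_real a * z)"
      using ball z by (intro higher_deriv_compose_linear[OF holo, of "ball 0 (1 / (\<bar>a\<bar> * \<tau>))"]) auto
    then have "cmod ((deriv ^^ 3) (\<lambda>w. \<phi> (of_real a * w)) z) \<le> \<bar>a\<bar> ^ 3 * (\<tau> * v)"
      using third[OF ball[OF z]] by (auto simp: norm_mult norm_power intro!: mult_left_mono)
    then show "cmod ((deriv ^^ 3) (\<lambda>w. \<phi> (of_real a * w)) z) \<le> \<bar>a\<bar> * \<tau> * (a\<^sup>2 * v)"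
      by (simp add: power3_eq_cube power2_eq_square mult_ac)
  next
    show mean': "G.expectation (\<lambda>x. x) = 0"
      using mean by (subst integral_distr) auto
    have "G.variance (\<lambda>x. x) = expectation (\<lambda>x. (a * x)\<^sup>2)"
      unfolding mean' by (subst integral_distr) auto
    also have "\<dots> = a\<^sup>2 * v"
      using var mean by (simp add: power_mult_distrib)
    finally show "G.variance (\<lambda>x. x) = a\<^sup>2 * v" .
  qed
qed

end

lemma class_A1_imp_A1_distribution:
  assumes F: "F \<in> class_A1 \<tau>" and \<tau>: "\<tau> > 0" and mean: "prob_space.expectation F (\<lambda>x. x) = 0"
  shows "\<exists>\<phi>. A1_distribution F \<tau> (prob_space.variance F (\<lambda>x. x)) \<phi>"
proof -
  have ball: "{z. cmod z * \<tau> < 1} = ball 0 (1 / \<tau>)"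
    using \<tau> by (auto simp: field_simps)
  from F obtain \<phi> where F': "prob_space F" "sets F = sets borel"
    and \<phi>: "is_log_laplace F {z. cmod z * \<tau> < 1} \<phi>"
    and third: "\<And>z. cmod z * \<tau> < 1 \<Longrightarrow> cmod ((deriv ^^ 3) \<phi> z) \<le> \<tau> * prob_space.variance F (\<lambda>x. x)"
    by (auto simp: class_A1_def real_distribution_def)
  interpret prob_space F by (rule F')
  have "A1_distribution F \<tau> (variance (\<lambda>x. x)) \<phi>"
  proof
    show "\<phi> holomorphic_on ball 0 (1 / \<tau>)"
      using \<phi> unfolding ball is_log_laplace_def by (auto intro: analytic_imp_holomorphic)
    fix z :: complex assume "z \<in> ball 0 (1 / \<tau>)"
    then have "cmod z * \<tau> < 1" using ball by auto
    then show "integrable F (\<lambda>x. exp (z * complex_of_real x))"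
      "exp (\<phi> z) = (\<integral>x. exp (z * complex_of_real x) \<partial>F)"
      "cmod ((deriv ^^ 3) \<phi> z) \<le> \<tau> * variance (\<lambda>x. x)"
      using \<phi> third by (auto simp: is_log_laplace_def)
  qed (use \<phi> \<tau> F' mean in \<open>auto simp: is_log_laplace_def\<close>)
  then show ?thesis by blast
qed

subsection \<open>Exponential tilting\<close>

text \<open>The Esscher transform of \<open>F\<close> at h, recentred at its mean \<phi>'(h); its
  variance is \<phi>''(h). Taking \<open>Re\<close> loses nothing for |h| < 1/\<tau>, since \<phi>
  and \<phi>' are real there.\<close>

definition tilted :: "real measure \<Rightarrow> (complex \<Rightarrow> complex) \<Rightarrow> real \<Rightarrow> real measure" where
  "tilted F \<phi> h = distr (density F (\<lambda>x. ennreal (exp (h * x - Re (\<phi> (of_real h)))))) borel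
     (\<lambda>x. x - Re (deriv \<phi> (of_real h)))"

context A1_distribution
begin

lemma tilted_integral:
  fixes f :: "real \<Rightarrow> 'b :: {banach, second_countable_topology}"
  assumes [measurable]: "f \<in> borel_measurable borel"
  shows "(\<integral>u. f u \<partial>tilted F \<phi> h) =
    (\<integral>x. exp (h * x - Re (\<phi> (of_real h))) *\<^sub>R f (x - Re (deriv \<phi> (of_real h))) \<partial>F)"
  unfolding tilted_def by (simp add: integral_distr integral_density)

lemma tilted_real_distribution:
  assumes h: "\<bar>h\<bar> < 1 / \<tau>"
  shows "rdist (tilted F \<phi> h)"
proof -
  let ?D = "density F (\<lambda>x. ennreal (exp (h * x - Re (\<phi> (of_real h)))))"
  have int: "integrable F (\<lambda>x. exp (h * x - Re (\<phi> (of_real h))))"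
    using real_exp_integrable[OF h] by (simp add: exp_diff)
  have "(\<integral>x. exp (h * x - Re (\<phi> (of_real h))) \<partial>F) = 1"
    using exp_real[OF h] by (simp add: exp_diff)
  then have "(\<integral>\<^sup>+x. ennreal (exp (h * x - Re (\<phi> (of_real h)))) \<partial>F) = 1"
    by (subst nn_integral_eq_integral[OF int]) auto
  then have "prob_space ?D"
    by (intro prob_spaceI) (simp add: emeasure_density)
  then interpret D: prob_space ?D .
  show ?thesis unfolding tilted_def by (intro D.real_distribution_distr) auto
qed

text \<open>Tilting by h translates the argument of \<phi> by h, so the Taylor remainder at h
  controls the tilted law.\<close>

lemma char_tilted:
  assumes h: "\<bar>h\<bar> < 1 / \<tau>" and z: "of_real h + \<i> * of_real t \<in> ball 0 (1 / \<tau>)"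
  shows "char (tilted F \<phi> h) t = exp (\<phi> (of_real h + \<i> * of_real t) - \<phi> (of_real h)
    - \<i> * of_real t * deriv \<phi> (of_real h))"
proof -
  define L m where "L = Re (\<phi> (of_real h))" and "m = Re (deriv \<phi> (of_real h))"
  have L: "\<phi> (of_real h) = of_real L" and m: "deriv \<phi> (of_real h) = of_real m"
    using Im_\<phi>[OF h] Im_deriv_\<phi>[OF h] by (simp_all add: L_def m_def complex_eq_iff)
  have "char (tilted F \<phi> h) t = (\<integral>x. exp (h * x - L) *\<^sub>R iexp (t * (x - m)) \<partial>F)"
    unfolding char_def L_def m_def by (rule tilted_integral) simp
  also have "\<dots> = (\<integral>x. exp (- of_real L - \<i> * of_real t * of_real m) * exp ((of_real h + \<i> * of_real t) * of_real x) \<partial>F)"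
    by (intro Bochner_Integration.integral_cong)
       (simp_all add: scaleR_conv_of_real algebra_simps flip: exp_of_real exp_add)
  also have "\<dots> = exp (- of_real L - \<i> * of_real t * of_real m) * exp (\<phi> (of_real h + \<i> * of_real t))"
    by (subst exp_\<phi>[OF z]) simp
  finally show ?thesis by (simp add: L m algebra_simps flip: exp_add)
qed

text \<open>Undoing the density exp(h x) leaves exp(-h u) with u = x - \<phi>'(h). The tail of
  \<open>F\<close> thereby becomes an integral over the positive half-line against a centred
  law.\<close>

lemma tail_tilted:
  assumes h: "\<bar>h\<bar> < 1 / \<tau>"
  defines "L \<equiv> Re (\<phi> (of_real h))" and "m \<equiv> Re (deriv \<phi> (of_real h))"
  shows "measure F {m<..} = exp (L - h * m) * (\<integral>u. indicator {0<..} u * exp (- h * u) \<partial>tilted F \<phi> h)"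
proof -
  have "(\<integral>u. indicator {0<..} u * exp (- h * u) \<partial>tilted F \<phi> h)
      = (\<integral>x. exp (h * x - L) *\<^sub>R (indicator {0<..} (x - m) * exp (- h * (x - m))) \<partial>F)"
    unfolding L_def m_def by (rule tilted_integral) simp
  also have "\<dots> = (\<integral>x. exp (h * m - L) * indicator {m<..} x \<partial>F)"
    by (intro Bochner_Integration.integral_cong)
       (auto simp: algebra_simps split: split_indicator simp flip: exp_add)
  also have "\<dots> = exp (h * m - L) * measure F {m<..}" by simp
  finally show ?thesis by (simp add: mult.assoc[symmetric] flip: exp_add)
qed

text \<open>Bounding both |h| and |t| by a quarter of the radius keeps h + i t inside the disc. A
  factor |t| is split off because the smoothing inequality asks for it.\<close>

lemma char_tilted_approx:
  assumes v: "v = 1" and h: "\<bar>h\<bar> * \<tau> \<le> 1 / 4" and t: "\<bar>t\<bar> \<le> 1 / (4 * \<tau>)"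
  defines "s \<equiv> Re (deriv (deriv \<phi>) (of_real h))"
  shows "cmod (char (tilted F \<phi> h) t - of_real (exp (- s * t\<^sup>2 / 2)))
    \<le> \<bar>t\<bar> * (\<tau> / 2 * (t\<^sup>2 * exp (- t\<^sup>2 / 4)))"
proof -
  have "\<bar>h\<bar> * \<tau> < 1" using h by linarith
  then have h': "\<bar>h\<bar> < 1 / \<tau>" using \<tau>_pos by (simp add: field_simps)
  then have hball: "complex_of_real h \<in> ball 0 (1 / \<tau>)" by simp
  have t': "\<bar>t\<bar> * \<tau> \<le> 1 / 4" using t \<tau>_pos by (simp add: field_simps)
  have "cmod (of_real h + \<i> * of_real t) \<le> \<bar>h\<bar> + \<bar>t\<bar>"
    using norm_triangle_ineq[of "complex_of_real h" "\<i> * of_real t"] by (simp add: norm_mult)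
  then have "cmod (of_real h + \<i> * of_real t) * \<tau> \<le> (\<bar>h\<bar> + \<bar>t\<bar>) * \<tau>"
    using \<tau>_pos by (intro mult_right_mono) auto
  also have "\<dots> < 1" using h t' by (simp add: ring_distribs)
  finally have z: "of_real h + \<i> * of_real t \<in> ball 0 (1 / \<tau>)"
    using \<tau>_pos by (simp add: field_simps)
  have s: "deriv (deriv \<phi>) (of_real h) = of_real s"
    using Im_deriv2_\<phi>[OF h'] by (simp add: s_def complex_eq_iff)
  have s34: "s \<ge> 3 / 4"
    using deriv2_\<phi>_real_bound[OF h'] h v unfolding s_def by (auto simp: mult.commute)
  \<comment> \<open>The third-order Taylor remainder at h, that is, the logarithm of the ratio of
    the two transforms.\<close>
  define \<theta> where "\<theta> = \<phi> (of_real h + \<i> * of_real t) - \<phi> (of_real h)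
    - \<i> * of_real t * deriv \<phi> (of_real h) + of_real (s * t\<^sup>2 / 2)"
  have th1: "cmod \<theta> \<le> \<tau> * \<bar>t\<bar> ^ 3 / 2"
    using taylor2[OF z hball] v
    by (simp add: \<theta>_def s norm_mult power_mult_distrib algebra_simps)
  also have "\<dots> = (\<bar>t\<bar> * \<tau>) * (t\<^sup>2 / 2)"
    by (simp add: power2_eq_square power3_eq_cube)
  also have "\<dots> \<le> 1 / 4 * (t\<^sup>2 / 2)" using t' by (intro mult_right_mono) auto
  finally have th2: "cmod \<theta> \<le> t\<^sup>2 / 8" by simp
  have char: "char (tilted F \<phi> h) t = of_real (exp (- s * t\<^sup>2 / 2)) * exp \<theta>"
    unfolding char_tilted[OF h' z] \<theta>_def by (simp flip: exp_add exp_of_real)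
  have "cmod (exp \<theta> - 1) \<le> exp \<bar>Re \<theta>\<bar> * cmod \<theta>"
    using Taylor_exp[of \<theta> 0] by simp
  also have "\<dots> \<le> exp (t\<^sup>2 / 8) * (\<tau> * \<bar>t\<bar> ^ 3 / 2)"
    using th1 th2 abs_Re_le_cmod[of \<theta>] by (intro mult_mono) auto
  finally have th3: "cmod (exp \<theta> - 1) \<le> exp (t\<^sup>2 / 8) * (\<tau> * \<bar>t\<bar> ^ 3 / 2)" .
  have "char (tilted F \<phi> h) t - of_real (exp (- s * t\<^sup>2 / 2)) = of_real (exp (- s * t\<^sup>2 / 2)) * (exp \<theta> - 1)"
    unfolding char by (simp add: ring_distribs)
  then have "cmod (char (tilted F \<phi> h) t - of_real (exp (- s * t\<^sup>2 / 2))) = exp (- s * t\<^sup>2 / 2) * cmod (exp \<theta> - 1)"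
    by (simp add: norm_mult)
  \<comment> \<open>The exponents -3/8 from the variance bound s >= 3/4 and +1/8 from \<theta> add
    up to -1/4.\<close>
  also have "\<dots> \<le> exp (- (3 / 4) * t\<^sup>2 / 2) * (exp (t\<^sup>2 / 8) * (\<tau> * \<bar>t\<bar> ^ 3 / 2))"
  proof (intro mult_mono th3)
    have "3 / 4 * t\<^sup>2 \<le> s * t\<^sup>2" using s34 by (intro mult_right_mono) auto
    then show "exp (- s * t\<^sup>2 / 2) \<le> exp (- (3 / 4) * t\<^sup>2 / 2)" by simp
  qed auto
  also have "\<dots> = exp (- t\<^sup>2 / 4) * (\<tau> * \<bar>t\<bar> ^ 3 / 2)"
    by (simp add: mult.assoc[symmetric] flip: exp_add)
  also have "\<dots> = \<bar>t\<bar> * (\<tau> / 2 * (t\<^sup>2 * exp (- t\<^sup>2 / 4)))"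
    by (simp add: power2_eq_square power3_eq_cube)
  finally show ?thesis .
qed

end

lemma scaled_gauss:
  assumes s: "s > 0"
  defines "N \<equiv> distr gauss borel (\<lambda>x. s * x)"
  shows "rdist N" "char N t = of_real (exp (- s\<^sup>2 * t\<^sup>2 / 2))" "cdf N x = cdf gauss (x / s)"
    "(\<integral>u. indicator {0<..} u * exp (- h * u) \<partial>N) = mills (h * s)"
proof -
  show "rdist N" unfolding N_def by simp
  have "char N t = char gauss (t * s)"
    unfolding N_def char_def by (subst integral_distr) (auto simp: mult_ac)
  then show "char N t = of_real (exp (- s\<^sup>2 * t\<^sup>2 / 2))"
    by (simp add: char_std_normal_distribution power_mult_distrib mult.commute)
  have "(\<lambda>x. s * x) -` {..x} = {..x / s}" using s by (auto simp: field_simps)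
  then show "cdf N x = cdf gauss (x / s)"
    unfolding N_def cdf_def by (subst measure_distr) auto
  show "(\<integral>u. indicator {0<..} u * exp (- h * u) \<partial>N) = mills (h * s)"
    unfolding N_def mills_def using s
    by (subst integral_distr)
       (auto intro!: Bochner_Integration.integral_cong simp: zero_less_mult_iff mult_ac split: split_indicator)
qed

lemma integrable_square_exp: "integrable lborel (\<lambda>t::real. t\<^sup>2 * exp (- t\<^sup>2 / 4))"
proof -
  have "integrable lborel (\<lambda>t. sqrt (4 * pi) * (normal_density 0 (sqrt 2) t * (t - 0) ^ 2))"
    by (intro integrable_mult_right integrable_normal_moment) simp
  also have "(\<lambda>t. sqrt (4 * pi) * (normal_density 0 (sqrt 2) t * (t - 0) ^ 2)) = (\<lambda>t::real. t\<^sup>2 * exp (- t\<^sup>2 / 4))"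
    by (auto simp: normal_density_def fun_eq_iff)
  finally show ?thesis .
qed

text \<open>The Gaussian comparison law keeps the variance \<phi>''(h). Replacing it by 1 would cost
  order h \<tau>, too much for an additive error; that step is done later, on \<open>mills\<close>,
  with relative error.\<close>

lemma tilted_berry_esseen:
  "\<exists>C>0. \<forall>F \<tau> \<phi> h x. A1_distribution F \<tau> 1 \<phi> \<longrightarrow> \<bar>h\<bar> * \<tau> \<le> 1 / 4 \<longrightarrow>
     \<bar>cdf (tilted F \<phi> h) x - cdf (distr gauss borel (\<lambda>x. sqrt (Re (deriv (deriv \<phi>) (of_real h))) * x)) x\<bar> \<le> C * \<tau>"
proof -
  obtain C where C: "C > 0" and smoothing: "\<And>M N T A g x. rdist M \<Longrightarrow> rdist N \<Longrightarrow> T > 0 \<Longrightarrow> A \<ge> 0 \<Longrightarrow>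
     (\<And>x y. x \<le> y \<Longrightarrow> cdf N y - cdf N x \<le> A * (y - x)) \<Longrightarrow>
     integrable lborel g \<Longrightarrow> (\<And>t. \<bar>t\<bar> \<le> T \<Longrightarrow> cmod (char M t - char N t) \<le> \<bar>t\<bar> * g t) \<Longrightarrow> (\<And>t. 0 \<le> g t) \<Longrightarrow>
     \<bar>cdf M x - cdf N x\<bar> \<le> C * ((\<integral>t. g t \<partial>lborel) + A / T)"
    using esseen_smoothing by metis
  define J where "J = (\<integral>t. (t::real)\<^sup>2 * exp (- t\<^sup>2 / 4) \<partial>lborel)"
  have J: "J \<ge> 0" unfolding J_def by (intro integral_nonneg_AE) auto
  show ?thesis
  proof (intro exI[of _ "C * (J / 2 + 8)"] conjI allI impI)
    show "0 < C * (J / 2 + 8)" using C J by simp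
    fix F \<tau> \<phi> h x assume "A1_distribution F \<tau> 1 \<phi>" and h: "\<bar>h\<bar> * \<tau> \<le> 1 / 4"
    then interpret A1_distribution F \<tau> 1 \<phi> by simp
    have "\<bar>h\<bar> * \<tau> < 1" using h by linarith
    then have h': "\<bar>h\<bar> < 1 / \<tau>" using \<tau>_pos by (simp add: field_simps)
    define s where "s = Re (deriv (deriv \<phi>) (of_real h))"
    have s34: "s \<ge> 3 / 4"
      using deriv2_\<phi>_real_bound[OF h'] h unfolding s_def by (auto simp: mult.commute)
    have "1 / 2 \<le> sqrt s" using s34 by (intro real_le_rsqrt) (auto simp: power2_eq_square)
    moreover have "sqrt s > 0" using s34 by simp
    ultimately have ss: "sqrt s > 0" "1 / sqrt s \<le> 2" by (simp_all add: divide_le_eq)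
    let ?N = "distr gauss borel (\<lambda>x. sqrt s * x)"
    \<comment> \<open>Smoothing is applied with T = 1/(4 \<tau>) and Lipschitz constant A = 2,
      available since 1/sqrt s <= 2; so A/T = 8 \<tau>.\<close>
    have "\<bar>cdf (tilted F \<phi> h) x - cdf ?N x\<bar> \<le> C * ((\<integral>t. \<tau> / 2 * (t\<^sup>2 * exp (- t\<^sup>2 / 4)) \<partial>lborel) + 2 / (1 / (4 * \<tau>)))"
    proof (rule smoothing)
      show "rdist (tilted F \<phi> h)" by (rule tilted_real_distribution[OF h'])
      show "rdist ?N" using ss by (intro scaled_gauss) auto
      fix a b :: real assume ab: "a \<le> b"
      then have ab': "a / sqrt s \<le> b / sqrt s" using ss by (intro divide_right_mono) auto
      then have "cdf ?N b - cdf ?N a \<le> b / sqrt s - a / sqrt s"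
        using gtail_diff[OF ab'] gauss_Ioc_le[OF ab'] ss by (simp add: scaled_gauss gtail_cdf)
      also have "\<dots> = (b - a) * (1 / sqrt s)" by (simp add: diff_divide_distrib)
      also have "\<dots> \<le> (b - a) * 2" using ab ss by (intro mult_left_mono) auto
      finally show "cdf ?N b - cdf ?N a \<le> 2 * (b - a)" by simp
    next
      show "integrable lborel (\<lambda>t. \<tau> / 2 * (t\<^sup>2 * exp (- t\<^sup>2 / 4)))"
        by (intro integrable_mult_right integrable_square_exp)
      fix t :: real
      show "0 \<le> \<tau> / 2 * (t\<^sup>2 * exp (- t\<^sup>2 / 4))" using \<tau>_pos by simp
      assume "\<bar>t\<bar> \<le> 1 / (4 * \<tau>)"
      from char_tilted_approx[OF refl h this] ss s34
      show "cmod (char (tilted F \<phi> h) t - char ?N t) \<le> \<bar>t\<bar> * (\<tau> / 2 * (t\<^sup>2 * exp (- t\<^sup>2 / 4)))"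
        by (simp add: scaled_gauss s_def)
    qed (use \<tau>_pos in auto)
    also have "\<dots> = C * (J / 2 + 8) * \<tau>"
      by (simp add: J_def algebra_simps)
    finally show "\<bar>cdf (tilted F \<phi> h) x - cdf (distr gauss borel (\<lambda>x. sqrt (Re (deriv (deriv \<phi>) (of_real h))) * x)) x\<bar>
      \<le> C * (J / 2 + 8) * \<tau>" unfolding s_def .
  qed
qed

subsection \<open>Tail comparison\<close>

text \<open>\<open>mills\<close> decreases while s \<open>mills\<close> s increases, so scaling the
  argument by q changes \<open>mills\<close> by a factor between 1 and 1/q. Here q = sqrt s lies
  within r of 1, and 1/(1 - r) <= 1 + 2r.\<close>

lemma mills_perturb:
  assumes h: "h \<ge> 0" and r: "0 \<le> r" "r \<le> 1 / 4" and s: "\<bar>s - 1\<bar> \<le> r"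
  shows "(1 - r) * mills h \<le> mills (h * sqrt s)" "mills (h * sqrt s) \<le> (1 + 2 * r) * mills h"
proof -
  have s0: "s > 0" using r s by linarith
  have m0: "mills h \<ge> 0" "mills (h * sqrt s) \<ge> 0" using mills_pos[of h] mills_pos[of "h * sqrt s"] h s0 by auto
  have "(1 - r) * mills h \<le> mills (h * sqrt s) \<and> mills (h * sqrt s) \<le> (1 + 2 * r) * mills h"
  proof (cases "h = 0")
    case True
    then show ?thesis using m0 r by (simp add: ring_distribs)
  next
    case False
    with h have h: "h > 0" by simp
    show ?thesis
    proof (cases "s \<ge> 1")
      case True
      have "1 * 1 \<le> sqrt s * 1" using True by simp
      then have "h * 1 \<le> h * sqrt s" using h by (intro mult_left_mono) auto
      then have le: "h \<le> h * sqrt s" by simp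
      have sq: "sqrt s \<le> 1 + r"
      proof (rule real_le_lsqrt)
        have "s \<le> 1 + 2 * r" using s r by linarith
        also have "\<dots> \<le> (1 + r)\<^sup>2" by (simp add: power2_eq_square algebra_simps)
        finally show "s \<le> (1 + r)\<^sup>2" .
      qed (use r in simp)
      have "h * mills h \<le> (h * sqrt s) * mills (h * sqrt s)"
        by (rule mills_times_mono[OF h le])
      then have "mills h \<le> sqrt s * mills (h * sqrt s)" using h by simp
      also have "\<dots> \<le> (1 + r) * mills (h * sqrt s)" using sq m0 by (intro mult_right_mono) auto
      finally have "(1 - r) * mills h \<le> (1 - r) * ((1 + r) * mills (h * sqrt s))"
        using r by (intro mult_left_mono) auto
      also have "\<dots> = (1 - r * r) * mills (h * sqrt s)" by (simp add: algebra_simps)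
      also have "\<dots> \<le> 1 * mills (h * sqrt s)" using m0 by (intro mult_right_mono) auto
      finally have "(1 - r) * mills h \<le> mills (h * sqrt s)" by simp
      moreover have "mills (h * sqrt s) \<le> mills h" using h le by (intro mills_antimono) auto
      moreover have "1 * mills h \<le> (1 + 2 * r) * mills h" using r m0 by (intro mult_right_mono) auto
      ultimately show ?thesis by simp
    next
      case False
      have ss: "sqrt s \<le> 1" "sqrt s > 0" using False s0 by auto
      then have le: "h * sqrt s \<le> h" using h by (simp add: mult_le_cancel_left1)
      have sq: "sqrt s \<ge> 1 - r"
      proof -
        have "s = sqrt s * sqrt s" using s0 by simp
        also have "\<dots> \<le> sqrt s * 1" using ss by (intro mult_left_mono) auto
        finally show ?thesis using s by linarith
      qed
      have "(h * sqrt s) * mills (h * sqrt s) \<le> h * mills h"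
        using h ss by (intro mills_times_mono le) auto
      then have "sqrt s * mills (h * sqrt s) \<le> mills h" using h by (simp add: mult.assoc)
      moreover have "(1 - r) * mills (h * sqrt s) \<le> sqrt s * mills (h * sqrt s)"
        using sq m0 by (intro mult_right_mono) auto
      ultimately have "(1 - r) * mills (h * sqrt s) \<le> mills h" by linarith
      then have "(1 + 2 * r) * ((1 - r) * mills (h * sqrt s)) \<le> (1 + 2 * r) * mills h"
        using r by (intro mult_left_mono) auto
      moreover have "1 \<le> (1 + 2 * r) * (1 - r)"
      proof -
        have "0 \<le> r * (1 - 2 * r)" using r by (intro mult_nonneg_nonneg) auto
        then show ?thesis by (simp add: algebra_simps)
      qed
      then have "1 * mills (h * sqrt s) \<le> (1 + 2 * r) * (1 - r) * mills (h * sqrt s)"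
        using m0 by (intro mult_right_mono) auto
      moreover have "mills h \<le> mills (h * sqrt s)" using h ss le by (intro mills_antimono) auto
      moreover have "(1 - r) * mills h \<le> 1 * mills h" using r m0 by (intro mult_right_mono) auto
      ultimately show ?thesis by (simp add: mult.assoc)
    qed
  qed
  then show "(1 - r) * mills h \<le> mills (h * sqrt s)" "mills (h * sqrt s) \<le> (1 + 2 * r) * mills h"
    by auto
qed

text \<open>Two relative errors are combined: the change of variance from \<phi>''(h) to 1 costs
  order h \<tau>, and the Berry-Esseen error becomes relative through the lower bound for
  \<open>mills\<close>.\<close>

lemma tail_saddlepoint:
  "\<exists>C\<ge>1. \<forall>F \<tau> \<phi> h. A1_distribution F \<tau> 1 \<phi> \<longrightarrow> 0 \<le> h \<longrightarrow> h * \<tau> \<le> 1 / 4 \<longrightarrow>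
     \<bar>measure F {Re (deriv \<phi> (of_real h))<..} - exp (Re (\<phi> (of_real h)) - h * Re (deriv \<phi> (of_real h))) * mills h\<bar>
       \<le> C * \<tau> * (1 + h) * (exp (Re (\<phi> (of_real h)) - h * Re (deriv \<phi> (of_real h))) * mills h)"
proof -
  obtain C where C: "C > 0" and BE: "\<And>F \<tau> \<phi> h x. A1_distribution F \<tau> 1 \<phi> \<Longrightarrow> \<bar>h\<bar> * \<tau> \<le> 1 / 4 \<Longrightarrow>
     \<bar>cdf (tilted F \<phi> h) x - cdf (distr gauss borel (\<lambda>x. sqrt (Re (deriv (deriv \<phi>) (of_real h))) * x)) x\<bar> \<le> C * \<tau>"
    using tilted_berry_esseen by metis
  define c where "c = exp (- 1) * std_normal_density 1"
  have c: "c > 0" by (simp add: c_def normal_density_pos)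
  show ?thesis
  proof (intro exI[of _ "2 + 2 * C / c"] conjI allI impI)
    show "1 \<le> 2 + 2 * C / c" using C c by simp
    fix F \<tau> \<phi> h assume "A1_distribution F \<tau> 1 \<phi>" and h0: "0 \<le> (h::real)" and h: "h * \<tau> \<le> 1 / 4"
    then interpret A1_distribution F \<tau> 1 \<phi> by simp
    have "\<bar>h\<bar> * \<tau> < 1" using h h0 by simp
    then have h': "\<bar>h\<bar> < 1 / \<tau>" using \<tau>_pos by (simp add: field_simps)
    define s where "s = Re (deriv (deriv \<phi>) (of_real h))"
    define W where "W = exp (Re (\<phi> (of_real h)) - h * Re (deriv \<phi> (of_real h)))"
    have s: "\<bar>s - 1\<bar> \<le> h * \<tau>"
      using deriv2_\<phi>_real_bound[OF h'] h0 unfolding s_def by (simp add: mult.commute)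
    then have s0: "s > 0" using h by linarith
    have "\<bar>(\<integral>u. indicator {0<..} u * exp (- h * u) \<partial>tilted F \<phi> h)
        - (\<integral>u. indicator {0<..} u * exp (- h * u) \<partial>distr gauss borel (\<lambda>x. sqrt s * x))\<bar> \<le> 2 * (C * \<tau>)"
      unfolding s_def using h h0 s0
      by (intro laplace_cdf_bound tilted_real_distribution h' scaled_gauss BE) (auto intro: A1_distribution_axioms simp: s_def)
    then have 1: "\<bar>(\<integral>u. indicator {0<..} u * exp (- h * u) \<partial>tilted F \<phi> h) - mills (h * sqrt s)\<bar> \<le> 2 * (C * \<tau>)"
      by (simp only: scaled_gauss(4)[OF real_sqrt_gt_zero[OF s0]])
    have r: "0 \<le> h * \<tau>" using h0 \<tau>_pos by simp
    have "\<bar>mills (h * sqrt s) - mills h\<bar> \<le> 2 * (h * \<tau>) * mills h"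
      using mills_perturb[OF h0 r h s] mult_nonneg_nonneg[OF r less_imp_le[OF mills_pos[OF h0]]]
      by (simp add: ring_distribs abs_le_iff)
    also have "\<dots> \<le> 2 * \<tau> * (1 + h) * mills h"
      using h0 \<tau>_pos mills_pos[OF h0] by (intro mult_right_mono) (auto simp: ring_distribs)
    finally have 2: "\<bar>mills (h * sqrt s) - mills h\<bar> \<le> 2 * \<tau> * (1 + h) * mills h" .
    \<comment> \<open>This converts the additive error 2 C \<tau> into a multiple of
      \<open>mills h\<close> at the price of a factor 1 + h.\<close>
    have "c \<le> (1 + h) * mills h" unfolding c_def by (rule mills_lower[OF h0])
    then have "2 * C * \<tau> / c * c \<le> 2 * C * \<tau> / c * ((1 + h) * mills h)"
      using C c \<tau>_pos by (intro mult_left_mono) auto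
    then have "2 * (C * \<tau>) \<le> 2 * C / c * \<tau> * (1 + h) * mills h"
      using c by simp
    with 1 2 have "\<bar>(\<integral>u. indicator {0<..} u * exp (- h * u) \<partial>tilted F \<phi> h) - mills h\<bar>
        \<le> (2 * \<tau> * (1 + h) * mills h) + (2 * C / c * \<tau> * (1 + h) * mills h)" by linarith
    also have "\<dots> = (2 + 2 * C / c) * \<tau> * (1 + h) * mills h" by (simp add: algebra_simps)
    finally have 3: "\<bar>(\<integral>u. indicator {0<..} u * exp (- h * u) \<partial>tilted F \<phi> h) - mills h\<bar>
        \<le> (2 + 2 * C / c) * \<tau> * (1 + h) * mills h" .
    have "measure F {Re (deriv \<phi> (of_real h))<..} - W * mills h
        = W * ((\<integral>u. indicator {0<..} u * exp (- h * u) \<partial>tilted F \<phi> h) - mills h)"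
      unfolding tail_tilted[OF h'] W_def by (simp add: right_diff_distrib)
    also have "\<bar>\<dots>\<bar> \<le> W * ((2 + 2 * C / c) * \<tau> * (1 + h) * mills h)"
      unfolding abs_mult using 3 by (simp add: W_def)
    finally show "\<bar>measure F {Re (deriv \<phi> (of_real h))<..} - exp (Re (\<phi> (of_real h)) - h * Re (deriv \<phi> (of_real h))) * mills h\<bar>
       \<le> (2 + 2 * C / c) * \<tau> * (1 + h) * (exp (Re (\<phi> (of_real h)) - h * Re (deriv \<phi> (of_real h))) * mills h)"
      unfolding W_def by (simp add: mult_ac)
  qed
qed

lemma one_minus_ge_exp: "0 \<le> e \<Longrightarrow> e \<le> 1 / 2 \<Longrightarrow> exp (- 2 * e) \<le> 1 - e" for e :: real
proof -
  assume e: "0 \<le> e" "e \<le> 1 / 2"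
  have "1 + 2 * e \<le> exp (2 * e)" by (rule exp_ge_add_one_self)
  then have "1 / exp (2 * e) \<le> 1 / (1 + 2 * e)" using e by (intro divide_left_mono) (auto simp: add_pos_nonneg)
  also have "\<dots> \<le> 1 - e"
  proof -
    have "0 \<le> e * (1 - 2 * e)" using e by (intro mult_nonneg_nonneg) auto
    then have "1 \<le> (1 - e) * (1 + 2 * e)" by (simp add: algebra_simps)
    then show ?thesis using e by (simp add: divide_le_eq)
  qed
  finally show ?thesis by (simp add: exp_minus inverse_eq_divide)
qed

text \<open>The saddlepoint prefactor differs from exp(-h^2/2) by a cubic exponent of order \<tau>
  h^3. The smallness condition makes the relative error e at most 1/2, so 1 - e can be bounded below
  by exp(-2e).\<close>

lemma tail_compare:
  "\<exists>C\<ge>4. \<forall>F \<tau> \<phi> h. A1_distribution F \<tau> 1 \<phi> \<longrightarrow> 0 \<le> h \<longrightarrow> C * \<tau> * (1 + h) \<le> 1 \<longrightarrow>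
     exp (- (C * \<tau> * (1 + h) * (1 + h\<^sup>2))) * gtail h \<le> measure F {Re (deriv \<phi> (of_real h))<..} \<and>
     measure F {Re (deriv \<phi> (of_real h))<..} \<le> exp (C * \<tau> * (1 + h) * (1 + h\<^sup>2)) * gtail h"
proof -
  obtain C where C: "C \<ge> 1" and saddle: "\<And>F \<tau> \<phi> h. A1_distribution F \<tau> 1 \<phi> \<Longrightarrow> 0 \<le> h \<Longrightarrow> h * \<tau> \<le> 1 / 4 \<Longrightarrow>
     \<bar>measure F {Re (deriv \<phi> (of_real h))<..} - exp (Re (\<phi> (of_real h)) - h * Re (deriv \<phi> (of_real h))) * mills h\<bar>
       \<le> C * \<tau> * (1 + h) * (exp (Re (\<phi> (of_real h)) - h * Re (deriv \<phi> (of_real h))) * mills h)"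
    using tail_saddlepoint by metis
  show ?thesis
  proof (intro exI[of _ "2 + 2 * C"] allI impI conjI)
    show "4 \<le> 2 + 2 * C" using C by simp
    fix F \<tau> \<phi> h assume A1: "A1_distribution F \<tau> 1 \<phi>" and h0: "0 \<le> (h::real)"
      and small: "(2 + 2 * C) * \<tau> * (1 + h) \<le> 1"
    from A1 interpret A1_distribution F \<tau> 1 \<phi> .
    define e where "e = C * \<tau> * (1 + h)"
    define r where "r = \<tau> * (1 + h)"
    have r0: "r \<ge> 0" unfolding r_def using \<tau>_pos h0 by simp
    have e_r: "e = C * r" unfolding e_def r_def by simp
    have small': "2 * r + 2 * e \<le> 1" using small unfolding e_r r_def by (simp add: algebra_simps)
    have "r \<le> e" unfolding e_r using C r0 by (simp add: mult_le_cancel_right1)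
    with small' have r4: "r \<le> 1 / 4" by linarith
    have e: "0 \<le> e" "e \<le> 1 / 2" using small' r0 \<open>r \<le> e\<close> by linarith+
    have "h * \<tau> \<le> r" unfolding r_def using \<tau>_pos by (simp add: ring_distribs mult.commute)
    then have h: "h * \<tau> \<le> 1 / 4" using r4 by linarith
    then have "\<bar>h\<bar> * \<tau> < 1" using h0 by simp
    then have h': "\<bar>h\<bar> < 1 / \<tau>" using \<tau>_pos by (simp add: field_simps)
    define L m where "L = Re (\<phi> (of_real h))" and "m = Re (deriv \<phi> (of_real h))"
    \<comment> \<open>The deviation of the saddlepoint exponent \<phi>(h) - h \<phi>'(h) from its
      Gaussian value -h^2/2.\<close>
    define q where "q = L - h * m + h\<^sup>2 / 2"
    have "\<bar>L - h\<^sup>2 / 2\<bar> \<le> \<tau> * h ^ 3 / 2" using \<phi>_real_bound[OF h'] h0 unfolding L_def by simp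
    moreover have "\<bar>h * (m - h)\<bar> \<le> h * (\<tau> * h\<^sup>2)"
      unfolding abs_mult using deriv_\<phi>_real_bound[OF h'] h0 unfolding m_def by (intro mult_mono) auto
    moreover have "q = (L - h\<^sup>2 / 2) - h * (m - h)"
      unfolding q_def by (simp add: power2_eq_square algebra_simps)
    ultimately have "\<bar>q\<bar> \<le> \<tau> * h ^ 3 / 2 + h * (\<tau> * h\<^sup>2)" by linarith
    \<comment> \<open>The bracket equals h^2 + h^3. Written as this difference, it leaves a term 1 +
      h in reserve when e is added.\<close>
    also have "\<dots> \<le> 2 * (\<tau> * (h * h\<^sup>2))"
      using \<tau>_pos h0 by (simp add: power2_eq_square power3_eq_cube)
    also have "\<dots> \<le> 2 * (\<tau> * ((1 + h) * (1 + h\<^sup>2) - (1 + h)))"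
      using \<tau>_pos h0 by (intro mult_left_mono) (auto simp: algebra_simps)
    finally have q: "\<bar>q\<bar> \<le> 2 * (\<tau> * ((1 + h) * (1 + h\<^sup>2) - (1 + h)))" .
    have exponent: "\<bar>q\<bar> + 2 * e \<le> (2 + 2 * C) * \<tau> * (1 + h) * (1 + h\<^sup>2)"
    proof -
      have "C * r * 1 \<le> C * r * (1 + h\<^sup>2)" using C r0 by (intro mult_left_mono) auto
      then show ?thesis using q r0 unfolding e_r r_def by (simp add: algebra_simps)
    qed
    define P where "P = measure F {m<..}"
    have W: "exp (L - h * m) * mills h = exp q * gtail h"
      unfolding gtail_mills q_def by (simp add: mult.assoc[symmetric] flip: exp_add)
    have P: "\<bar>P - exp q * gtail h\<bar> \<le> e * (exp q * gtail h)"
      using saddle[OF A1 h0 h] unfolding L_def[symmetric] m_def[symmetric] W P_def e_def .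
    have g: "0 \<le> exp q * gtail h" by (simp add: gtail_nonneg)
    have "exp (- ((2 + 2 * C) * \<tau> * (1 + h) * (1 + h\<^sup>2))) * gtail h \<le> exp (- 2 * e + q) * gtail h"
      using exponent by (intro mult_right_mono gtail_nonneg) auto
    also have "\<dots> = exp (- 2 * e) * (exp q * gtail h)"
      by (simp add: mult.assoc[symmetric] flip: exp_add)
    also have "\<dots> \<le> (1 - e) * (exp q * gtail h)" by (intro mult_right_mono one_minus_ge_exp e g)
    also have "\<dots> \<le> P" using P by (simp add: left_diff_distrib abs_le_iff)
    finally show "exp (- ((2 + 2 * C) * \<tau> * (1 + h) * (1 + h\<^sup>2))) * gtail h \<le> measure F {Re (deriv \<phi> (of_real h))<..}"
      unfolding P_def m_def .
    have "P \<le> (1 + e) * (exp q * gtail h)" using P by (simp add: distrib_right abs_le_iff)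
    also have "\<dots> \<le> exp e * (exp q * gtail h)" by (intro mult_right_mono exp_ge_add_one_self g)
    also have "\<dots> = exp (e + q) * gtail h" by (simp add: mult.assoc[symmetric] flip: exp_add)
    also have "\<dots> \<le> exp ((2 + 2 * C) * \<tau> * (1 + h) * (1 + h\<^sup>2)) * gtail h"
      using exponent e by (intro mult_right_mono gtail_nonneg) auto
    finally show "measure F {Re (deriv \<phi> (of_real h))<..} \<le> exp ((2 + 2 * C) * \<tau> * (1 + h) * (1 + h\<^sup>2)) * gtail h"
      unfolding P_def m_def .
  qed
qed

text \<open>A shift d of the argument gains a factor exp(\<open>shift_const\<close> d (1 + h)); with
  d proportional to \<tau>(1 + h^2) this has the same form as the multiplicative error and offsets
  it.\<close>

lemma tail_shift_tilt:
  "\<exists>K\<ge>4. \<forall>F \<tau> \<phi> h. A1_distribution F \<tau> 1 \<phi> \<longrightarrow> 0 \<le> h \<longrightarrow> K * \<tau> * (1 + h) \<le> 1 \<longrightarrow>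
     gtail (h + K * \<tau> * (1 + h\<^sup>2)) \<le> measure F {Re (deriv \<phi> (of_real h))<..} \<and>
     measure F {Re (deriv \<phi> (of_real h))<..} \<le> gtail (h - K * \<tau> * (1 + h\<^sup>2))"
proof -
  obtain C where C: "C \<ge> 4" and cmp: "\<And>F \<tau> \<phi> h. A1_distribution F \<tau> 1 \<phi> \<Longrightarrow> 0 \<le> h \<Longrightarrow> C * \<tau> * (1 + h) \<le> 1 \<Longrightarrow>
     exp (- (C * \<tau> * (1 + h) * (1 + h\<^sup>2))) * gtail h \<le> measure F {Re (deriv \<phi> (of_real h))<..} \<and>
     measure F {Re (deriv \<phi> (of_real h))<..} \<le> exp (C * \<tau> * (1 + h) * (1 + h\<^sup>2)) * gtail h"
    using tail_compare by metis
  \<comment> \<open>With d = B \<tau>(1 + h^2) the gain in the exponent is exactly C \<tau>(1 + h)(1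
    + h^2).\<close>
  define B where "B = C / shift_const"
  have B: "B \<ge> C" "B \<ge> 4" "shift_const * B = C"
  proof -
    have "C * 1 \<le> C * (1 / shift_const)"
      using C shift_const by (intro mult_left_mono) (auto simp: field_simps)
    then show "B \<ge> C" by (simp add: B_def)
    then show "B \<ge> 4" using C by simp
    show "shift_const * B = C" using shift_const by (simp add: B_def)
  qed
  show ?thesis
  \<comment> \<open>The factor 4 strengthens the smallness condition enough to give d <= 1 for h < 1
    and d <= h/2 for h >= 1; by monotonicity of the tail the larger shift only weakens the
    conclusion.\<close>
  proof (intro exI[of _ "4 * B"] allI impI conjI)
    show "4 \<le> 4 * B" using B by simp
    fix F \<tau> \<phi> h assume A1: "A1_distribution F \<tau> 1 \<phi>" and h0: "0 \<le> (h::real)"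
      and small: "4 * B * \<tau> * (1 + h) \<le> 1"
    from A1 interpret A1_distribution F \<tau> 1 \<phi> .
    define r where "r = \<tau> * (1 + h)"
    have r0: "r \<ge> 0" unfolding r_def using \<tau>_pos h0 by simp
    have small': "4 * (B * r) \<le> 1" using small by (simp add: r_def mult_ac)
    have "C * r \<le> B * r" using B r0 by (intro mult_right_mono) auto
    moreover have "0 \<le> B * r" using B r0 by simp
    ultimately have "C * r \<le> 1" using small' by linarith
    then have hyp: "C * \<tau> * (1 + h) \<le> 1" by (simp add: r_def mult_ac)
    note c = cmp[OF A1 h0 hyp]
    define d where "d = B * \<tau> * (1 + h\<^sup>2)"
    have d0: "d \<ge> 0" unfolding d_def using B \<tau>_pos by (intro mult_nonneg_nonneg) auto
    have d1: "d \<le> 1" if "h < 1"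
    proof -
      have "h\<^sup>2 \<le> h" using that h0 by (simp add: power2_eq_square mult_left_le_one_le)
      then have "d \<le> B * \<tau> * (1 + h)" unfolding d_def using B \<tau>_pos by (intro mult_left_mono) auto
      then show ?thesis using small' \<open>0 \<le> B * r\<close> unfolding r_def by (simp add: mult.assoc)
    qed
    have d2: "d \<le> h / 2" if "h \<ge> 1"
    proof -
      have "1 * 1 \<le> h * h" using that by (intro mult_mono) auto
      then have "1 + h\<^sup>2 \<le> 2 * h * h" by (simp add: power2_eq_square)
      also have "\<dots> \<le> 2 * (1 + h) * h" using h0 by (intro mult_right_mono) auto
      finally have "d \<le> B * \<tau> * (2 * (1 + h) * h)" unfolding d_def using B \<tau>_pos by (intro mult_left_mono) auto
      also have "\<dots> = (4 * (B * r)) * (h / 2)" by (simp add: r_def)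
      also have "\<dots> \<le> 1 * (h / 2)" using small' h0 by (intro mult_right_mono) auto
      finally show ?thesis by simp
    qed
    have ex: "shift_const * d * (1 + h) = C * \<tau> * (1 + h) * (1 + h\<^sup>2)"
      unfolding d_def B(3)[symmetric] by (simp add: mult_ac)
    have d4: "d \<le> 4 * B * \<tau> * (1 + h\<^sup>2)" using d0 unfolding d_def by simp
    have "gtail (h + 4 * B * \<tau> * (1 + h\<^sup>2)) \<le> gtail (h + d)"
      using d4 by (intro gtail_antimono) auto
    also have "\<dots> \<le> exp (- (C * \<tau> * (1 + h) * (1 + h\<^sup>2))) * gtail h"
      using gtail_shift_up[OF h0 d0 d1] unfolding ex by simp
    also have "\<dots> \<le> measure F {Re (deriv \<phi> (of_real h))<..}" using c by simp
    finally show "gtail (h + 4 * B * \<tau> * (1 + h\<^sup>2)) \<le> measure F {Re (deriv \<phi> (of_real h))<..}" .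
    have "measure F {Re (deriv \<phi> (of_real h))<..} \<le> exp (C * \<tau> * (1 + h) * (1 + h\<^sup>2)) * gtail h" using c by simp
    also have "\<dots> \<le> exp (C * \<tau> * (1 + h) * (1 + h\<^sup>2)) * (exp (- (C * \<tau> * (1 + h) * (1 + h\<^sup>2))) * gtail (h - d))"
      using gtail_shift_down[OF h0 d0 d1 d2] unfolding ex by (intro mult_left_mono) auto
    also have "\<dots> = gtail (h - d)" by (simp add: mult.assoc[symmetric] flip: exp_add)
    also have "\<dots> \<le> gtail (h - 4 * B * \<tau> * (1 + h\<^sup>2))"
      using d4 by (intro gtail_antimono) auto
    finally show "measure F {Re (deriv \<phi> (of_real h))<..} \<le> gtail (h - 4 * B * \<tau> * (1 + h\<^sup>2))" .
  qed
qed

text \<open>The intermediate value theorem solves \<phi>'(h) = x with h in [0, 2x]. The discrepancy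
  |x - h| <= \<tau> h^2 has the same order as the shift and is absorbed.\<close>

lemma tail_shift:
  "\<exists>K\<ge>4. \<forall>F \<tau> \<phi> x. A1_distribution F \<tau> 1 \<phi> \<longrightarrow> 0 \<le> x \<longrightarrow> K * \<tau> * (1 + x) \<le> 1 \<longrightarrow>
     gtail (x + K * \<tau> * (1 + x\<^sup>2)) \<le> measure F {x<..} \<and>
     measure F {x<..} \<le> gtail (x - K * \<tau> * (1 + x\<^sup>2))"
proof -
  obtain K where K: "K \<ge> 4" and tail: "\<And>F \<tau> \<phi> h. A1_distribution F \<tau> 1 \<phi> \<Longrightarrow> 0 \<le> h \<Longrightarrow> K * \<tau> * (1 + h) \<le> 1 \<Longrightarrow>
     gtail (h + K * \<tau> * (1 + h\<^sup>2)) \<le> measure F {Re (deriv \<phi> (of_real h))<..} \<and>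
     measure F {Re (deriv \<phi> (of_real h))<..} \<le> gtail (h - K * \<tau> * (1 + h\<^sup>2))"
    using tail_shift_tilt by metis
  show ?thesis
  \<comment> \<open>Since h^2 <= 4 x^2, the old shift contributes 4K and the bound on |x - h|
    contributes 4.\<close>
  proof (rule exI[of _ "4 * K + 4"])
    show "(4 * K + 4 \<ge> 4) \<and> (\<forall>F \<tau> \<phi> x. A1_distribution F \<tau> 1 \<phi> \<longrightarrow> 0 \<le> x \<longrightarrow> (4 * K + 4) * \<tau> * (1 + x) \<le> 1 \<longrightarrow>
     gtail (x + (4 * K + 4) * \<tau> * (1 + x\<^sup>2)) \<le> measure F {x<..} \<and>
     measure F {x<..} \<le> gtail (x - (4 * K + 4) * \<tau> * (1 + x\<^sup>2)))"
    proof (intro conjI[of "4 * K + 4 \<ge> 4"] allI impI)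
      show "4 * K + 4 \<ge> 4" using K by simp
      fix F \<tau> \<phi> x assume A1: "A1_distribution F \<tau> 1 \<phi>" and x0: "0 \<le> (x::real)"
        and small: "(4 * K + 4) * \<tau> * (1 + x) \<le> 1"
      from A1 interpret A1_distribution F \<tau> 1 \<phi> .
      have tx: "0 \<le> \<tau> * x" using \<tau>_pos x0 by simp
      have "K * \<tau> \<ge> 4 * \<tau>" "K * (\<tau> * x) \<ge> 4 * (\<tau> * x)"
        using mult_right_mono[OF K less_imp_le[OF \<tau>_pos]] mult_right_mono[OF K tx] by auto
      moreover have "4 * (K * \<tau>) + 4 * \<tau> + 4 * (K * (\<tau> * x)) + 4 * (\<tau> * x) \<le> 1"
        using small by (simp add: algebra_simps)
      ultimately have ktx: "16 * (\<tau> * x) \<le> 1" and "K * \<tau> + 2 * (K * (\<tau> * x)) \<le> 1"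
        using tx \<tau>_pos by linarith+
      then have K1: "K * \<tau> * (1 + 2 * x) \<le> 1" by (simp add: algebra_simps)
      define m where "m = (\<lambda>h. Re (deriv \<phi> (of_real h)))"
      have dom: "\<bar>h\<bar> < 1 / \<tau>" if "0 \<le> h" "h \<le> 2 * x" for h
      proof -
        have "h * \<tau> \<le> 2 * x * \<tau>" using that \<tau>_pos by (intro mult_right_mono) auto
        then have "h * \<tau> < 1" using ktx tx by (simp add: mult_ac)
        then show ?thesis using that \<tau>_pos by (simp add: field_simps)
      qed
      have mb: "\<bar>m h - h\<bar> \<le> \<tau> * h\<^sup>2" if "0 \<le> h" "h \<le> 2 * x" for h
        using deriv_\<phi>_real_bound[OF dom[OF that]] by (simp add: m_def)
      have "continuous_on {0..2 * x} m"
        unfolding m_def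
        by (intro continuous_intros continuous_on_compose2[OF holomorphic_on_imp_continuous_on[OF holomorphic_deriv[OF holo open_ball]]])
           (use dom in auto)
      moreover have "m 0 \<le> x" using x0 by (simp add: m_def deriv_\<phi>_0)
      \<comment> \<open>At 2x the error \<tau>(2x)^2 is at most x, so \<phi>'(2x) stays above
        x.\<close>
      moreover have "x \<le> m (2 * x)"
      proof -
        have "\<tau> * (2 * x)\<^sup>2 = 4 * (\<tau> * x) * x" by (simp add: power2_eq_square)
        also have "\<dots> \<le> 1 * x" using ktx tx x0 by (intro mult_right_mono) auto
        finally show ?thesis using mb[of "2 * x"] x0 by linarith
      qed
      ultimately obtain h where h: "0 \<le> h" "h \<le> 2 * x" "m h = x"
        using IVT'[of m 0 x "2 * x"] x0 by auto
      have hsq: "h\<^sup>2 \<le> 4 * x\<^sup>2" using power_mono[OF h(2,1), of 2] by (simp add: power_mult_distrib)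
      have "K * \<tau> * (1 + h) \<le> K * \<tau> * (1 + 2 * x)" using h K \<tau>_pos by (intro mult_left_mono) auto
      with K1 have "K * \<tau> * (1 + h) \<le> 1" by linarith
      from tail[OF A1 h(1) this] have t: "gtail (h + K * \<tau> * (1 + h\<^sup>2)) \<le> measure F {x<..}"
        "measure F {x<..} \<le> gtail (h - K * \<tau> * (1 + h\<^sup>2))"
        using h(3) unfolding m_def by auto
      have "\<bar>x - h\<bar> \<le> \<tau> * h\<^sup>2" using mb[OF h(1,2)] h(3) by simp
      also have "\<dots> \<le> \<tau> * (4 * x\<^sup>2)" using hsq \<tau>_pos by (intro mult_left_mono) auto
      finally have xh: "\<bar>x - h\<bar> \<le> \<tau> * (4 * x\<^sup>2)" .
      have "K * \<tau> * (1 + h\<^sup>2) \<le> K * \<tau> * (1 + 4 * x\<^sup>2)" using hsq K \<tau>_pos by (intro mult_left_mono) auto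
      moreover have "K * \<tau> * (1 + 4 * x\<^sup>2) + \<tau> * (4 * x\<^sup>2) \<le> (4 * K + 4) * \<tau> * (1 + x\<^sup>2)"
        using K \<tau>_pos by (simp add: algebra_simps)
      ultimately have "h + K * \<tau> * (1 + h\<^sup>2) \<le> x + (4 * K + 4) * \<tau> * (1 + x\<^sup>2)"
        "x - (4 * K + 4) * \<tau> * (1 + x\<^sup>2) \<le> h - K * \<tau> * (1 + h\<^sup>2)"
        using xh by linarith+
      then show "gtail (x + (4 * K + 4) * \<tau> * (1 + x\<^sup>2)) \<le> measure F {x<..} \<and>
        measure F {x<..} \<le> gtail (x - (4 * K + 4) * \<tau> * (1 + x\<^sup>2))"
        using t order_trans[OF gtail_antimono t(1)] order_trans[OF t(2) gtail_antimono] by blast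
    qed
  qed
qed

subsection \<open>Quantile coupling\<close>

text \<open>The open and the closed half-line both occur because \<open>F\<close> may have atoms:
  the Gaussian level lies inside the jump of the tail of \<open>F\<close> at x.\<close>

definition quantile_related :: "real measure \<Rightarrow> real \<Rightarrow> real \<Rightarrow> bool" where
  "quantile_related F x y \<longleftrightarrow> measure F {x<..} \<le> gtail y \<and> gtail y \<le> measure F {x..}"

text \<open>Both variables are generalised inverses evaluated at the same uniform \<omega> in (0,
  1). Then 1 - \<omega> lies between the open and closed tails of \<open>F\<close>, and equals the
  Gaussian tail because that law has no atoms.\<close>

lemma quantile_coupling:
  assumes F: "rdist F"
  shows "\<exists>(\<Omega> :: real measure) X Y. prob_space \<Omega> \<and> X \<in> borel_measurable \<Omega> \<and> Y \<in> borel_measurable \<Omega> \<and>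
    distr \<Omega> borel X = F \<and> distr \<Omega> borel Y = gauss \<and> (\<forall>\<omega>\<in>space \<Omega>. quantile_related F (X \<omega>) (Y \<omega>))"
proof -
  interpret F: cdf_distribution F unfolding cdf_distribution_def by (rule F)
  interpret G: cdf_distribution gauss unfolding cdf_distribution_def by (rule real_dist_normal_dist)
  define \<Omega> where "\<Omega> = (restrict_space lborel {0<..<1} :: real measure)"
  have space: "space \<Omega> = {0<..<1}" by (simp add: \<Omega>_def space_restrict_space)
  have meas: "measurable \<Omega> borel = measurable (restrict_space borel {0<..<1}) borel"
    unfolding \<Omega>_def by (intro measurable_cong_sets sets_restrict_space_cong) auto
  have "prob_space \<Omega>"
    unfolding \<Omega>_def by (auto simp: emeasure_restrict_space space_restrict_space intro!: prob_spaceI)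
  moreover have "F.I \<in> borel_measurable \<Omega>" "G.I \<in> borel_measurable \<Omega>"
    unfolding meas by (rule F.measurable_CI G.measurable_CI)+
  moreover have "distr \<Omega> borel F.I = F" "distr \<Omega> borel G.I = gauss"
    unfolding \<Omega>_def by (rule F.distr_I_eq_M G.distr_I_eq_M)+
  moreover have "quantile_related F (F.I \<omega>) (G.I \<omega>)" if \<omega>: "\<omega> \<in> space \<Omega>" for \<omega>
  proof -
    have lower: "\<omega> \<le> cdf K (right_continuous_mono.I (cdf K) \<omega>)"
      and upper: "measure K {..<right_continuous_mono.I (cdf K) \<omega>} \<le> \<omega>" if "cdf_distribution K" for K
    proof -
      interpret K: cdf_distribution K by (rule that)
      have \<omega>': "0 < \<omega>" "\<omega> < 1" using \<omega> by (auto simp: space)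
      show "\<omega> \<le> cdf K (K.I \<omega>)" using K.pseudoinverse[OF \<omega>'] by blast
      have "cdf K x \<le> \<omega>" if "x < K.I \<omega>" for x
        using K.pseudoinverse[OF \<omega>', of x] that by auto
      then have "eventually (\<lambda>x. cdf K x \<le> \<omega>) (at_left (K.I \<omega>))"
        by (auto simp: eventually_at_left_real eventually_at_filter)
      then show "measure K {..<K.I \<omega>} \<le> \<omega>"
        by (intro tendsto_upperbound[OF K.cdf_at_left]) auto
    qed
    have compl1: "measure K {x<..} = 1 - cdf K x" and compl2: "measure K {x..} = 1 - measure K {..<x}"
      if "rdist K" for K x
    proof -
      interpret K: Distribution_Functions.real_distribution K by (rule that)
      have "space K - {..x} = {x<..}" "space K - {..<x} = {x..}" by auto
      then show "measure K {x<..} = 1 - cdf K x" "measure K {x..} = 1 - measure K {..<x}"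
        using K.prob_compl[of "{..x}"] K.prob_compl[of "{..<x}"] by (auto simp: cdf_def)
    qed
    have "gtail (G.I \<omega>) \<le> 1 - \<omega>"
      using lower[OF G.cdf_distribution_axioms] by (simp add: gtail_cdf)
    moreover have "gtail (G.I \<omega>) \<ge> 1 - \<omega>"
      using upper[OF G.cdf_distribution_axioms] by (simp add: gtail_cdf cdf_gauss_lessThan)
    ultimately show ?thesis
      using lower[OF F.cdf_distribution_axioms] upper[OF F.cdf_distribution_axioms]
      by (auto simp: quantile_related_def compl1 compl2 F)
  qed
  ultimately show ?thesis by blast
qed

text \<open>Reflection exchanges the two inequalities, which reduces negative x to positive x. The
  map is written with the factor -1 to match the rescaling of the class.\<close>

lemma quantile_related_uminus:
  assumes F: "rdist F" and rel: "quantile_related F x y"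
  shows "quantile_related (distr F borel (\<lambda>x. - 1 * x)) (- x) (- y)"
proof -
  interpret F: Distribution_Functions.real_distribution F by (rule F)
  have "measure (distr F borel (\<lambda>x. - 1 * x)) {-x<..} = measure F {..<x}"
    by (subst measure_distr) (auto intro!: arg_cong[of _ _ "measure F"])
  moreover have "measure (distr F borel (\<lambda>x. - 1 * x)) {-x..} = measure F {..x}"
    by (subst measure_distr) (auto intro!: arg_cong[of _ _ "measure F"])
  moreover have "measure F {x<..} = 1 - measure F {..x}" "measure F {x..} = 1 - measure F {..<x}"
  proof -
    have "space F - {..x} = {x<..}" "space F - {..<x} = {x..}" by auto
    then show "measure F {x<..} = 1 - measure F {..x}" "measure F {x..} = 1 - measure F {..<x}"
      using F.prob_compl[of "{..x}"] F.prob_compl[of "{..<x}"] by auto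
  qed
  ultimately show ?thesis using rel by (simp add: quantile_related_def gtail_uminus)
qed

lemma A1_uminus:
  assumes "A1_distribution F \<tau> v \<phi>"
  shows "A1_distribution (distr F borel (\<lambda>x. - 1 * x)) \<tau> v (\<lambda>z. \<phi> (of_real (- 1) * z))"
  using A1_distribution.A1_scale[OF assms, of "-1"] by simp

text \<open>As the Gaussian tail is strictly decreasing, the shift estimates become inequalities
  between arguments. The error must be in terms of y, whose law is Gaussian, so x^2 is traded for
  y^2. Beyond the range of the estimates only a lower bound on |y| is kept.\<close>

lemma quantile_distance:
  "\<exists>K\<ge>4. \<forall>F \<tau> \<phi> x y. A1_distribution F \<tau> 1 \<phi> \<longrightarrow> K * \<tau> \<le> 1 / 4 \<longrightarrow> quantile_related F x y \<longrightarrow>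
     (if \<bar>x\<bar> \<le> 1 / (4 * K * \<tau>) then \<bar>x - y\<bar> \<le> (K + 1) * \<tau> * (3 + 8 * y\<^sup>2) else \<bar>y\<bar> \<ge> 1 / (8 * K * \<tau>))"
proof -
  obtain K where K: "K \<ge> 4" and tail: "\<And>F \<tau> \<phi> x. A1_distribution F \<tau> 1 \<phi> \<Longrightarrow> 0 \<le> x \<Longrightarrow> K * \<tau> * (1 + x) \<le> 1 \<Longrightarrow>
     gtail (x + K * \<tau> * (1 + x\<^sup>2)) \<le> measure F {x<..} \<and>
     measure F {x<..} \<le> gtail (x - K * \<tau> * (1 + x\<^sup>2))"
    using tail_shift by metis
  have U: "y \<le> x + K * \<tau> * (1 + x\<^sup>2)"
    if "A1_distribution F \<tau> 1 \<phi>" "0 \<le> x" "K * \<tau> * (1 + x) \<le> 1" "quantile_related F x y" for F \<tau> \<phi> x y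
    using tail[OF that(1-3)] that(4) order_trans[of "gtail (x + K * \<tau> * (1 + x\<^sup>2))" _ "gtail y"]
    unfolding quantile_related_def gtail_le_iff by blast
  \<comment> \<open>The relation controls the closed tail at x, whereas the estimates concern open
    tails; so they are applied at a point strictly to the left.\<close>
  have L: "x' - K * \<tau> * (1 + x'\<^sup>2) \<le> y"
    if A1: "A1_distribution F \<tau> 1 \<phi>" and x: "0 \<le> x'" "x' < x" "K * \<tau> * (1 + x') \<le> 1" and rel: "quantile_related F x y"
    for F \<tau> \<phi> x x' y
  proof -
    interpret A1_distribution F \<tau> 1 \<phi> by (rule A1)
    have "gtail y \<le> measure F {x..}" using rel by (simp add: quantile_related_def)
    also have "\<dots> \<le> measure F {x'<..}" using x by (intro finite_measure_mono) auto
    also have "\<dots> \<le> gtail (x' - K * \<tau> * (1 + x'\<^sup>2))" using tail[OF A1 x(1,3)] by blast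
    finally show ?thesis by (simp add: gtail_le_iff)
  qed
  define S where "S = (\<lambda>\<tau> x y. if \<bar>x\<bar> \<le> 1 / (4 * K * \<tau>) then \<bar>x - y\<bar> \<le> (K + 1) * \<tau> * (3 + 8 * y\<^sup>2) else \<bar>y\<bar> \<ge> 1 / (8 * K * \<tau>))"
  have pos: "S \<tau> x y" if A1: "A1_distribution F \<tau> 1 \<phi>" and small: "K * \<tau> \<le> 1 / 4" and rel: "quantile_related F x y" and x: "x > 0"
    for F \<tau> \<phi> x y
  proof -
    interpret A1_distribution F \<tau> 1 \<phi> by (rule A1)
    have K0: "K * \<tau> > 0" using K \<tau>_pos by simp
    \<comment> \<open>On [0, b] both K \<tau> and K \<tau> u are at most 1/4, which leaves room in
      the smallness condition.\<close>
    define b where "b = 1 / (4 * K * \<tau>)"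
    have b: "b \<ge> 1" "K * \<tau> * b = 1 / 4" using K0 small by (auto simp: b_def field_simps)
    have dom: "K * \<tau> * (1 + u) \<le> 1" if "0 \<le> u" "u \<le> b" for u
    proof -
      have "K * \<tau> * u \<le> K * \<tau> * b" using that K0 by (intro mult_left_mono) auto
      then show ?thesis using b small by (simp add: ring_distribs)
    qed
    show ?thesis
    proof (cases "x \<le> b")
      case True
      \<comment> \<open>Moving left by at most \<tau> costs no more than the shift itself; it
        accounts for K + 1 in place of K.\<close>
      define x' where "x' = max 0 (x - \<tau>)"
      have x': "0 \<le> x'" "x' < x" "x' \<le> b" "x - \<tau> \<le> x'" using x True \<tau>_pos by (auto simp: x'_def)
      have "K * \<tau> * (1 + x'\<^sup>2) \<le> K * \<tau> * (1 + x\<^sup>2)"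
        using x' K0 by (intro mult_left_mono add_left_mono power_mono) auto
      then have lo: "x - \<tau> - K * \<tau> * (1 + x\<^sup>2) \<le> y"
        using L[OF A1 x'(1,2) dom[OF x'(1,3)] rel] x'(4) by linarith
      have hi: "y \<le> x + K * \<tau> * (1 + x\<^sup>2)"
        using U[OF A1 _ dom rel] x True by auto
      have "\<tau> * 1 \<le> \<tau> * (1 + x\<^sup>2)" using \<tau>_pos by (intro mult_left_mono) auto
      moreover have "(K + 1) * \<tau> * (1 + x\<^sup>2) = K * \<tau> * (1 + x\<^sup>2) + \<tau> * (1 + x\<^sup>2)"
        by (simp add: algebra_simps)
      ultimately have d: "\<bar>x - y\<bar> \<le> (K + 1) * \<tau> * (1 + x\<^sup>2)"
        using lo hi \<tau>_pos by linarith
      have "(K + 1) * \<tau> * x \<le> 2 * (K * \<tau> * b)"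
      proof -
        have "(K + 1) * \<tau> * x \<le> (2 * K) * \<tau> * b"
          using K \<tau>_pos x True b by (intro mult_mono) auto
        then show ?thesis by simp
      qed
      then have half: "(K + 1) * \<tau> * x \<le> 1 / 2" using b by simp
      have "(K + 1) * \<tau> * (1 + x\<^sup>2) = (K * \<tau> + \<tau>) + ((K + 1) * \<tau> * x) * x"
        by (simp add: power2_eq_square algebra_simps)
      also have "\<dots> \<le> (1 / 4 + 1 / 4) + 1 / 2 * x"
      proof (intro add_mono mult_right_mono small half)
        have "1 * \<tau> \<le> K * \<tau>" using K \<tau>_pos by (intro mult_right_mono) auto
        then show "\<tau> \<le> 1 / 4" using small by simp
      qed (use x in auto)
      \<comment> \<open>The shift is at most 1/2 + x/2, so x is bounded in terms of |y| and its
        square can be replaced.\<close>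
      finally have "x \<le> 2 * \<bar>y\<bar> + 1" using d x by linarith
      then have "x\<^sup>2 \<le> (2 * \<bar>y\<bar> + 1)\<^sup>2" using x by (intro power_mono) auto
      also have "\<dots> \<le> 8 * y\<^sup>2 + 2"
      proof -
        have "0 \<le> (2 * \<bar>y\<bar> - 1)\<^sup>2" by simp
        then show ?thesis by (simp add: power2_eq_square algebra_simps)
      qed
      finally have "(K + 1) * \<tau> * (1 + x\<^sup>2) \<le> (K + 1) * \<tau> * (3 + 8 * y\<^sup>2)"
        using K \<tau>_pos by (intro mult_left_mono) auto
      then show ?thesis using d True x unfolding S_def b_def by auto
    next
      case False
      \<comment> \<open>For x beyond the admissible range the estimate at b still bounds y from
        below, by 3b/4 - 1/4 >= b/2.\<close>
      have "b - K * \<tau> * (1 + b\<^sup>2) \<le> y"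
        using False b by (intro L[OF A1 _ _ dom rel]) auto
      moreover have "K * \<tau> * (1 + b\<^sup>2) = K * \<tau> + (K * \<tau> * b) * b"
        by (simp add: power2_eq_square algebra_simps)
      then have "K * \<tau> * (1 + b\<^sup>2) \<le> 1 / 4 + 1 / 4 * b" unfolding b(2) using small by simp
      ultimately have "b / 2 \<le> y" using b(1) by linarith
      then show ?thesis using False x unfolding S_def b_def by auto
    qed
  qed
  show ?thesis
  proof (intro exI[of _ K])
    have "S \<tau> x y" if A1: "A1_distribution F \<tau> 1 \<phi>" and small: "K * \<tau> \<le> 1 / 4" and rel: "quantile_related F x y"
      for F \<tau> \<phi> x y
    proof -
      interpret A1_distribution F \<tau> 1 \<phi> by (rule A1)
      note A1' = A1_uminus[OF A1] and rel' = quantile_related_uminus[OF real_distribution_axioms rel]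
      consider "x > 0" | "x < 0" | "x = 0" by linarith
      then show ?thesis
      proof cases
        case 1
        then show ?thesis by (rule pos[OF A1 small rel])
      next
        case 2
        then have "S \<tau> (- x) (- y)" by (intro pos[OF A1' small rel']) auto
        moreover have "\<bar>- x - - y\<bar> = \<bar>x - y\<bar>" by linarith
        ultimately show ?thesis unfolding S_def by (simp only: abs_minus_cancel power2_minus)
      next
        \<comment> \<open>At 0 there is no admissible point strictly to the left, so the upper
          estimate is used twice, for \<open>F\<close> and for its reflection.\<close>
        case 3
        have K0: "K * \<tau> > 0" using K \<tau>_pos by simp
        have "y \<le> K * \<tau>" using U[OF A1 _ _ rel] 3 small by simp
        moreover have "- y \<le> K * \<tau>" using U[OF A1' _ _ rel'] 3 small by simp
        ultimately have "\<bar>x - y\<bar> \<le> K * \<tau>" using 3 by simp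
        also have "\<dots> \<le> (K + 1) * \<tau> * 1" using \<tau>_pos by (simp add: ring_distribs)
        also have "\<dots> \<le> (K + 1) * \<tau> * (3 + 8 * y\<^sup>2)" using K \<tau>_pos by (intro mult_left_mono) auto
        finally show ?thesis using 3 K0 by (simp add: S_def)
      qed
    qed
    then show "K \<ge> 4 \<and> (\<forall>F \<tau> \<phi> x y. A1_distribution F \<tau> 1 \<phi> \<longrightarrow> K * \<tau> \<le> 1 / 4 \<longrightarrow> quantile_related F x y \<longrightarrow>
     (if \<bar>x\<bar> \<le> 1 / (4 * K * \<tau>) then \<bar>x - y\<bar> \<le> (K + 1) * \<tau> * (3 + 8 * y\<^sup>2) else \<bar>y\<bar> \<ge> 1 / (8 * K * \<tau>)))"
      using K unfolding S_def by blast
  qed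
qed

section \<open>Exponential moments and bounds for the coupling cost\<close>

lemma gauss_exp_square_nn: "(\<integral>\<^sup>+y. ennreal (exp (y\<^sup>2 / 4)) \<partial>gauss) = ennreal (sqrt 2)"
  using gauss_exp_square by (subst nn_integral_eq_integral) auto

text \<open>For h \<tau> < 1 the cubic Taylor remainder is at most v h^2/2, so \<phi>(h) and
  \<phi>(-h) are bounded by v h^2.\<close>

lemma (in A1_distribution) abs_exp_nn:
  assumes h: "0 \<le> h" "h * \<tau> < 1"
  shows "(\<integral>\<^sup>+x. ennreal (exp (h * \<bar>x\<bar>)) \<partial>F) \<le> ennreal (2 * exp (v * h\<^sup>2))"
proof -
  have bound: "(\<integral>x. exp (u * x) \<partial>F) \<le> exp (v * h\<^sup>2)" if u: "\<bar>u\<bar> = h" for u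
  proof -
    have u': "\<bar>u\<bar> < 1 / \<tau>" using h u \<tau>_pos by (simp add: field_simps)
    have "\<tau> * v * \<bar>u\<bar> ^ 3 / 2 = (h * \<tau>) * (v * h\<^sup>2 / 2)"
      by (simp add: u power2_eq_square power3_eq_cube)
    also have "\<dots> \<le> 1 * (v * h\<^sup>2 / 2)" using h v_nonneg by (intro mult_right_mono) auto
    finally have "Re (\<phi> (of_real u)) \<le> v * u\<^sup>2 / 2 + v * h\<^sup>2 / 2"
      using \<phi>_real_bound[OF u'] by linarith
    also have "u\<^sup>2 = h\<^sup>2" using u by (metis power2_abs)
    finally show ?thesis using exp_real[OF u'] by simp
  qed
  have int: "integrable F (\<lambda>x. exp (u * x))" if u: "\<bar>u\<bar> = h" for u
    using h u \<tau>_pos by (intro real_exp_integrable) (simp add: field_simps)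
  have "(\<integral>\<^sup>+x. ennreal (exp (h * \<bar>x\<bar>)) \<partial>F) \<le> (\<integral>\<^sup>+x. ennreal (exp (h * x) + exp (- h * x)) \<partial>F)"
  proof (intro nn_integral_mono ennreal_leI)
    show "exp (h * \<bar>x\<bar>) \<le> exp (h * x) + exp (- h * x)" for x
      by (cases "x \<ge> 0") simp_all
  qed
  also have "\<dots> = ennreal (\<integral>x. exp (h * x) + exp (- h * x) \<partial>F)"
    using int[of h] int[of "- h"] h
    by (intro nn_integral_eq_integral Bochner_Integration.integrable_add) (auto intro: add_nonneg_nonneg)
  also have "(\<integral>x. exp (h * x) + exp (- h * x) \<partial>F) = (\<integral>x. exp (h * x) \<partial>F) + (\<integral>x. exp (- h * x) \<partial>F)"
    using int[of h] int[of "- h"] h by (intro Bochner_Integration.integral_add) auto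
  also have "ennreal \<dots> \<le> ennreal (2 * exp (v * h\<^sup>2))"
    using bound[of h] bound[of "- h"] h by (intro ennreal_leI) auto
  finally show ?thesis .
qed

text \<open>Scaling by 0 produces the point mass, so one description also covers the degenerate
  law.\<close>

lemma normal_distribution_eq:
  assumes "v \<ge> 0"
  shows "normal_distribution 0 v = distr gauss borel (\<lambda>x. sqrt v * x)"
proof (cases "v = 0")
  case True
  have "distr gauss borel (\<lambda>x. 0 :: real) = return borel 0"
    by (rule measure_eqI) (auto simp: emeasure_distr emeasure_return gauss.emeasure_space_1 split: split_indicator)
  then show ?thesis using True by (simp add: normal_distribution_def)
next
  case False
  with assms have s: "sqrt v > 0" by simp
  have "distributed gauss lborel (\<lambda>x. x) (\<lambda>x. ennreal (std_normal_density x))"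
    unfolding distributed_def by (auto simp: distr_id2)
  then have "distributed gauss lborel (\<lambda>x. 0 + sqrt v * x) (\<lambda>x. ennreal (normal_density (0 + sqrt v * 0) (\<bar>sqrt v\<bar> * 1) x))"
    using s by (intro gauss.normal_density_affine) auto
  then have "distr gauss lborel (\<lambda>x. sqrt v * x) = density lborel (\<lambda>x. ennreal (normal_density 0 (sqrt v) x))"
    using s by (simp add: distributed_def)
  moreover have "distr gauss borel (\<lambda>x. sqrt v * x) = distr gauss lborel (\<lambda>x. sqrt v * x)"
    by (intro distr_cong) auto
  ultimately show ?thesis using False by (simp add: normal_distribution_def)
qed

lemma couplingsI:
  fixes X Y :: "'a \<Rightarrow> real"
  assumes "prob_space \<Omega>" and [measurable]: "X \<in> borel_measurable \<Omega>" "Y \<in> borel_measurable \<Omega>"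
    and "distr \<Omega> borel X = F" "distr \<Omega> borel Y = G"
  shows "distr \<Omega> borel (\<lambda>\<omega>. (X \<omega>, Y \<omega>)) \<in> couplings F G"
proof -
  have [measurable]: "(\<lambda>\<omega>. (X \<omega>, Y \<omega>)) \<in> borel_measurable \<Omega>" by (rule borel_measurable_Pair) auto
  have "fst \<in> borel_measurable (borel :: (real \<times> real) measure)" "snd \<in> borel_measurable (borel :: (real \<times> real) measure)"
    by (intro borel_measurable_continuous_onI continuous_intros)+
  then show ?thesis
    using assms by (auto simp: couplings_def distr_distr comp_def intro!: prob_space.prob_space_distr)
qed

text \<open>The infimum is at most the cost of any single coupling, so two random variables with the
  right laws suffice.\<close>

lemma coupling_bound:
  fixes X Y :: "'a \<Rightarrow> real"
  assumes "prob_space \<Omega>" and [measurable]: "X \<in> borel_measurable \<Omega>" "Y \<in> borel_measurable \<Omega>"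
    and "distr \<Omega> borel X = F" "distr \<Omega> borel Y = G"
    and "(\<integral>\<^sup>+\<omega>. ennreal (exp (\<bar>X \<omega> - Y \<omega>\<bar> / b)) \<partial>\<Omega>) \<le> B"
  shows "(INF P \<in> couplings F G. \<integral>\<^sup>+ (x, y). ennreal (exp (\<bar>x - y\<bar> / b)) \<partial>P) \<le> B"
proof -
  have XY: "(\<lambda>\<omega>. (X \<omega>, Y \<omega>)) \<in> borel_measurable \<Omega>" by (rule borel_measurable_Pair) auto
  have "(\<lambda>p. exp (\<bar>fst p - snd p\<bar> / b)) \<in> borel_measurable (borel :: (real \<times> real) measure)"
    unfolding divide_inverse by (intro borel_measurable_continuous_onI continuous_intros)
  then have meas: "(\<lambda>p. ennreal (exp (\<bar>fst p - snd p\<bar> / b))) \<in> borel_measurable (borel :: (real \<times> real) measure)"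
    by (rule measurable_compose[OF _ measurable_ennreal])
  have "(\<integral>\<^sup>+ (x, y). ennreal (exp (\<bar>x - y\<bar> / b)) \<partial>distr \<Omega> borel (\<lambda>\<omega>. (X \<omega>, Y \<omega>)))
      = (\<integral>\<^sup>+\<omega>. ennreal (exp (\<bar>X \<omega> - Y \<omega>\<bar> / b)) \<partial>\<Omega>)"
    unfolding split_beta' using meas by (subst nn_integral_distr[OF XY]) simp_all
  then show ?thesis
    using assms by (intro INF_lower2[OF couplingsI[OF assms(1-5)]]) auto
qed

text \<open>For h = 1/(c \<tau>) the standard deviation times h is at most 1, so each factor has a
  bounded exponential moment. The product bound 6 * 9/2 = 27 is the origin of the condition on c;
  variance 0 falls under this case.\<close>

lemma small_variance_case:
  assumes A1: "A1_distribution F \<tau> v \<phi>" and small: "sqrt v \<le> c * \<tau>" and c: "c \<ge> 27"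
  shows "(INF P \<in> couplings F (normal_distribution 0 v). \<integral>\<^sup>+ (x, y). ennreal (exp (\<bar>x - y\<bar> / (c * \<tau>))) \<partial>P) \<le> ennreal c"
proof -
  interpret A1_distribution F \<tau> v \<phi> by (rule A1)
  interpret P: pair_prob_space F gauss ..
  have sets_eq[measurable_cong]: "sets (F \<Otimes>\<^sub>M gauss) = sets (borel \<Otimes>\<^sub>M borel)"
    by (intro sets_pair_measure_cong) auto
  define h where "h = 1 / (c * \<tau>)"
  have h: "h > 0" "h * \<tau> < 1" "sqrt v * h \<le> 1"
    using c \<tau>_pos small by (auto simp: h_def divide_le_eq)
  have vh: "v * h\<^sup>2 \<le> 1"
  proof -
    have "v * h\<^sup>2 = (sqrt v * h)\<^sup>2" using v_nonneg by (simp add: power_mult_distrib)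
    also have "\<dots> \<le> 1" using h v_nonneg by (intro power_le_one) auto
    finally show ?thesis .
  qed
  have s2: "sqrt 2 \<le> 3 / 2" by (rule real_le_lsqrt) (auto simp: power2_eq_square)
  have e3: "exp (1::real) \<le> 3" by (rule exp_le)
  have F: "(\<integral>\<^sup>+x. ennreal (exp (h * \<bar>x\<bar>)) \<partial>F) \<le> ennreal 6"
  proof -
    have "2 * exp (v * h\<^sup>2) \<le> 6" using vh e3 exp_le_cancel_iff[of "v * h\<^sup>2" 1] by linarith
    then show ?thesis
      by (intro order_trans[OF abs_exp_nn ennreal_leI]) (use h in auto)
  qed
  have G: "(\<integral>\<^sup>+y. ennreal (exp (h * \<bar>sqrt v * y\<bar>)) \<partial>gauss) \<le> ennreal (9 / 2)"
  proof -
    have "(\<integral>\<^sup>+y. ennreal (exp (h * \<bar>sqrt v * y\<bar>)) \<partial>gauss) \<le> (\<integral>\<^sup>+y. ennreal (exp 1) * ennreal (exp (y\<^sup>2 / 4)) \<partial>gauss)"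
    proof (intro nn_integral_mono)
      fix y
      have "h * \<bar>sqrt v * y\<bar> = (sqrt v * h) * \<bar>y\<bar>" using v_nonneg by (simp add: abs_mult)
      also have "\<dots> \<le> 1 * \<bar>y\<bar>" using h by (intro mult_right_mono) auto
      also have "\<dots> \<le> 1 + y\<^sup>2 / 4"
        using zero_le_power2[of "\<bar>y\<bar> / 2 - 1"] by (simp add: power2_eq_square field_simps)
      finally have "exp (h * \<bar>sqrt v * y\<bar>) \<le> exp 1 * exp (y\<^sup>2 / 4)" by (simp flip: exp_add)
      then show "ennreal (exp (h * \<bar>sqrt v * y\<bar>)) \<le> ennreal (exp 1) * ennreal (exp (y\<^sup>2 / 4))"
        by (simp add: ennreal_leI flip: ennreal_mult)
    qed
    also have "\<dots> = ennreal (exp 1 * sqrt 2)"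
      by (subst nn_integral_cmult) (auto simp: gauss_exp_square_nn ennreal_mult)
    also have "\<dots> \<le> ennreal (9 / 2)"
      using mult_mono[OF e3 s2] by (intro ennreal_leI) auto
    finally show ?thesis .
  qed
  show ?thesis
  proof (rule coupling_bound)
    show "prob_space (F \<Otimes>\<^sub>M gauss)" by (rule P.prob_space_axioms)
    show "(\<lambda>p. fst p) \<in> borel_measurable (F \<Otimes>\<^sub>M gauss)" "(\<lambda>p. sqrt v * snd p) \<in> borel_measurable (F \<Otimes>\<^sub>M gauss)"
      by measurable
    have "distr (F \<Otimes>\<^sub>M gauss) F fst = F"
      by (rule gauss.distr_pair_fst)
    then show "distr (F \<Otimes>\<^sub>M gauss) borel (\<lambda>p. fst p) = F"
      by (metis distr_cong M_is_borel)
    have "distr (F \<Otimes>\<^sub>M gauss) gauss snd = gauss"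
    proof (rule measure_eqI)
      fix A assume "A \<in> sets (distr (F \<Otimes>\<^sub>M gauss) gauss snd)"
      then have A: "A \<in> sets gauss" by simp
      have "snd -` A \<inter> space (F \<Otimes>\<^sub>M gauss) = space F \<times> A"
        using sets.sets_into_space[OF A] by (auto simp: space_pair_measure)
      then show "emeasure (distr (F \<Otimes>\<^sub>M gauss) gauss snd) A = emeasure gauss A"
        using A by (simp add: emeasure_distr gauss.emeasure_pair_measure_Times emeasure_space_1[unfolded space_eq_univ])
    qed simp
    then have "distr (distr (F \<Otimes>\<^sub>M gauss) gauss snd) borel (\<lambda>x. sqrt v * x) = normal_distribution 0 v"
      using v_nonneg by (simp add: normal_distribution_eq)
    then show "distr (F \<Otimes>\<^sub>M gauss) borel (\<lambda>p. sqrt v * snd p) = normal_distribution 0 v"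
      by (subst (asm) distr_distr) (auto simp: comp_def)
    have "(\<integral>\<^sup>+p. ennreal (exp (\<bar>fst p - sqrt v * snd p\<bar> / (c * \<tau>))) \<partial>(F \<Otimes>\<^sub>M gauss))
        \<le> (\<integral>\<^sup>+p. ennreal (exp (h * \<bar>fst p\<bar>)) * ennreal (exp (h * \<bar>sqrt v * snd p\<bar>)) \<partial>(F \<Otimes>\<^sub>M gauss))"
    proof (intro nn_integral_mono)
      fix p :: "real \<times> real"
      have "\<bar>fst p - sqrt v * snd p\<bar> / (c * \<tau>) = h * \<bar>fst p - sqrt v * snd p\<bar>" by (simp add: h_def)
      also have "\<dots> \<le> h * (\<bar>fst p\<bar> + \<bar>sqrt v * snd p\<bar>)" using h by (intro mult_left_mono abs_triangle_ineq4) auto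
      finally have "exp (\<bar>fst p - sqrt v * snd p\<bar> / (c * \<tau>)) \<le> exp (h * \<bar>fst p\<bar>) * exp (h * \<bar>sqrt v * snd p\<bar>)"
        by (simp add: distrib_left flip: exp_add)
      then show "ennreal (exp (\<bar>fst p - sqrt v * snd p\<bar> / (c * \<tau>))) \<le> ennreal (exp (h * \<bar>fst p\<bar>)) * ennreal (exp (h * \<bar>sqrt v * snd p\<bar>))"
        by (simp add: ennreal_leI flip: ennreal_mult)
    qed
    also have "\<dots> = (\<integral>\<^sup>+x. \<integral>\<^sup>+y. ennreal (exp (h * \<bar>x\<bar>)) * ennreal (exp (h * \<bar>sqrt v * y\<bar>)) \<partial>gauss \<partial>F)"
      by (subst gauss.nn_integral_fst[symmetric]) auto
    also have "\<dots> = (\<integral>\<^sup>+x. ennreal (exp (h * \<bar>x\<bar>)) \<partial>F) * (\<integral>\<^sup>+y. ennreal (exp (h * \<bar>sqrt v * y\<bar>)) \<partial>gauss)"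
      by (simp add: nn_integral_cmult nn_integral_multc)
    also have "\<dots> \<le> ennreal 6 * ennreal (9 / 2)" by (intro mult_mono F G) auto
    also have "\<dots> = ennreal (6 * (9 / 2))" by (rule ennreal_mult[symmetric]) auto
    also have "\<dots> \<le> ennreal c" using c by (intro ennreal_leI) simp
    finally show "(\<integral>\<^sup>+p. ennreal (exp (\<bar>fst p - sqrt v * snd p\<bar> / (c * \<tau>))) \<partial>(F \<Otimes>\<^sub>M gauss)) \<le> ennreal c" .
  qed
qed

text \<open>Each term on the right has a bounded integral, the first by the Gaussian law and the
  second by the exponential moment bound. The constant 64 (K + 1) makes 8/(c \<tau>) at most 1/(8 K
  \<tau>), as the far region requires, and in the near region cancels K + 1.\<close>

lemma exp_distance_bound:
  fixes K c \<tau> x y :: real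
  assumes K: "K \<ge> 4" and \<tau>: "\<tau> > 0" and c: "c = 64 * (K + 1)"
    and dist: "if \<bar>x\<bar> \<le> 1 / (4 * K * \<tau>) then \<bar>x - y\<bar> \<le> (K + 1) * \<tau> * (3 + 8 * y\<^sup>2) else \<bar>y\<bar> \<ge> 1 / (8 * K * \<tau>)"
  shows "exp (\<bar>x - y\<bar> / (c * \<tau>)) \<le> 4 * exp (y\<^sup>2 / 4) + exp (- 1 / (8 * K * \<tau>)\<^sup>2) * exp (1 / (8 * K * \<tau>) * \<bar>x\<bar>)"
proof -
  have c0: "c > 0" "c \<ge> 64 * K" using K c by auto
  have e3: "exp (1::real) \<le> 3" by (rule exp_le)
  show ?thesis
  proof (cases "\<bar>x\<bar> \<le> 1 / (4 * K * \<tau>)")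
    case True
    then have "\<bar>x - y\<bar> / (c * \<tau>) \<le> (K + 1) * \<tau> * (3 + 8 * y\<^sup>2) / (c * \<tau>)"
      using dist c0 \<tau> by (intro divide_right_mono) auto
    also have "\<dots> = (3 + 8 * y\<^sup>2) / 64" using K \<tau> unfolding c by (simp add: divide_simps)
    also have "\<dots> \<le> 1 + y\<^sup>2 / 4" by (simp add: field_simps)
    finally have "exp (\<bar>x - y\<bar> / (c * \<tau>)) \<le> exp 1 * exp (y\<^sup>2 / 4)" by (simp flip: exp_add)
    also have "\<dots> \<le> 4 * exp (y\<^sup>2 / 4)" using e3 by (intro mult_right_mono) auto
    finally show ?thesis by (simp add: add_increasing2)
  next
    case False
    define h where "h = 1 / (8 * K * \<tau>)"
    define g where "g = 1 / (c * \<tau>)"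
    have h: "h > 0" "g > 0" using K \<tau> c0 by (auto simp: h_def g_def)
    have gh: "8 * g \<le> h"
      using K \<tau> c0 by (simp add: h_def g_def field_simps)
    have y: "h \<le> \<bar>y\<bar>" and x: "2 * h \<le> \<bar>x\<bar>" using False dist by (auto simp: h_def)
    have "\<bar>x - y\<bar> / (c * \<tau>) = g * \<bar>x - y\<bar>" by (simp add: g_def)
    also have "\<dots> \<le> g * (\<bar>x\<bar> + \<bar>y\<bar>)" using h by (intro mult_left_mono abs_triangle_ineq4) auto
    finally have "exp (\<bar>x - y\<bar> / (c * \<tau>)) \<le> exp (g * \<bar>x\<bar>) * exp (g * \<bar>y\<bar>)"
      by (simp add: distrib_left flip: exp_add)
    \<comment> \<open>Squaring separates x from y, whose joint law is not a product, at the price of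
      doubling g.\<close>
    also have "\<dots> \<le> (exp (g * \<bar>x\<bar>))\<^sup>2 + (exp (g * \<bar>y\<bar>))\<^sup>2"
      using sum_squares_bound[of "exp (g * \<bar>x\<bar>)" "exp (g * \<bar>y\<bar>)"]
        mult_pos_pos[OF exp_gt_zero exp_gt_zero, of "g * \<bar>x\<bar>" "g * \<bar>y\<bar>"] by linarith
    also have "\<dots> = exp (2 * g * \<bar>x\<bar>) + exp (2 * g * \<bar>y\<bar>)"
      by (simp add: power2_eq_square mult.assoc flip: exp_add)
    also have "exp (2 * g * \<bar>y\<bar>) \<le> exp (y\<^sup>2 / 4)"
    proof -
      have "8 * g * \<bar>y\<bar> \<le> \<bar>y\<bar> * \<bar>y\<bar>" using gh y by (intro mult_right_mono) auto
      then show ?thesis by (simp add: power2_eq_square)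
    qed
    \<comment> \<open>Raising the exponent from 2g to h while |x| >= 2h gains (h - 2g)|x| >= h^2;
      this factor will cancel the growth of the exponential moment.\<close>
    also have "exp (2 * g * \<bar>x\<bar>) \<le> exp (- h\<^sup>2) * exp (h * \<bar>x\<bar>)"
    proof -
      have "h * h \<le> h / 2 * (2 * h)" by simp
      also have "\<dots> \<le> (h - 2 * g) * \<bar>x\<bar>" using gh h x by (intro mult_mono) auto
      finally have "2 * g * \<bar>x\<bar> \<le> - h\<^sup>2 + h * \<bar>x\<bar>" by (simp add: power2_eq_square algebra_simps)
      then show ?thesis by (simp flip: exp_add)
    qed
    finally have "exp (\<bar>x - y\<bar> / (c * \<tau>)) \<le> exp (- h\<^sup>2) * exp (h * \<bar>x\<bar>) + exp (y\<^sup>2 / 4)" by simp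
    moreover have "- h\<^sup>2 = - 1 / (8 * K * \<tau>)\<^sup>2" by (simp add: h_def power_divide)
    ultimately show ?thesis by (simp add: h_def) (smt (verit) exp_gt_zero)
  qed
qed

theorem theorem1:
  shows "\<exists>c\<^sub>1::real. c\<^sub>1 > 0 \<and>
    (\<forall>(\<tau>::real) (F :: real measure).
       \<tau> > 0 \<longrightarrow> F \<in> class_A1 \<tau> \<longrightarrow> prob_space.expectation F (\<lambda>x. x) = 0 \<longrightarrow>
       (INF P \<in> couplings F (normal_distribution 0 (prob_space.variance F (\<lambda>x. x))).
          \<integral>\<^sup>+ (x, y). ennreal (exp (\<bar>x - y\<bar> / (c\<^sub>1 * \<tau>))) \<partial>P) \<le> ennreal c\<^sub>1)"
proof -
  obtain K where K: "K \<ge> 4" and dist: "\<And>F \<tau> \<phi> x y. A1_distribution F \<tau> 1 \<phi> \<Longrightarrow> K * \<tau> \<le> 1 / 4 \<Longrightarrow> quantile_related F x y \<Longrightarrow>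
     (if \<bar>x\<bar> \<le> 1 / (4 * K * \<tau>) then \<bar>x - y\<bar> \<le> (K + 1) * \<tau> * (3 + 8 * y\<^sup>2) else \<bar>y\<bar> \<ge> 1 / (8 * K * \<tau>))"
    using quantile_distance by metis
  define c where "c = 64 * (K + 1)"
  have c: "c > 0" "c \<ge> 27" "c \<ge> 4 * K" using K by (auto simp: c_def)
  show ?thesis
  proof (intro exI[of _ c] conjI allI impI)
    show "c > 0" by fact
    fix \<tau> :: real and F :: "real measure"
    assume \<tau>: "\<tau> > 0" and F: "F \<in> class_A1 \<tau>" and mean: "prob_space.expectation F (\<lambda>x. x) = 0"
    define v where "v = prob_space.variance F (\<lambda>x. x)"
    obtain \<phi> where A1: "A1_distribution F \<tau> v \<phi>" using class_A1_imp_A1_distribution[OF F \<tau> mean] unfolding v_def by blast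
    interpret A1_distribution F \<tau> v \<phi> by (rule A1)
    have "(INF P \<in> couplings F (normal_distribution 0 v). \<integral>\<^sup>+ (x, y). ennreal (exp (\<bar>x - y\<bar> / (c * \<tau>))) \<partial>P) \<le> ennreal c"
    \<comment> \<open>The threshold is K \<rho> = 1/4 for \<rho> = \<tau>/\<sigma>, the limit of
      validity of the quantile estimate.\<close>
    proof (cases "sqrt v \<le> 4 * K * \<tau>")
      case True
      moreover have "4 * K * \<tau> \<le> c * \<tau>" using c \<tau> by (intro mult_right_mono) auto
      ultimately show ?thesis using c by (intro small_variance_case[OF A1]) auto
    next
      case False
      define \<sigma> where "\<sigma> = sqrt v"
      have "0 < 4 * K * \<tau>" using K \<tau> by simp
      then have \<sigma>: "\<sigma> > 0" using False unfolding \<sigma>_def by linarith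
      then have v: "v = \<sigma>\<^sup>2" using v_nonneg by (simp add: \<sigma>_def)
      define F' where "F' = distr F borel (\<lambda>x. (1 / \<sigma>) * x)"
      define \<rho> where "\<rho> = \<tau> / \<sigma>"
      have \<rho>: "\<rho> > 0" using \<tau> \<sigma> by (simp add: \<rho>_def)
      have A1': "A1_distribution F' \<rho> 1 (\<lambda>z. \<phi> (of_real (1 / \<sigma>) * z))"
        using A1_scale[of "1 / \<sigma>"] \<sigma> by (simp add: F'_def \<rho>_def v power_divide)
      interpret F': A1_distribution F' \<rho> 1 "\<lambda>z. \<phi> (of_real (1 / \<sigma>) * z)" by (rule A1')
      have small: "K * \<rho> \<le> 1 / 4" using False \<sigma> by (simp add: \<rho>_def \<sigma>_def[symmetric] field_simps)
      obtain \<Omega> :: "real measure" and X Y where prob: "prob_space \<Omega>"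
        and XY[measurable]: "X \<in> borel_measurable \<Omega>" "Y \<in> borel_measurable \<Omega>"
        and dX: "distr \<Omega> borel X = F'" and dY: "distr \<Omega> borel Y = gauss"
        and rel: "\<And>\<omega>. \<omega> \<in> space \<Omega> \<Longrightarrow> quantile_related F' (X \<omega>) (Y \<omega>)"
        using quantile_coupling[OF F'.real_distribution_axioms] by blast
      define h where "h = 1 / (8 * K * \<rho>)"
      show ?thesis
      proof (rule coupling_bound[OF prob])
        show "(\<lambda>\<omega>. \<sigma> * X \<omega>) \<in> borel_measurable \<Omega>" "(\<lambda>\<omega>. \<sigma> * Y \<omega>) \<in> borel_measurable \<Omega>"
          by measurable
        have "distr \<Omega> borel (\<lambda>\<omega>. \<sigma> * X \<omega>) = distr F' borel (\<lambda>x. \<sigma> * x)"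
          unfolding dX[symmetric] by (subst distr_distr) (auto simp: comp_def)
        also have "\<dots> = distr F borel (\<lambda>x. x)"
          unfolding F'_def using \<sigma> by (subst distr_distr) (auto simp: comp_def)
        also have "\<dots> = F" by (simp add: distr_id2)
        finally show "distr \<Omega> borel (\<lambda>\<omega>. \<sigma> * X \<omega>) = F" .
        have "distr \<Omega> borel (\<lambda>\<omega>. \<sigma> * Y \<omega>) = distr gauss borel (\<lambda>x. \<sigma> * x)"
          unfolding dY[symmetric] by (subst distr_distr) (auto simp: comp_def)
        then show "distr \<Omega> borel (\<lambda>\<omega>. \<sigma> * Y \<omega>) = normal_distribution 0 v"
          using v_nonneg by (simp add: normal_distribution_eq \<sigma>_def)
        have "(\<integral>\<^sup>+\<omega>. ennreal (exp (\<bar>\<sigma> * X \<omega> - \<sigma> * Y \<omega>\<bar> / (c * \<tau>))) \<partial>\<Omega>)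
            \<le> (\<integral>\<^sup>+\<omega>. ennreal 4 * ennreal (exp ((Y \<omega>)\<^sup>2 / 4)) + ennreal (exp (- h\<^sup>2)) * ennreal (exp (h * \<bar>X \<omega>\<bar>)) \<partial>\<Omega>)"
        proof (intro nn_integral_mono)
          fix \<omega> assume \<omega>: "\<omega> \<in> space \<Omega>"
          have "\<bar>\<sigma> * X \<omega> - \<sigma> * Y \<omega>\<bar> = \<sigma> * \<bar>X \<omega> - Y \<omega>\<bar>"
            using \<sigma> by (simp add: abs_mult flip: right_diff_distrib)
          then have "\<bar>\<sigma> * X \<omega> - \<sigma> * Y \<omega>\<bar> / (c * \<tau>) = \<bar>X \<omega> - Y \<omega>\<bar> / (c * \<rho>)"
            using \<sigma> by (simp add: \<rho>_def)
          moreover have "- h\<^sup>2 = - 1 / (8 * K * \<rho>)\<^sup>2" by (simp add: h_def power_divide)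
          ultimately have "exp (\<bar>\<sigma> * X \<omega> - \<sigma> * Y \<omega>\<bar> / (c * \<tau>))
              \<le> 4 * exp ((Y \<omega>)\<^sup>2 / 4) + exp (- h\<^sup>2) * exp (h * \<bar>X \<omega>\<bar>)"
            using exp_distance_bound[OF K \<rho> c_def dist[OF A1' small rel[OF \<omega>]]] unfolding h_def by simp
          from ennreal_leI[OF this] show "ennreal (exp (\<bar>\<sigma> * X \<omega> - \<sigma> * Y \<omega>\<bar> / (c * \<tau>)))
            \<le> ennreal 4 * ennreal (exp ((Y \<omega>)\<^sup>2 / 4)) + ennreal (exp (- h\<^sup>2)) * ennreal (exp (h * \<bar>X \<omega>\<bar>))"
            by (simp only: ennreal_plus ennreal_mult exp_ge_zero mult_nonneg_nonneg zero_le_numeral)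
        qed
        also have "\<dots> = ennreal 4 * (\<integral>\<^sup>+\<omega>. ennreal (exp ((Y \<omega>)\<^sup>2 / 4)) \<partial>\<Omega>)
            + ennreal (exp (- h\<^sup>2)) * (\<integral>\<^sup>+\<omega>. ennreal (exp (h * \<bar>X \<omega>\<bar>)) \<partial>\<Omega>)"
          by (simp add: nn_integral_add nn_integral_cmult)
        also have "(\<integral>\<^sup>+\<omega>. ennreal (exp ((Y \<omega>)\<^sup>2 / 4)) \<partial>\<Omega>) = (\<integral>\<^sup>+y. ennreal (exp (y\<^sup>2 / 4)) \<partial>gauss)"
          unfolding dY[symmetric] by (subst nn_integral_distr) auto
        also have "\<dots> = ennreal (sqrt 2)" by (rule gauss_exp_square_nn)
        also have "(\<integral>\<^sup>+\<omega>. ennreal (exp (h * \<bar>X \<omega>\<bar>)) \<partial>\<Omega>) = (\<integral>\<^sup>+x. ennreal (exp (h * \<bar>x\<bar>)) \<partial>F')"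
          unfolding dX[symmetric] by (subst nn_integral_distr) auto
        also have "ennreal 4 * ennreal (sqrt 2) + ennreal (exp (- h\<^sup>2)) * (\<integral>\<^sup>+x. ennreal (exp (h * \<bar>x\<bar>)) \<partial>F')
            \<le> ennreal 4 * ennreal (sqrt 2) + ennreal (exp (- h\<^sup>2)) * ennreal (2 * exp (1 * h\<^sup>2))"
          using K \<rho> by (intro add_left_mono mult_left_mono F'.abs_exp_nn) (auto simp: h_def)
        also have "\<dots> = ennreal (4 * sqrt 2 + exp (- h\<^sup>2) * (2 * exp (1 * h\<^sup>2)))"
          by (simp only: ennreal_plus ennreal_mult exp_ge_zero mult_nonneg_nonneg zero_le_numeral real_sqrt_ge_zero)
        \<comment> \<open>The gain from the far region cancels the exponential moment exactly, so
          the bound no longer depends on \<rho>.\<close>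
        also have "exp (- h\<^sup>2) * (2 * exp (1 * h\<^sup>2)) = 2" by (simp add: exp_minus)
        also have "ennreal (4 * sqrt 2 + 2) \<le> ennreal c"
        proof (rule ennreal_leI)
          have "sqrt 2 \<le> 3 / 2" by (rule real_le_lsqrt) (auto simp: power2_eq_square)
          then show "4 * sqrt 2 + 2 \<le> c" using c by simp
        qed
        finally show "(\<integral>\<^sup>+\<omega>. ennreal (exp (\<bar>\<sigma> * X \<omega> - \<sigma> * Y \<omega>\<bar> / (c * \<tau>))) \<partial>\<Omega>) \<le> ennreal c" .
      qed
    qed
    then show "(INF P \<in> couplings F (normal_distribution 0 (prob_space.variance F (\<lambda>x. x))).
          \<integral>\<^sup>+ (x, y). ennreal (exp (\<bar>x - y\<bar> / (c * \<tau>))) \<partial>P) \<le> ennreal c"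
      unfolding v_def .
  qed
qed

end
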